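(* Let $P$ be the Metropolis-Hastings transition kernel on $\mathbb{R}^d$ with target density $\pi$ and proposal density $q$, let $\Phi$ be the Markov chain driven by $P$, and assume that $P$ satisfies assumptions A1, A2, A3 (stated in the context) with drift function $V$. Let $F\in L^\infty_V$ be continuous $\pi$-almost everywhere, and let $(\mathbb{X}_n)_{n\in\mathbb{N}}$, $\mathbb{X}_n=(\mathbb{J}_n,X_n)$ with $\mathbb{J}_n=\{J^n_0,\dots,J^n_{m_n}\}$ and $X_n=\{a^n_j\in J^n_j: j=0,1,\dots,m_n\}$, be a sequence of allotments that is exhaustive with respect to $V$. For each $n\in\mathbb{N}$ let $\tilde F_n:\mathbb{R}^d\to\mathbb{R}$ be the output of the Scheme with input $P$, $F$ and $\mathbb{X}_n$. Then $(\tilde F_n)_{n\in\mathbb{N}}$ asymptotically solves Poisson's equation for $P$ and $F$, i.e. the asymptotic variance $\sigma_n^2$ in the central limit theorem for the ergodic averages of $F+P\tilde F_n-\tilde F_n$ along $\Phi$ satisfies $$\lim_{n\to\infty}\sigma_n^2=0 .$$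
   Context: Metropolis-Hastings kernel: $\pi$ is a probability density on $\mathbb{R}^d$ with respect to Lebesgue measure $\mu^{\mathrm{Leb}}$, and $q:\mathbb{R}^d\times\mathbb{R}^d\to\mathbb{R}$ is a transition density (for every $x$, $y\mapsto q(x,y)$ is a probability density). Put $\alpha(x,y)=\min\left(1,\frac{\pi(y)q(y,x)}{\pi(x)q(x,y)}\right)$ if $\pi(x)q(x,y)>0$ and $\alpha(x,y)=1$ otherwise, and $$P(x,dy)=\alpha(x,y)q(x,y)\,dy+\Big(1-\int_{\mathbb{R}^d}\alpha(x,z)q(x,z)\,dz\Big)\delta_x(dy).$$ The symbol $\pi$ also denotes the probability measure $\pi(x)dx$; $\pi(G)=\int G(x)\pi(x)dx$ and $PG(x)=\int G(y)P(x,dy)$. Assumptions. A1: there is a continuous function $V:\mathbb{R}^d\to[1,\infty)$ with $\pi(V^2)<\infty$, with bounded sublevel sets ($V^{-1}([1,c])$ is bounded for every $c\ge1$), and there are constants $\lambda_V\in(0,1)$, $\kappa_V>0$ and a compact set $C_V\subset\mathbb{R}^d$ with $PV(x)\le\lambda_V V(x)+\kappa_V 1_{C_V}(x)$ for all $x\in\mathbb{R}^d$. A2: $\pi:\mathbb{R}^d\to(0,\infty)$ is continuous and strictly positive. A3: $q:\mathbb{R}^d\times\mathbb{R}^d\to(0,\infty)$ is continuous, strictly positive and bounded. $L^\infty_V$ is the space of measurable $G:\mathbb{R}^d\to\mathbb{R}$ with $\|G\|_V:=\sup_x |G(x)|/V(x)<\infty$. Asymptotic variance: for $H\in L^\infty_V$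 let $S_k(H)=\frac1k\sum_{i=1}^kH(\Phi_i)$. Under A1-A3 the CLT $\sqrt{k}\,(S_k(H)-\pi(H))\to\sigma_H N(0,1)$ in distribution as $k\to\infty$ holds, with $\sigma_H^2$ not depending on the initial distribution; $\sigma_H^2$ is the asymptotic variance. For $G\in L^\infty_V$ one has $PG\in L^\infty_V$ and $\pi(PG-G)=0$. A sequence $(G_n)$ in $L^\infty_V$ asymptotically solves Poisson's equation for $P$ and $F$ if $\sigma^2_{F+PG_n-G_n}\to0$. Allotments: an allotment $\mathbb{X}=(\mathbb{J},X)$ of size $m$ consists of a partition $\mathbb{J}=\{J_0,\dots,J_m\}$ of $\mathbb{R}^d$ into measurable sets with $\bigcup_{j=1}^mJ_j$ bounded and $\mu^{\mathrm{Leb}}(J_j)>0$ for all $0\le j\le m$, and a set of representatives $X=\{a_0,\dots,a_m\}$ with $a_j\in J_j$. For measurable $W:\mathbb{R}^d\to[1,\infty)$ define $\mathrm{rad}(\mathbb{X},W)=\inf_{y\in J_0}W(y)$ and $$\delta(\mathbb{X},W)=\max\Big(\max_{1\le j\le m}\sup_{y\in J_j}|y-a_j|,\ \max_{0\le j\le m}\sup_{y\in J_j}\big(W(a_j)/W(y)-1\big)\Big).$$ A sequence $(\mathbb{X}_n)$ of allotments is exhaustive with respect to $W$ if $\mathrm{rad}(\mathbb{X}_n,W)\to\infty$ and $\delta(\mathbb{X}_n,W)\to0$ as $n\to\infty$. The Scheme with input $P$, $F$, $\mathbb{X}$: (I) let $(p_{\mathbb{X}})_{ij}=P(a_i,J_j)$,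 $0\le i,j\le m$, and $f_{\mathbb{X}}(a_j)=F(a_j)$; (II) let $\hat f_{\mathbb{X}}:X\to\mathbb{R}$ be a solution of $\hat f_{\mathbb{X}}-p_{\mathbb{X}}\hat f_{\mathbb{X}}=f_{\mathbb{X}}-\pi_{\mathbb{X}}(f_{\mathbb{X}})$, where $\pi_{\mathbb{X}}$ is the unique invariant probability measure of the stochastic matrix $p_{\mathbb{X}}$ on $X$ (under A2, A3 all entries of $p_{\mathbb{X}}$ are strictly positive, so a solution exists and is unique up to an additive constant; any solution may be chosen); (III) output $\tilde F_{\mathbb{X}}=\sum_{j=0}^m\hat f_{\mathbb{X}}(a_j)1_{J_j}$. *)

theory Defs
  imports "HOL-Probability.Probability"
begin

text \<open>Throughout, the state space \<open>\<real>\<^sup>d\<close> is a type of class \<open>euclidean_space\<close>, and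
  ``measurable'' means Borel measurable.\<close>

definition prob_density :: "('a::euclidean_space \<Rightarrow> real) \<Rightarrow> bool" where
  "prob_density f \<longleftrightarrow>
     f \<in> borel_measurable borel \<and> (\<forall>x. 0 \<le> f x) \<and> (\<integral>\<^sup>+x. ennreal (f x) \<partial>lborel) = 1"

definition target_measure :: "('a::euclidean_space \<Rightarrow> real) \<Rightarrow> 'a measure" where
  "target_measure \<pi> = density lborel (\<lambda>x. ennreal (\<pi> x))"


subsection \<open>The Metropolis-Hastings kernel\<close>

definition mh_accept ::
  "('a \<Rightarrow> real) \<Rightarrow> ('a \<Rightarrow> 'a \<Rightarrow> real) \<Rightarrow> 'a \<Rightarrow> 'a \<Rightarrow> real" where
  "mh_accept \<pi> q x y =
     (if \<pi> x * q x y > 0 then min 1 ((\<pi> y * q y x) / (\<pi> x * q x y)) else 1)"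

definition mh_kernel ::
  "('a::euclidean_space \<Rightarrow> real) \<Rightarrow> ('a \<Rightarrow> 'a \<Rightarrow> real) \<Rightarrow> 'a \<Rightarrow> 'a measure" where
  "mh_kernel \<pi> q x = measure_of UNIV (sets borel)
     (\<lambda>A. (\<integral>\<^sup>+y\<in>A. ennreal (mh_accept \<pi> q x y * q x y) \<partial>lborel)
        + ennreal (1 - (\<integral>z. mh_accept \<pi> q x z * q x z \<partial>lborel)) * indicator A x)"

lemma space_mh_kernel [simp]: "space (mh_kernel \<pi> q x) = UNIV"
  and sets_mh_kernel [simp]: "sets (mh_kernel \<pi> q x) = sets borel"
  unfolding mh_kernel_def
  using sets.sigma_sets_eq[of "borel :: 'a measure"]
  by (simp_all add: space_measure_of_conv sets_measure_of_conv)

text \<open>\<open>measure_of\<close> returns the null measure on a set function that is not a measure; this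
  does not happen here.\<close>

lemma emeasure_mh_kernel:
  assumes meas: "(\<lambda>y. mh_accept \<pi> q x y * q x y) \<in> borel_measurable borel"
    and A: "A \<in> sets borel"
  shows "emeasure (mh_kernel \<pi> q x) A =
      (\<integral>\<^sup>+y\<in>A. ennreal (mh_accept \<pi> q x y * q x y) \<partial>lborel)
      + ennreal (1 - (\<integral>z. mh_accept \<pi> q x z * q x z \<partial>lborel)) * indicator A x"
proof -
  define f where "f = (\<lambda>y. ennreal (mh_accept \<pi> q x y * q x y))"
  define c where "c = ennreal (1 - (\<integral>z. mh_accept \<pi> q x z * q x z \<partial>lborel))"
  define \<mu> where "\<mu> = (\<lambda>A. (\<integral>\<^sup>+y\<in>A. f y \<partial>lborel) + c * indicator A x)"
  have f: "f \<in> borel_measurable lborel" using meas by (simp add: f_def)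
  have eq: "\<mu> B = emeasure (density lborel f) B + c * emeasure (return borel x) B"
    if "B \<in> sets borel" for B
    using that f by (simp add: \<mu>_def emeasure_density)
  have "countably_additive (sets borel) \<mu>"
  proof (rule countably_additiveI)
    fix B :: "nat \<Rightarrow> 'a set"
    assume B: "range B \<subseteq> sets borel" "disjoint_family B" "(\<Union>i. B i) \<in> sets borel"
    have "(\<Sum>i. emeasure (density lborel f) (B i)) = emeasure (density lborel f) (\<Union>i. B i)"
      using B by (intro suminf_emeasure) auto
    moreover have "(\<Sum>i. emeasure (return borel x) (B i)) = emeasure (return borel x) (\<Union>i. B i)"
      using B by (intro suminf_emeasure) auto
    ultimately show "(\<Sum>i. \<mu> (B i)) = \<mu> (\<Union>i. B i)"
      using B by (subst suminf_cong[OF eq])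
        (auto simp: eq suminf_add[symmetric] range_subsetD)
  qed
  moreover have "positive (sets borel) \<mu>" by (simp add: positive_def \<mu>_def)
  moreover have "mh_kernel \<pi> q x = measure_of UNIV (sets borel) \<mu>"
    by (simp add: mh_kernel_def \<mu>_def f_def c_def)
  ultimately have "emeasure (mh_kernel \<pi> q x) A = \<mu> A"
    using A emeasure_measure_of_sigma[of UNIV "sets borel" \<mu> A]
      sets.sigma_algebra_axioms[of "borel :: 'a measure"] by simp
  then show ?thesis by (simp add: \<mu>_def f_def c_def)
qed


subsection \<open>Markov chains and the asymptotic variance\<close>

text \<open>The last clause is the Markov property
  \<open>P(\<Phi>\<^sub>k\<^sub>+\<^sub>1 \<in> A | \<Phi>\<^sub>0, \<dots>, \<Phi>\<^sub>k) = P(\<Phi>\<^sub>k, A)\<close> almost surely, with the conditional probability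
  unfolded; \<open>B\<close> ranges over the events determined by \<open>\<Phi>\<^sub>0, \<dots>, \<Phi>\<^sub>k\<close>. The law of \<open>\<Phi>\<^sub>0\<close> is
  arbitrary.\<close>

definition markov_chain ::
  "('a::euclidean_space \<Rightarrow> 'a measure) \<Rightarrow> 'w measure \<Rightarrow> (nat \<Rightarrow> 'w \<Rightarrow> 'a) \<Rightarrow> bool" where
  "markov_chain P M \<Phi> \<longleftrightarrow>
     prob_space M \<and>
     (\<forall>i. \<Phi> i \<in> borel_measurable M) \<and>
     (\<forall>k. \<forall>A\<in>sets borel. \<forall>B\<in>sets (PiM {..k} (\<lambda>_. borel)).
        emeasure M {\<omega>\<in>space M. (\<lambda>i\<in>{..k}. \<Phi> i \<omega>) \<in> B \<and> \<Phi> (Suc k) \<omega> \<in> A} =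
        (\<integral>\<^sup>+\<omega>. indicator B (\<lambda>i\<in>{..k}. \<Phi> i \<omega>) * emeasure (P (\<Phi> k \<omega>)) A \<partial>M))"

definition ergodic_average :: "(nat \<Rightarrow> 'w \<Rightarrow> 'a) \<Rightarrow> ('a \<Rightarrow> real) \<Rightarrow> nat \<Rightarrow> 'w \<Rightarrow> real" where
  "ergodic_average \<Phi> H k \<omega> = (1 / real k) * (\<Sum>i=1..k. H (\<Phi> i \<omega>))"

text \<open>\<open>clt_along M \<Phi> \<mu> H v\<close>: the central limit theorem with variance \<open>v\<close>, where \<open>v = 0\<close>
  (a Dirac limit) is allowed.\<close>

definition clt_along ::
  "'w measure \<Rightarrow> (nat \<Rightarrow> 'w \<Rightarrow> 'a) \<Rightarrow> 'a measure \<Rightarrow> ('a \<Rightarrow> real) \<Rightarrow> real \<Rightarrow> bool" where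
  "clt_along M \<Phi> \<mu> H v \<longleftrightarrow>
     0 \<le> v \<and>
     weak_conv_m
       (\<lambda>k. distr M borel (\<lambda>\<omega>. sqrt (real k) * (ergodic_average \<Phi> H k \<omega> - (\<integral>x. H x \<partial>\<mu>))))
       (distr std_normal_distribution borel (\<lambda>z. sqrt v * z))"

text \<open>The one variance with which the central limit theorem holds for every initial
  distribution. Taking \<open>nat \<Rightarrow> 'a\<close> as the type of the sample space is no restriction, as
  every chain has a copy with the same law on the path space.\<close>

definition asymptotic_variance ::
  "('a::euclidean_space \<Rightarrow> 'a measure) \<Rightarrow> 'a measure \<Rightarrow> ('a \<Rightarrow> real) \<Rightarrow> real" where
  "asymptotic_variance P \<mu> H =
     (THE v. \<forall>(M :: (nat \<Rightarrow> 'a) measure) \<Phi>. markov_chain P M \<Phi> \<longrightarrow> clt_along M \<Phi> \<mu> H v)"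

definition L_inf :: "('a::euclidean_space \<Rightarrow> real) \<Rightarrow> ('a \<Rightarrow> real) set" where
  "L_inf V = {G \<in> borel_measurable borel. bdd_above (range (\<lambda>x. \<bar>G x\<bar> / V x))}"

definition poisson_residual ::
  "('a \<Rightarrow> 'a measure) \<Rightarrow> ('a \<Rightarrow> real) \<Rightarrow> ('a \<Rightarrow> real) \<Rightarrow> 'a \<Rightarrow> real" where
  "poisson_residual P F G x = F x + (\<integral>y. G y \<partial>P x) - G x"

definition asymptotically_solves_poisson ::
  "('a::euclidean_space \<Rightarrow> 'a measure) \<Rightarrow> 'a measure \<Rightarrow> ('a \<Rightarrow> real) \<Rightarrow> ('a \<Rightarrow> real)
    \<Rightarrow> (nat \<Rightarrow> 'a \<Rightarrow> real) \<Rightarrow> bool" where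
  "asymptotically_solves_poisson P \<mu> V F G \<longleftrightarrow>
     (\<forall>n. G n \<in> L_inf V) \<and>
     (\<lambda>n. asymptotic_variance P \<mu> (poisson_residual P F (G n))) \<longlonglongrightarrow> 0"

text \<open>The drift inequality is stated with the nonnegative integral: the Bochner integral of a
  non-integrable function is \<open>0\<close>, which would make the inequality trivial.\<close>

definition drift_condition ::
  "('a::euclidean_space \<Rightarrow> 'a measure) \<Rightarrow> 'a measure \<Rightarrow> ('a \<Rightarrow> real) \<Rightarrow> bool" where
  "drift_condition P \<mu> V \<longleftrightarrow>
     continuous_on UNIV V \<and> (\<forall>x. 1 \<le> V x) \<and>
     (\<integral>\<^sup>+x. ennreal ((V x)\<^sup>2) \<partial>\<mu>) < \<infinity> \<and>
     (\<forall>c\<ge>1. bounded (V -` {1..c})) \<and>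
     (\<exists>l k C. 0 < l \<and> l < 1 \<and> 0 < k \<and> compact C \<and>
        (\<forall>x. (\<integral>\<^sup>+y. ennreal (V y) \<partial>P x) \<le> ennreal (l * V x + k * indicator C x)))"


subsection \<open>Allotments and the Scheme\<close>

text \<open>An allotment of size \<open>m\<close> is given by its cells \<open>J 0, \<dots>, J m\<close> and representatives
  \<open>a 0, \<dots>, a m\<close>; the values of \<open>J\<close> and \<open>a\<close> beyond \<open>m\<close> are irrelevant.\<close>

definition allotment :: "nat \<Rightarrow> (nat \<Rightarrow> 'a::euclidean_space set) \<Rightarrow> (nat \<Rightarrow> 'a) \<Rightarrow> bool" where
  "allotment m J a \<longleftrightarrow>
     disjoint_family_on J {..m} \<and> (\<Union>j\<le>m. J j) = UNIV \<and>
     (\<forall>j\<le>m. J j \<in> sets borel \<and> 0 < emeasure lborel (J j) \<and> a j \<in> J j) \<and>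
     bounded (\<Union>j\<in>{1..m}. J j)"

definition allotment_rad :: "(nat \<Rightarrow> 'a set) \<Rightarrow> ('a \<Rightarrow> real) \<Rightarrow> real" where
  "allotment_rad J W = (INF y\<in>J 0. W y)"

text \<open>For an allotment and \<open>W \<ge> 1\<close> the suprema are over nonempty bounded sets of reals. The
  maximum is taken over the union of the two families, since the first is empty if \<open>m = 0\<close>.\<close>

definition allotment_mesh ::
  "nat \<Rightarrow> (nat \<Rightarrow> 'a::euclidean_space set) \<Rightarrow> (nat \<Rightarrow> 'a) \<Rightarrow> ('a \<Rightarrow> real) \<Rightarrow> real" where
  "allotment_mesh m J a W =
     Max ((\<lambda>j. SUP y\<in>J j. norm (y - a j)) ` {1..m}
        \<union> (\<lambda>j. SUP y\<in>J j. W (a j) / W y - 1) ` {0..m})"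

definition exhaustive ::
  "(nat \<Rightarrow> nat) \<Rightarrow> (nat \<Rightarrow> nat \<Rightarrow> 'a::euclidean_space set) \<Rightarrow> (nat \<Rightarrow> nat \<Rightarrow> 'a)
    \<Rightarrow> ('a \<Rightarrow> real) \<Rightarrow> bool" where
  "exhaustive m J a W \<longleftrightarrow>
     filterlim (\<lambda>n. allotment_rad (J n) W) at_top sequentially \<and>
     (\<lambda>n. allotment_mesh (m n) (J n) (a n) W) \<longlonglongrightarrow> 0"

definition scheme_matrix ::
  "('a \<Rightarrow> 'a measure) \<Rightarrow> (nat \<Rightarrow> 'a set) \<Rightarrow> (nat \<Rightarrow> 'a) \<Rightarrow> nat \<Rightarrow> nat \<Rightarrow> real" where
  "scheme_matrix P J a i j = measure (P (a i)) (J j)"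

definition invariant_prob :: "nat \<Rightarrow> (nat \<Rightarrow> nat \<Rightarrow> real) \<Rightarrow> (nat \<Rightarrow> real) \<Rightarrow> bool" where
  "invariant_prob m p w \<longleftrightarrow>
     (\<forall>j\<le>m. 0 \<le> w j) \<and> (\<Sum>j\<le>m. w j) = 1 \<and> (\<forall>j\<le>m. (\<Sum>i\<le>m. w i * p i j) = w j)"

text \<open>A relation rather than a function, as the solution \<open>fh\<close> (relevant only on the
  representatives) is unique only up to an additive constant and any one may be chosen.\<close>

definition scheme_output ::
  "('a \<Rightarrow> 'a measure) \<Rightarrow> ('a \<Rightarrow> real) \<Rightarrow> nat \<Rightarrow> (nat \<Rightarrow> 'a set) \<Rightarrow> (nat \<Rightarrow> 'a)
    \<Rightarrow> ('a \<Rightarrow> real) \<Rightarrow> bool" where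
  "scheme_output P F m J a Ft \<longleftrightarrow>
     (\<exists>w fh. invariant_prob m (scheme_matrix P J a) w \<and>
        (\<forall>i\<le>m. fh (a i) - (\<Sum>j\<le>m. scheme_matrix P J a i j * fh (a j)) =
           F (a i) - (\<Sum>j\<le>m. w j * F (a j))) \<and>
        Ft = (\<lambda>x. \<Sum>j\<le>m. fh (a j) * indicator (J j) x))"

end

theory Submission
  imports Defs
begin

text \<open>Write \<open>P\<close> for the kernel and \<open>\<pi>\<close> for the target measure. For \<open>H\<close> dominated by a multiple of \<open>V\<close>,
  geometric ergodicity in the \<open>V\<close>-norm gives a solution \<open>hh\<close> of \<open>hh - P hh = h\<close> with
  \<open>h = H - \<pi>(H)\<close>, whose size relative to \<open>V\<close> is at most a constant times that of \<open>h\<close>. The central limit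
  theorem holds with variance \<open>\<pi>(h (2 hh - h))\<close>, and this is at most a constant times the \<open>V\<close>-norm
  of \<open>h\<close> times \<open>\<pi>(\<bar>h\<bar> V)\<close>. Since \<open>\<pi>(V\<^sup>2)\<close> is finite and additive constants do not matter, it suffices that
  the residuals, up to constants, are dominated by one multiple of \<open>V\<close> and tend to \<open>0\<close> almost
  everywhere (\<open>asymptotic_variance_tendsto_0\<close>).

  Let \<open>rep n x\<close> be the representative of the cell of \<open>x\<close>. The Scheme says that
  \<open>Ft n x - (P (Ft n)) (rep n x) = F (rep n x) - c n\<close>, so the residual at \<open>x\<close> is \<open>c n\<close> plus
  \<open>F x - F (rep n x)\<close> plus \<open>(P (Ft n)) x - (P (Ft n)) (rep n x)\<close>. Exhaustiveness gives
  \<open>rep n x \<longlonglongrightarrow> x\<close>, so the first difference vanishes in the limit wherever \<open>F\<close> is continuous. In the second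
  difference \<open>Ft n\<close> takes the same value at \<open>x\<close> and \<open>rep n x\<close>, so the atoms of \<open>P\<close> contribute only
  through the continuous rejection probability, and the absolutely continuous parts have continuous
  densities dominated by a multiple of \<open>\<pi>\<close> (\<open>kernel_integral_continuous\<close>).

  The domination uniform in \<open>n\<close> comes from reading the Scheme as Poisson's equation for the kernel that
  sends \<open>x\<close> to the law of \<open>rep n Y\<close> with \<open>Y\<close> distributed as \<open>P (rep n x)\<close>. For large \<open>n\<close> these kernels inherit the drift
  and minorization conditions of \<open>P\<close> with constants independent of \<open>n\<close> (\<open>uniform_harris\<close>), and a kernel
  with these two properties contracts \<open>V\<close>-weighted oscillations at a rate that depends on the
  constants only (\<open>harris_contraction\<close>, the argument of Hairer and Mattingly).

  The central limit theorem is proved through characteristic functions. With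
  \<open>R f = P (exp (i s h) f)\<close> one has \<open>E exp (i s S\<^sub>k) = E (R\<^sup>k 1) (\<Phi> 0)\<close>, where \<open>S\<^sub>k\<close> is the sum of
  \<open>h\<close> over \<open>\<Phi> 1, \<dots>, \<Phi> k\<close>. Multiplying \<open>1 - s\<^sup>2 u / 2\<close> by the phase \<open>exp (i s P hh)\<close>, with \<open>u\<close> an
  approximate solution of Poisson's equation for the conditional variance of the martingale
  increments, produces an eigenfunction of \<open>R\<close> for the eigenvalue \<open>1 - s\<^sup>2 v / 2\<close>, where \<open>v\<close> is the
  asymptotic variance, up to an error that is negligible compared with \<open>s\<^sup>2\<close> in \<open>L\<^sup>1(\<pi>)\<close>
  (\<open>approximate_eigenfunction\<close>). Taking \<open>s = t / sqrt k\<close> and \<open>k\<close> iterations yields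
  \<open>exp (- v t\<^sup>2 / 2)\<close> for the stationary chain, geometric ergodicity removes the dependence
  on the initial law, and Levy's continuity theorem turns the limit into weak convergence.\<close>

section \<open>Contraction of weighted oscillations\<close>

text \<open>\<open>A\<close> is a Lipschitz constant of \<open>f\<close> for the metric that puts distinct points \<open>u\<close>, \<open>v\<close> at distance
  \<open>2 + \<beta> * V u + \<beta> * V v\<close>.\<close>

definition weighted_osc_le :: "real \<Rightarrow> ('a \<Rightarrow> real) \<Rightarrow> real \<Rightarrow> ('a \<Rightarrow> real) \<Rightarrow> bool" where
  "weighted_osc_le \<beta> V A f \<longleftrightarrow> (\<forall>u v. \<bar>f u - f v\<bar> \<le> A * (2 + \<beta> * V u + \<beta> * V v))"

text \<open>All constants are arguments, so that one contraction rate can serve a whole family of kernels.\<close>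

definition harris_kernel ::
  "('a::euclidean_space \<Rightarrow> real) \<Rightarrow> real \<Rightarrow> real \<Rightarrow> real \<Rightarrow> real \<Rightarrow> ('a \<Rightarrow> 'a measure) \<Rightarrow> bool" where
  "harris_kernel V \<gamma> k R \<alpha> K \<longleftrightarrow>
     (\<forall>x. prob_space (K x) \<and> sets (K x) = sets borel \<and> integrable (K x) V \<and>
        (\<integral>y. V y \<partial>K x) \<le> \<gamma> * V x + k) \<and>
     (\<exists>\<nu>. sets \<nu> = sets borel \<and> emeasure \<nu> UNIV = ennreal \<alpha> \<and>
        (\<forall>x. V x \<le> R \<longrightarrow> (\<forall>A\<in>sets borel. emeasure \<nu> A \<le> emeasure (K x) A)))"

lemma integral_mono_measure_nonneg:
  fixes f :: "'a \<Rightarrow> real"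
  assumes sets: "sets N = sets M" and le: "\<And>A. A \<in> sets M \<Longrightarrow> emeasure N A \<le> emeasure M A"
    and f: "integrable M f" and nn: "\<And>x. 0 \<le> f x"
  shows "integrable N f" "(\<integral>x. f x \<partial>N) \<le> (\<integral>x. f x \<partial>M)"
proof -
  have N_le: "N \<le> M"
    using sets le by (metis le_measure_iff order_refl sets_eq_imp_space_eq le_funI emeasure_notin_sets)
  have meas: "f \<in> borel_measurable N"
    using f sets by (simp add: measurable_cong_sets[OF sets refl] borel_measurable_integrable)
  have le_nn: "(\<integral>\<^sup>+x. ennreal (f x) \<partial>N) \<le> (\<integral>\<^sup>+x. ennreal (f x) \<partial>M)"
    using N_le sets by (intro nn_integral_mono_measure) auto
  have fin: "(\<integral>\<^sup>+x. ennreal (f x) \<partial>M) < \<infinity>"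
    using f nn by (simp add: nn_integral_eq_integral)
  show int: "integrable N f"
    using meas nn le_nn fin by (intro integrableI_nonneg) auto
  show "(\<integral>x. f x \<partial>N) \<le> (\<integral>x. f x \<partial>M)"
    using le_nn f int nn by (simp add: nn_integral_eq_integral)
qed

text \<open>A coupling estimate without a coupling: the common part \<open>N\<close> of the two measures cancels, and the
  oscillation inequality for \<open>f u - f v\<close> is integrated in \<open>u\<close> against \<open>M1 - N\<close> and in \<open>v\<close> against
  \<open>M2 - N\<close>. Each has mass \<open>1 - \<alpha>\<close>, which replaces the constant \<open>2\<close> of the metric by \<open>2 * (1 - \<alpha>)\<close>.\<close>

lemma integral_difference_le:
  fixes f V :: "'a \<Rightarrow> real"
  assumes M1: "prob_space M1" and M2: "prob_space M2"
    and V1: "integrable M1 V" and V2: "integrable M2 V" and V0: "\<And>x. 0 \<le> V x"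
    and f1: "integrable M1 f" and f2: "integrable M2 f"
    and N1: "sets N = sets M1" "\<And>A. A \<in> sets M1 \<Longrightarrow> emeasure N A \<le> emeasure M1 A"
    and N2: "sets N = sets M2" "\<And>A. A \<in> sets M2 \<Longrightarrow> emeasure N A \<le> emeasure M2 A"
    and mass: "emeasure N (space N) = ennreal \<alpha>" "0 \<le> \<alpha>" "\<alpha> < 1"
    and \<beta>: "0 \<le> \<beta>" and A: "0 \<le> A" and osc: "weighted_osc_le \<beta> V A f"
  shows "(\<integral>x. f x \<partial>M1) - (\<integral>x. f x \<partial>M2) \<le>
    A * (2 * (1 - \<alpha>) + \<beta> * (\<integral>x. V x \<partial>M1) + \<beta> * (\<integral>x. V x \<partial>M2))"
proof -
  interpret M1: prob_space M1 by fact
  interpret M2: prob_space M2 by fact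
  interpret N: finite_measure N
    using mass by (intro finite_measureI) auto
  have N_mass: "measure N (space N) = \<alpha>"
    using mass by (simp add: measure_def)
  have osc': "f u \<le> f v + A * (2 + \<beta> * V u + \<beta> * V v)" for u v
    using osc unfolding weighted_osc_le_def by (smt (verit))
  define B where "B u = \<bar>f undefined\<bar> + A * (2 + \<beta> * V u + \<beta> * V undefined)" for u
  have fB: "\<bar>f u\<bar> \<le> B u" for u
    using osc unfolding weighted_osc_le_def B_def by (smt (verit))
  have BV1: "integrable M1 B"
    unfolding B_def using V1 by auto
  have intN: "integrable N V"
    by (rule integral_mono_measure_nonneg(1)[OF N1 V1 V0])
  have B0: "0 \<le> B u" for u using fB[of u] by simp
  have fN: "integrable N f"
  proof (rule Bochner_Integration.integrable_bound)
    show "integrable N B" using integral_mono_measure_nonneg[OF N1 BV1 B0] by auto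
    show "f \<in> borel_measurable N"
      using borel_measurable_integrable[OF f1] by (simp add: measurable_cong_sets[OF N1(1) refl])
    show "AE x in N. norm (f x) \<le> norm (B x)" using fB by (simp add: B0)
  qed
  \<comment> \<open>The signed measures \<open>M1 - N\<close> and \<open>M2 - N\<close> are positive, of mass \<open>1 - \<alpha>\<close>.\<close>
  define L1 where "L1 g = (\<integral>x. g x \<partial>M1) - (\<integral>x. g x \<partial>N)" for g :: "'a \<Rightarrow> real"
  define L2 where "L2 g = (\<integral>x. g x \<partial>M2) - (\<integral>x. g x \<partial>N)" for g :: "'a \<Rightarrow> real"
  have L1V: "L1 V \<le> (\<integral>x. V x \<partial>M1)" and L2V: "L2 V \<le> (\<integral>x. V x \<partial>M2)"
    using Bochner_Integration.integral_nonneg[of N V] V0 by (auto simp: L1_def L2_def)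
  have step1: "L1 f \<le> (1 - \<alpha>) * (f v + A * (2 + \<beta> * V v)) + A * \<beta> * L1 V" for v
  proof -
    let ?g = "\<lambda>u. f v + A * (2 + \<beta> * V u + \<beta> * V v) - f u"
    have "integrable M1 ?g" using V1 f1 by auto
    then have "(\<integral>x. ?g x \<partial>N) \<le> (\<integral>x. ?g x \<partial>M1)"
      using integral_mono_measure_nonneg[OF N1, of ?g] osc'[of _ v] by (simp add: algebra_simps)
    moreover have "(\<integral>x. ?g x \<partial>N) = \<alpha> * (f v + A * (2 + \<beta> * V v)) + A * \<beta> * (\<integral>x. V x \<partial>N) - (\<integral>x. f x \<partial>N)"
      using intN fN N_mass by (simp add: algebra_simps)
    moreover have "(\<integral>x. ?g x \<partial>M1) = (f v + A * (2 + \<beta> * V v)) + A * \<beta> * (\<integral>x. V x \<partial>M1) - (\<integral>x. f x \<partial>M1)"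
      using V1 f1 M1.prob_space by (simp add: algebra_simps)
    ultimately show ?thesis by (simp add: L1_def algebra_simps)
  qed
  have "(1 - \<alpha>) * L1 f \<le> (1 - \<alpha>) * (L2 f + A * (2 * (1 - \<alpha>) + \<beta> * L2 V)) + (1 - \<alpha>) * (A * \<beta> * L1 V)"
  proof -
    let ?g = "\<lambda>v. (1 - \<alpha>) * (f v + A * (2 + \<beta> * V v)) + A * \<beta> * L1 V - L1 f"
    have "integrable M2 ?g" using V2 f2 by auto
    then have "(\<integral>x. ?g x \<partial>N) \<le> (\<integral>x. ?g x \<partial>M2)"
      using integral_mono_measure_nonneg[OF N2, of ?g] step1 by (simp add: algebra_simps)
    moreover have "(\<integral>x. ?g x \<partial>N) = (1 - \<alpha>) * ((\<integral>x. f x \<partial>N) + A * (2 * \<alpha> + \<beta> * (\<integral>x. V x \<partial>N)))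
       + \<alpha> * (A * \<beta> * L1 V - L1 f)"
      using intN fN N_mass by (simp add: algebra_simps)
    moreover have "(\<integral>x. ?g x \<partial>M2) = (1 - \<alpha>) * ((\<integral>x. f x \<partial>M2) + A * (2 + \<beta> * (\<integral>x. V x \<partial>M2)))
       + (A * \<beta> * L1 V - L1 f)"
      using V2 f2 M2.prob_space by (simp add: algebra_simps)
    ultimately show ?thesis by (simp add: L2_def algebra_simps)
  qed
  then have "(1 - \<alpha>) * L1 f \<le> (1 - \<alpha>) * (L2 f + A * (2 * (1 - \<alpha>) + \<beta> * L2 V) + A * \<beta> * L1 V)"
    by (simp only: distrib_left)
  then have "L1 f \<le> L2 f + A * (2 * (1 - \<alpha>) + \<beta> * L2 V) + A * \<beta> * L1 V"
    using mass by (simp add: mult_le_cancel_left_pos)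
  moreover have "A * \<beta> * L1 V \<le> A * \<beta> * (\<integral>x. V x \<partial>M1)" "A * \<beta> * L2 V \<le> A * \<beta> * (\<integral>x. V x \<partial>M2)"
    using L1V L2V A \<beta> by (auto intro!: mult_left_mono)
  ultimately show ?thesis by (simp add: L1_def L2_def algebra_simps)
qed

lemma weighted_osc_le_integrable:
  assumes K: "prob_space N" and V: "integrable N V" and f: "f \<in> borel_measurable N"
    and osc: "weighted_osc_le \<beta> V A f"
  shows "integrable N f"
proof -
  interpret prob_space N by fact
  show ?thesis
  proof (rule Bochner_Integration.integrable_bound)
    show "integrable N (\<lambda>u. \<bar>f undefined\<bar> + A * (2 + \<beta> * V u + \<beta> * V undefined))"
      using V by auto
    show "AE u in N. norm (f u) \<le> norm (\<bar>f undefined\<bar> + A * (2 + \<beta> * V u + \<beta> * V undefined))"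
    proof (intro AE_I2)
      fix u
      have "\<bar>f u - f undefined\<bar> \<le> A * (2 + \<beta> * V u + \<beta> * V undefined)"
        using osc unfolding weighted_osc_le_def by blast
      then show "norm (f u) \<le> norm (\<bar>f undefined\<bar> + A * (2 + \<beta> * V u + \<beta> * V undefined))"
        by (auto simp: abs_if split: if_splits)
    qed
  qed (use f in auto)
qed

text \<open>If \<open>V x + V y\<close> exceeds \<open>R\<close>, the drift alone shrinks the distance between \<open>x\<close> and \<open>y\<close>, as it beats
  its own additive constant there. Otherwise both points lie in the sublevel set on which the
  kernels share a mass \<open>\<alpha>\<close>; the weight \<open>\<beta>\<close> is so small that the additive constant of the drift
  consumes only half of the gain from this shared mass.\<close>

lemma harris_contraction:
  fixes \<gamma> k R \<alpha> :: real
  assumes \<gamma>: "0 < \<gamma>" "\<gamma> < 1" and k: "0 < k" and R: "2 * k < (1 - \<gamma>) * R" and \<alpha>: "0 < \<alpha>" "\<alpha> < 1"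
  obtains \<beta> \<rho> where "0 < \<beta>" "0 < \<rho>" "\<rho> < 1"
    "\<And>V (K :: 'a::euclidean_space \<Rightarrow> 'a measure) f A. harris_kernel V \<gamma> k R \<alpha> K \<Longrightarrow> (\<And>x. 1 \<le> V x) \<Longrightarrow>
       f \<in> borel_measurable borel \<Longrightarrow> 0 \<le> A \<Longrightarrow> weighted_osc_le \<beta> V A f \<Longrightarrow>
       weighted_osc_le \<beta> V (\<rho> * A) (\<lambda>x. \<integral>y. f y \<partial>K x)"
proof -
  \<comment> \<open>With this weight \<open>2 * \<beta> * k = \<alpha>\<close>, half of the \<open>2 * \<alpha>\<close> gained by the minorization.\<close>
  define \<beta> where "\<beta> = \<alpha> / (2 * k)"
  have \<beta>: "0 < \<beta>" using \<alpha> k by (simp add: \<beta>_def)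
  have R0: "0 < R"
    using R k \<gamma> by (smt (verit) mult_nonneg_nonpos)
  \<comment> \<open>The drift rate for \<open>V x + V y \<ge> R\<close>, with the additive constant absorbed.\<close>
  define \<gamma>' where "\<gamma>' = \<gamma> + 2 * k / R"
  have \<gamma>': "0 < \<gamma>'" "\<gamma>' < 1"
    using \<gamma> k R R0 by (auto simp: \<gamma>'_def field_simps add_pos_pos)
  define \<rho>1 where "\<rho>1 = (2 + \<beta> * R * \<gamma>') / (2 + \<beta> * R)"
  have pos: "0 < 2 + \<beta> * R" using \<beta> R0 by (simp add: add_pos_pos)
  have \<rho>1: "0 < \<rho>1" "\<rho>1 < 1" "\<gamma>' \<le> \<rho>1"
    using \<gamma>' \<beta> R0 pos by (auto simp: \<rho>1_def divide_simps add_pos_pos algebra_simps)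
  define \<rho> where "\<rho> = max \<rho>1 (max (1 - \<alpha> / 2) \<gamma>)"
  have \<rho>: "0 < \<rho>" "\<rho> < 1" "\<rho>1 \<le> \<rho>" "1 - \<alpha> / 2 \<le> \<rho>" "\<gamma> \<le> \<rho>"
    using \<rho>1 \<alpha> \<gamma> by (auto simp: \<rho>_def)
  have "weighted_osc_le \<beta> V (\<rho> * A) (\<lambda>x. \<integral>y. f y \<partial>K x)"
    if K: "harris_kernel V \<gamma> k R \<alpha> K" and V: "\<And>x. 1 \<le> V x"
      and f: "f \<in> borel_measurable borel" and A: "0 \<le> A" and osc: "weighted_osc_le \<beta> V A f"
    for V :: "'a \<Rightarrow> real" and K f A
  proof -
    have Kx: "prob_space (K x)" "sets (K x) = sets borel" "integrable (K x) V"
      "(\<integral>y. V y \<partial>K x) \<le> \<gamma> * V x + k" for x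
      using K by (auto simp: harris_kernel_def)
    have V0: "0 \<le> V x" for x using V[of x] by simp
    have fint: "integrable (K x) f" for x
      using weighted_osc_le_integrable[OF Kx(1,3) _ osc] f
      by (simp add: measurable_cong_sets[OF Kx(2) refl])
    have far: "(\<integral>z. f z \<partial>K x) - (\<integral>z. f z \<partial>K y) \<le>
      A * (2 + \<beta> * (\<integral>z. V z \<partial>K x) + \<beta> * (\<integral>z. V z \<partial>K y))" for x y
      using integral_difference_le[OF Kx(1) Kx(1) Kx(3) Kx(3) V0 fint fint, of "null_measure borel" x y 0 \<beta> A]
        \<beta> A osc Kx(2) by simp
    obtain \<nu> where \<nu>: "sets \<nu> = sets borel" "emeasure \<nu> UNIV = ennreal \<alpha>"
      "\<And>x A. V x \<le> R \<Longrightarrow> A \<in> sets borel \<Longrightarrow> emeasure \<nu> A \<le> emeasure (K x) A"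
      using K unfolding harris_kernel_def by blast
    have sp: "space \<nu> = UNIV" using sets_eq_imp_space_eq[OF \<nu>(1)] by simp
    have near: "(\<integral>z. f z \<partial>K x) - (\<integral>z. f z \<partial>K y) \<le>
      A * (2 * (1 - \<alpha>) + \<beta> * (\<integral>z. V z \<partial>K x) + \<beta> * (\<integral>z. V z \<partial>K y))" if "V x \<le> R" "V y \<le> R" for x y
      using integral_difference_le[OF Kx(1) Kx(1) Kx(3) Kx(3) V0 fint fint, of \<nu> x y \<alpha> \<beta> A]
        \<beta> A osc Kx(2) \<alpha> \<nu> sp that by simp
    have drift: "\<beta> * (\<integral>z. V z \<partial>K x) \<le> \<beta> * (\<gamma> * V x + k)" for x
      using Kx(4)[of x] \<beta> by simp
    have one_sided: "(\<integral>z. f z \<partial>K x) - (\<integral>z. f z \<partial>K y) \<le> \<rho> * A * (2 + \<beta> * V x + \<beta> * V y)" for x y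
    proof (cases "V x + V y \<le> R")
      case True
      then have R2: "V x \<le> R" "V y \<le> R" using V0[of x] V0[of y] by linarith+
      have "2 * (1 - \<alpha>) + \<beta> * (\<integral>z. V z \<partial>K x) + \<beta> * (\<integral>z. V z \<partial>K y)
        \<le> 2 * (1 - \<alpha>) + \<beta> * (\<gamma> * V x + k) + \<beta> * (\<gamma> * V y + k)"
        using drift[of x] drift[of y] by linarith
      also have "\<dots> = 2 * (1 - \<alpha> / 2) + \<gamma> * (\<beta> * V x + \<beta> * V y)"
        using k by (simp add: \<beta>_def field_simps)
      also have "\<dots> \<le> 2 * \<rho> + \<rho> * (\<beta> * V x + \<beta> * V y)"
        using \<rho> \<beta> V0[of x] V0[of y] by (intro add_mono mult_right_mono) auto
      finally have "A * (2 * (1 - \<alpha>) + \<beta> * (\<integral>z. V z \<partial>K x) + \<beta> * (\<integral>z. V z \<partial>K y))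
        \<le> A * (2 * \<rho> + \<rho> * (\<beta> * V x + \<beta> * V y))" using A by (intro mult_left_mono) auto
      then show ?thesis using near[OF R2] by (simp add: algebra_simps)
    next
      case False
      define S where "S = V x + V y"
      have S: "R \<le> S" using False by (simp add: S_def)
      have "2 + \<beta> * (\<integral>z. V z \<partial>K x) + \<beta> * (\<integral>z. V z \<partial>K y)
        \<le> 2 + \<beta> * (\<gamma> * S + 2 * k)"
        using drift[of x] drift[of y] by (simp add: S_def algebra_simps)
      also have "\<beta> * (\<gamma> * S + 2 * k) \<le> \<beta> * (\<gamma>' * S)"
      proof -
        have "2 * k * R \<le> 2 * k * S" using S k by (intro mult_left_mono) auto
        then have "2 * k \<le> 2 * k / R * S" using R0 by (simp add: field_simps)
        then have "\<gamma> * S + 2 * k \<le> \<gamma>' * S"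
          unfolding \<gamma>'_def by (simp only: distrib_right add_left_mono)
        then show ?thesis using \<beta> by (intro mult_left_mono) auto
      qed
      also have "2 + \<beta> * (\<gamma>' * S) \<le> \<rho>1 * (2 + \<beta> * S)"
      proof -
        have "\<beta> * (\<rho>1 - \<gamma>') * R \<le> \<beta> * (\<rho>1 - \<gamma>') * S"
          using S \<beta> \<rho>1 by (intro mult_left_mono) auto
        moreover have "\<rho>1 * (2 + \<beta> * R) = 2 + \<beta> * R * \<gamma>'"
          using pos by (simp add: \<rho>1_def)
        ultimately show ?thesis by (simp add: algebra_simps)
      qed
      also have "\<dots> \<le> \<rho> * (2 + \<beta> * S)"
        using \<rho> \<beta> S R0 by (intro mult_right_mono) auto
      finally have "A * (2 + \<beta> * (\<integral>z. V z \<partial>K x) + \<beta> * (\<integral>z. V z \<partial>K y)) \<le> A * (\<rho> * (2 + \<beta> * S))"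
        using A by (intro mult_left_mono) auto
      then show ?thesis using far[of x y] by (simp add: S_def algebra_simps)
    qed
    show ?thesis
      unfolding weighted_osc_le_def
      using one_sided by (smt (verit) add.commute add.left_commute)
  qed
  then show thesis using that \<beta> \<rho> by blast
qed

text \<open>A bounded function has some finite oscillation constant \<open>S\<close>; iterating \<open>A \<mapsto> \<rho> * A + D\<close> from it
  converges to \<open>D / (1 - \<rho>)\<close>, which no longer mentions \<open>S\<close>. So a solution of a discretised Poisson
  equation, which is merely bounded, obeys an estimate independent of the discretisation.\<close>

lemma weighted_osc_le_fixpoint:
  assumes \<rho>: "0 \<le> \<rho>" "\<rho> < 1" and D: "0 \<le> D" and \<beta>: "0 \<le> \<beta>" and V: "\<And>x. 0 \<le> V x"
    and bounded: "\<And>x. \<bar>f x\<bar> \<le> S"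
    and step: "\<And>A. 0 \<le> A \<Longrightarrow> weighted_osc_le \<beta> V A f \<Longrightarrow> weighted_osc_le \<beta> V (\<rho> * A + D) f"
  shows "weighted_osc_le \<beta> V (D / (1 - \<rho>)) f"
proof -
  let ?E = "D / (1 - \<rho>)"
  have S: "0 \<le> S" using bounded[of undefined] by linarith
  have E: "0 \<le> ?E" "\<rho> * ?E + D = ?E" using \<rho> D by (auto simp: field_simps)
  have iter: "weighted_osc_le \<beta> V (\<rho> ^ i * S + ?E) f" for i
  proof (induction i)
    case 0
    show ?case
      unfolding weighted_osc_le_def
    proof (intro allI)
      fix u v
      have "\<bar>f u - f v\<bar> \<le> S * 2" using bounded[of u] bounded[of v] by linarith
      also have "\<dots> \<le> (S + ?E) * (2 + \<beta> * V u + \<beta> * V v)"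
        using S E(1) \<beta> V[of u] V[of v] by (intro mult_mono) auto
      finally show "\<bar>f u - f v\<bar> \<le> (\<rho> ^ 0 * S + ?E) * (2 + \<beta> * V u + \<beta> * V v)" by simp
    qed
  next
    case (Suc i)
    have "\<rho> * (\<rho> ^ i * S + ?E) + D = \<rho> ^ Suc i * S + ?E" using E(2) by (simp add: algebra_simps)
    then show ?case using step[OF _ Suc] S E \<rho> by simp
  qed
  show ?thesis
    unfolding weighted_osc_le_def
  proof (intro allI)
    fix u v
    let ?W = "2 + \<beta> * V u + \<beta> * V v"
    have "(\<lambda>i. (\<rho> ^ i * S + ?E) * ?W) \<longlonglongrightarrow> (0 * S + ?E) * ?W"
      using \<rho> by (intro tendsto_intros LIMSEQ_power_zero) auto
    moreover have "\<bar>f u - f v\<bar> \<le> (\<rho> ^ i * S + ?E) * ?W" for i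
      using iter[of i] unfolding weighted_osc_le_def by blast
    ultimately have "\<bar>f u - f v\<bar> \<le> (0 * S + ?E) * ?W" by (intro LIMSEQ_le_const) auto
    then show "\<bar>f u - f v\<bar> \<le> ?E * ?W" by simp
  qed
qed

section \<open>Geometric ergodicity and Poisson's equation\<close>

text \<open>The consequences of drift and minorization that matter below. Invariance is stated with
  nonnegative integrals, which need no integrability.\<close>

locale ergodic_kernel =
  fixes K :: "'a::euclidean_space \<Rightarrow> 'a measure" and \<mu> :: "'a measure" and V :: "'a \<Rightarrow> real"
    and \<beta> \<rho> :: real
  assumes kernel_measurable [measurable]: "K \<in> borel \<rightarrow>\<^sub>M subprob_algebra borel"
    and kernel_prob: "prob_space (K x)"
    and mu_prob: "prob_space \<mu>"
    and sets_mu [simp, measurable_cong]: "sets \<mu> = sets borel"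
    and invariant: "\<And>f. f \<in> borel_measurable borel \<Longrightarrow> (\<integral>\<^sup>+x. (\<integral>\<^sup>+y. f y \<partial>K x) \<partial>\<mu>) = (\<integral>\<^sup>+x. f x \<partial>\<mu>)"
    and V_measurable [measurable]: "V \<in> borel_measurable borel"
    and V_ge_1: "1 \<le> V x"
    and V_kernel: "integrable (K x) V"
    and V_square: "integrable \<mu> (\<lambda>x. (V x)\<^sup>2)"
    and \<beta>_pos: "0 < \<beta>" and \<rho>_pos: "0 < \<rho>" and \<rho>_less_1: "\<rho> < 1"
    and contraction: "\<And>f A. f \<in> borel_measurable borel \<Longrightarrow> 0 \<le> A \<Longrightarrow> weighted_osc_le \<beta> V A f \<Longrightarrow>
       weighted_osc_le \<beta> V (\<rho> * A) (\<lambda>x. \<integral>y. f y \<partial>K x)"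
begin

sublocale mu: prob_space \<mu> by (rule mu_prob)
sublocale kernel: prob_space "K x" for x by (rule kernel_prob)

lemma sets_kernel_borel [simp, measurable_cong]: "sets (K x) = sets borel"
  using measurable_space[OF kernel_measurable, of x] by (simp add: space_subprob_algebra)

lemma space_simps [simp]: "space (K x) = UNIV" "space \<mu> = UNIV"
  using sets_eq_imp_space_eq[OF sets_kernel_borel] sets_eq_imp_space_eq[OF sets_mu] by auto

definition kernel_op :: "('a \<Rightarrow> 'b::{banach, second_countable_topology}) \<Rightarrow> 'a \<Rightarrow> 'b" where
  "kernel_op f x = (\<integral>y. f y \<partial>K x)"

lemma kernel_op_eq: "kernel_op f = (\<lambda>x. \<integral>y. f y \<partial>K x)"
  by (simp add: fun_eq_iff kernel_op_def)

lemma kernel_op_measurable [measurable (raw)]: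
  assumes f [measurable]: "f \<in> borel_measurable borel"
  shows "kernel_op f \<in> borel_measurable borel"
  unfolding kernel_op_def by measurable

lemma kernel_op_funpow_measurable [measurable (raw)]:
  "f \<in> borel_measurable borel \<Longrightarrow> (kernel_op ^^ n) f \<in> borel_measurable borel"
  by (induction n) auto

lemma integrable_bounded:
  fixes f :: "'a \<Rightarrow> 'b::{banach, second_countable_topology}"
  assumes "f \<in> borel_measurable borel" "\<And>x. norm (f x) \<le> B"
  shows "integrable (K x) f" "integrable \<mu> f"
  using assms by (auto intro!: kernel.integrable_const_bound[where B=B] mu.integrable_const_bound[where B=B])

lemma norm_kernel_op_le:
  fixes f :: "'a \<Rightarrow> 'b::{banach, second_countable_topology}"
  assumes "f \<in> borel_measurable borel" "\<And>x. norm (f x) \<le> B"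
  shows "norm (kernel_op f x) \<le> B"
proof -
  have "norm (kernel_op f x) \<le> (\<integral>y. norm (f y) \<partial>K x)"
    unfolding kernel_op_def by (rule integral_norm_bound)
  also have "\<dots> \<le> (\<integral>y. B \<partial>K x)"
    using assms integrable_bounded(1)[OF assms] by (intro integral_mono) auto
  finally show ?thesis using kernel.prob_space by simp
qed

lemma kernel_op_funpow_bounded:
  fixes f :: "'a \<Rightarrow> 'b::{banach, second_countable_topology}"
  assumes "f \<in> borel_measurable borel" "\<And>x. norm (f x) \<le> B"
  shows "norm ((kernel_op ^^ n) f x) \<le> B"
  using assms(2) by (induction n arbitrary: x) (auto intro!: norm_kernel_op_le kernel_op_funpow_measurable assms(1))

text \<open>A function that is integrable for \<open>\<mu>\<close> may fail to be integrable for \<open>K x\<close> when \<open>x\<close> lies in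
  some \<open>\<mu>\<close>-null set.\<close>

lemma nn_kernel_op_AE:
  fixes f :: "'a \<Rightarrow> real"
  assumes f [measurable]: "f \<in> borel_measurable borel" and nn: "\<And>x. 0 \<le> f x" and int: "integrable \<mu> f"
  shows "AE x in \<mu>. integrable (K x) f"
    and "integrable \<mu> (kernel_op f)" and "(\<integral>x. kernel_op f x \<partial>\<mu>) = (\<integral>x. f x \<partial>\<mu>)"
proof -
  have inv: "(\<integral>\<^sup>+x. (\<integral>\<^sup>+y. ennreal (f y) \<partial>K x) \<partial>\<mu>) = ennreal (\<integral>x. f x \<partial>\<mu>)"
    using invariant[of "\<lambda>y. ennreal (f y)"] int nn by (simp add: nn_integral_eq_integral)
  have "AE x in \<mu>. (\<integral>\<^sup>+y. ennreal (f y) \<partial>K x) \<noteq> \<infinity>"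
    by (rule nn_integral_PInf_AE) (auto simp: inv)
  then show AE: "AE x in \<mu>. integrable (K x) f"
    by eventually_elim (auto intro!: integrableI_nonneg simp: nn top.not_eq_extremum)
  have "(\<integral>\<^sup>+x. ennreal (kernel_op f x) \<partial>\<mu>) = (\<integral>\<^sup>+x. (\<integral>\<^sup>+y. ennreal (f y) \<partial>K x) \<partial>\<mu>)"
    using AE by (intro nn_integral_cong_AE, eventually_elim)
      (auto simp: kernel_op_def nn nn_integral_eq_integral)
  then have eq: "(\<integral>\<^sup>+x. ennreal (kernel_op f x) \<partial>\<mu>) = ennreal (\<integral>x. f x \<partial>\<mu>)" using inv by simp
  have nn': "0 \<le> kernel_op f x" for x unfolding kernel_op_def using nn by simp
  show "integrable \<mu> (kernel_op f)"
    using eq nn' by (intro integrableI_nonneg) auto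
  then show "(\<integral>x. kernel_op f x \<partial>\<mu>) = (\<integral>x. f x \<partial>\<mu>)"
    using eq nn' nn by (simp add: nn_integral_eq_integral integral_nonneg_AE)
qed

lemma integral_kernel_op:
  fixes f :: "'a \<Rightarrow> real"
  assumes f [measurable]: "f \<in> borel_measurable borel" and int: "integrable \<mu> f"
  shows "integrable \<mu> (kernel_op f)" and "(\<integral>x. kernel_op f x \<partial>\<mu>) = (\<integral>x. f x \<partial>\<mu>)"
proof -
  let ?p = "\<lambda>x. max (f x) 0" and ?m = "\<lambda>x. max (- f x) 0"
  have pint: "integrable \<mu> ?p" and mint: "integrable \<mu> ?m" using int by auto
  note p = nn_kernel_op_AE[OF _ _ pint] and m = nn_kernel_op_AE[OF _ _ mint]
  have AE: "AE x in \<mu>. kernel_op f x = kernel_op ?p x - kernel_op ?m x"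
  proof -
    have "AE x in \<mu>. integrable (K x) ?p" "AE x in \<mu>. integrable (K x) ?m" using p m by auto
    then show ?thesis
    proof eventually_elim
      case (elim x)
      have "f = (\<lambda>y. ?p y - ?m y)" by auto
      then have "kernel_op f x = (\<integral>y. ?p y - ?m y \<partial>K x)" by (simp add: kernel_op_def)
      then show ?case using elim by (simp add: kernel_op_def)
    qed
  qed
  have "integrable \<mu> (\<lambda>x. kernel_op ?p x - kernel_op ?m x)" using p m by auto
  then show "integrable \<mu> (kernel_op f)"
    by (rule integrable_cong_AE_imp) (use AE in \<open>auto elim: eventually_mono\<close>)
  have "(\<integral>x. kernel_op f x \<partial>\<mu>) = (\<integral>x. kernel_op ?p x - kernel_op ?m x \<partial>\<mu>)"
    by (rule integral_cong_AE) (use AE in auto)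
  also have "\<dots> = (\<integral>x. ?p x \<partial>\<mu>) - (\<integral>x. ?m x \<partial>\<mu>)" using p m by simp
  also have "\<dots> = (\<integral>x. ?p x - ?m x \<partial>\<mu>)" using pint mint by simp
  also have "\<dots> = (\<integral>x. f x \<partial>\<mu>)" by (intro Bochner_Integration.integral_cong) auto
  finally show "(\<integral>x. kernel_op f x \<partial>\<mu>) = (\<integral>x. f x \<partial>\<mu>)" .
qed

lemma integral_kernel_op_funpow:
  fixes f :: "'a \<Rightarrow> real"
  assumes f: "f \<in> borel_measurable borel" and int: "integrable \<mu> f"
  shows "integrable \<mu> ((kernel_op ^^ n) f)" and "(\<integral>x. (kernel_op ^^ n) f x \<partial>\<mu>) = (\<integral>x. f x \<partial>\<mu>)"
proof -
  have "integrable \<mu> ((kernel_op ^^ n) f) \<and> (\<integral>x. (kernel_op ^^ n) f x \<partial>\<mu>) = (\<integral>x. f x \<partial>\<mu>)"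
    using int f by (induction n) (simp_all add: integral_kernel_op kernel_op_funpow_measurable)
  then show "integrable \<mu> ((kernel_op ^^ n) f)" and "(\<integral>x. (kernel_op ^^ n) f x \<partial>\<mu>) = (\<integral>x. f x \<partial>\<mu>)"
    by auto
qed

lemma L1_kernel_op_le:
  fixes f :: "'a \<Rightarrow> 'b::{banach, second_countable_topology}"
  assumes f [measurable]: "f \<in> borel_measurable borel" and B: "\<And>x. norm (f x) \<le> B"
  shows "(\<integral>x. norm (kernel_op f x) \<partial>\<mu>) \<le> (\<integral>x. norm (f x) \<partial>\<mu>)"
proof -
  have int: "integrable \<mu> (\<lambda>x. norm (f x))" using integrable_bounded(2)[OF f B] by simp
  have "(\<integral>x. norm (kernel_op f x) \<partial>\<mu>) \<le> (\<integral>x. kernel_op (\<lambda>y. norm (f y)) x \<partial>\<mu>)"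
  proof (rule integral_mono)
    show "integrable \<mu> (\<lambda>x. norm (kernel_op f x))"
      using integrable_bounded(2)[of "kernel_op f" B] norm_kernel_op_le[OF f B] by simp
    show "integrable \<mu> (kernel_op (\<lambda>y. norm (f y)))" by (intro integral_kernel_op int) auto
    show "norm (kernel_op f x) \<le> kernel_op (\<lambda>y. norm (f y)) x" for x
      unfolding kernel_op_def by (rule integral_norm_bound)
  qed
  also have "\<dots> = (\<integral>x. norm (f x) \<partial>\<mu>)" by (intro integral_kernel_op int) auto
  finally show ?thesis .
qed

lemma V_nonneg: "0 \<le> V x"
  using V_ge_1[of x] by simp

lemma V_mu: "integrable \<mu> V"
proof (rule Bochner_Integration.integrable_bound[OF V_square])
  show "AE x in \<mu>. norm (V x) \<le> norm ((V x)\<^sup>2)"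
  proof (intro AE_I2)
    fix x
    have "V x * 1 \<le> V x * V x" using V_ge_1[of x] by (intro mult_left_mono) auto
    then show "norm (V x) \<le> norm ((V x)\<^sup>2)"
      using V_ge_1[of x] by (simp add: power2_eq_square)
  qed
qed auto

lemma V_mean_nonneg: "0 \<le> (\<integral>x. V x \<partial>\<mu>)"
  by (rule Bochner_Integration.integral_nonneg) (rule V_nonneg)

lemma kernel_op_funpow_osc:
  assumes "f \<in> borel_measurable borel" "0 \<le> A" "weighted_osc_le \<beta> V A f"
  shows "weighted_osc_le \<beta> V (\<rho> ^ n * A) ((kernel_op ^^ n) f)"
proof (induction n)
  case (Suc n)
  have "weighted_osc_le \<beta> V (\<rho> * (\<rho> ^ n * A)) (kernel_op ((kernel_op ^^ n) f))"
    unfolding kernel_op_eq[of "(kernel_op ^^ n) f"]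
    using assms \<rho>_pos Suc by (intro contraction) (auto intro: kernel_op_funpow_measurable)
  then show ?case by (simp add: mult.assoc)
qed (use assms in simp)

text \<open>Integrating the contracted oscillation bound over the second point against the invariant measure
  turns it into a distance to the mean.\<close>

lemma geometric_ergodicity:
  fixes f :: "'a \<Rightarrow> real"
  assumes f: "f \<in> borel_measurable borel" "integrable \<mu> f" and A: "0 \<le> A" "weighted_osc_le \<beta> V A f"
  shows "\<bar>(kernel_op ^^ n) f x - (\<integral>y. f y \<partial>\<mu>)\<bar> \<le> \<rho> ^ n * A * (2 + \<beta> * V x + \<beta> * (\<integral>y. V y \<partial>\<mu>))"
proof -
  let ?g = "(kernel_op ^^ n) f"
  have int: "integrable \<mu> ?g" and eq: "(\<integral>y. ?g y \<partial>\<mu>) = (\<integral>y. f y \<partial>\<mu>)"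
    using integral_kernel_op_funpow[OF f] by auto
  have "\<bar>?g x - (\<integral>y. f y \<partial>\<mu>)\<bar> = \<bar>\<integral>y. ?g x - ?g y \<partial>\<mu>\<bar>"
    using int eq mu.prob_space by simp
  also have "\<dots> \<le> (\<integral>y. \<bar>?g x - ?g y\<bar> \<partial>\<mu>)" by (rule integral_abs_bound)
  also have "\<dots> \<le> (\<integral>y. \<rho> ^ n * A * (2 + \<beta> * V x + \<beta> * V y) \<partial>\<mu>)"
    using int V_mu kernel_op_funpow_osc[OF f(1) A, of n]
    by (intro integral_mono) (auto simp: weighted_osc_le_def)
  also have "\<dots> = \<rho> ^ n * A * (2 + \<beta> * V x + \<beta> * (\<integral>y. V y \<partial>\<mu>))"
    using V_mu mu.prob_space by simp
  finally show ?thesis .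
qed

text \<open>The factor that turns the bound of \<open>geometric_ergodicity\<close> into a multiple of \<open>V\<close>, times the sum
  \<open>1 / (1 - \<rho>)\<close> of the geometric series.\<close>

definition poisson_const :: real where
  "poisson_const = ((2 + \<beta> * (\<integral>y. V y \<partial>\<mu>)) / \<beta> + 1) / (1 - \<rho>)"

lemma poisson_const_nonneg: "0 \<le> poisson_const"
  unfolding poisson_const_def using \<rho>_less_1
  by (intro add_nonneg_nonneg divide_nonneg_pos mult_nonneg_nonneg V_mean_nonneg \<beta>_pos less_imp_le[OF \<beta>_pos]) auto

text \<open>The Neumann series \<open>\<Sum>n. P\<^sup>n h\<close>, which converges geometrically relative to \<open>V\<close>.\<close>

lemma poisson_solution:
  assumes h [measurable]: "h \<in> borel_measurable borel" and c: "0 \<le> c" and hV: "\<And>x. \<bar>h x\<bar> \<le> c * V x"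
    and mean: "(\<integral>x. h x \<partial>\<mu>) = 0"
  obtains hh where "hh \<in> borel_measurable borel" "\<And>x. \<bar>hh x\<bar> \<le> poisson_const * c * V x"
    "\<And>x. hh x - kernel_op hh x = h x"
proof -
  define D where "D = (2 + \<beta> * (\<integral>y. V y \<partial>\<mu>)) / \<beta> + 1"
  have D: "0 \<le> D" unfolding D_def
    by (intro add_nonneg_nonneg divide_nonneg_pos mult_nonneg_nonneg V_mean_nonneg \<beta>_pos less_imp_le[OF \<beta>_pos]) auto
  have osc: "weighted_osc_le \<beta> V (c / \<beta>) h"
    unfolding weighted_osc_le_def
  proof (intro allI)
    fix u v
    have "\<bar>h u - h v\<bar> \<le> c * V u + c * V v" using hV[of u] hV[of v] by linarith
    also have "\<dots> \<le> c / \<beta> * (2 + \<beta> * V u + \<beta> * V v)"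
      using \<beta>_pos c by (simp add: field_simps)
    finally show "\<bar>h u - h v\<bar> \<le> c / \<beta> * (2 + \<beta> * V u + \<beta> * V v)" .
  qed
  have hint: "integrable \<mu> h"
    by (rule Bochner_Integration.integrable_bound[of \<mu> "\<lambda>x. c * V x"])
      (use V_mu hV V_nonneg c in \<open>auto intro!: AE_I2 simp: abs_mult\<close>)
  have bound: "\<bar>(kernel_op ^^ n) h x\<bar> \<le> \<rho> ^ n * (c * D * V x)" for n x
  proof -
    have "\<bar>(kernel_op ^^ n) h x\<bar> \<le> \<rho> ^ n * (c / \<beta>) * (2 + \<beta> * V x + \<beta> * (\<integral>y. V y \<partial>\<mu>))"
      using geometric_ergodicity[OF h hint _ osc, of n x] mean c \<beta>_pos by simp
    also have "\<dots> = \<rho> ^ n * c * ((2 + \<beta> * (\<integral>y. V y \<partial>\<mu>)) / \<beta> * 1 + V x)"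
      using \<beta>_pos by (simp add: field_simps)
    also have "\<dots> \<le> \<rho> ^ n * c * ((2 + \<beta> * (\<integral>y. V y \<partial>\<mu>)) / \<beta> * V x + V x)"
      using \<beta>_pos \<rho>_pos c V_ge_1[of x] V_nonneg
      by (intro mult_left_mono add_right_mono) auto
    also have "\<dots> = \<rho> ^ n * (c * D * V x)" by (simp add: D_def algebra_simps)
    finally show ?thesis .
  qed
  have geo: "summable (\<lambda>n. \<rho> ^ n * b)" "(\<Sum>n. \<rho> ^ n * b) = b / (1 - \<rho>)" for b
    using \<rho>_pos \<rho>_less_1 by (auto intro!: summable_mult2 summable_geometric
        simp: suminf_mult2[symmetric] suminf_geometric)
  have summ: "summable (\<lambda>n. \<bar>(kernel_op ^^ n) h x\<bar>)" for x
    by (rule summable_comparison_test'[OF geo(1), of 0]) (use bound in auto)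
  define hh where "hh x = (\<Sum>n. (kernel_op ^^ n) h x)" for x
  have meas: "hh \<in> borel_measurable borel" unfolding hh_def by measurable
  have hhV: "\<bar>hh x\<bar> \<le> poisson_const * c * V x" for x
  proof -
    have "\<bar>hh x\<bar> \<le> (\<Sum>n. \<bar>(kernel_op ^^ n) h x\<bar>)" unfolding hh_def by (rule summable_rabs[OF summ])
    also have "\<dots> \<le> (\<Sum>n. \<rho> ^ n * (c * D * V x))" by (intro suminf_le bound summ geo)
    also have "\<dots> = poisson_const * c * V x"
      unfolding geo(2) by (simp add: poisson_const_def D_def)
    finally show ?thesis .
  qed
  have "hh x - kernel_op hh x = h x" for x
  proof -
    have int: "integrable (K x) ((kernel_op ^^ n) h)" for n
      by (rule Bochner_Integration.integrable_bound[of "K x" "\<lambda>x. \<rho> ^ n * (c * D * V x)"])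
        (use V_kernel bound \<rho>_pos D c V_nonneg in \<open>auto intro!: AE_I2 simp: abs_mult\<close>)
    have "kernel_op hh x = (\<Sum>n. \<integral>y. (kernel_op ^^ n) h y \<partial>K x)"
      unfolding kernel_op_def[of hh] hh_def
    proof (rule integral_suminf[OF int])
      show "AE y in K x. summable (\<lambda>n. norm ((kernel_op ^^ n) h y))" using summ by simp
      have "norm (\<integral>y. norm ((kernel_op ^^ n) h y) \<partial>K x) \<le> \<rho> ^ n * (c * D * (\<integral>y. V y \<partial>K x))" for n
      proof -
        have "(\<integral>y. norm ((kernel_op ^^ n) h y) \<partial>K x) \<le> (\<integral>y. \<rho> ^ n * (c * D * V y) \<partial>K x)"
          using int V_kernel bound by (intro integral_mono) auto
        then show ?thesis by simp
      qed
      then show "summable (\<lambda>n. \<integral>y. norm ((kernel_op ^^ n) h y) \<partial>K x)"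
        by (rule summable_comparison_test'[OF geo(1), of 0])
    qed
    also have "\<dots> = (\<Sum>n. (kernel_op ^^ Suc n) h x)" by (simp add: kernel_op_def)
    also have "\<dots> = hh x - h x"
      unfolding hh_def using suminf_split_head[of "\<lambda>n. (kernel_op ^^ n) h x"] summ[of x]
      by (simp add: summable_rabs_cancel)
    finally show ?thesis by simp
  qed
  then show thesis using that meas hhV by blast
qed

text \<open>An integrable \<open>g\<close> need not be dominated by \<open>V\<close>, so its Neumann series may diverge. Truncating \<open>g\<close>
  and stopping the series after finitely many terms costs a small \<open>L\<^sup>1\<close> error and makes \<open>u\<close>
  bounded, which is what the perturbation argument below needs.\<close>

lemma bounded_approximate_poisson_solution:
  fixes g :: "'a \<Rightarrow> real"
  assumes g [measurable]: "g \<in> borel_measurable borel" and int: "integrable \<mu> g" and \<epsilon>: "0 < \<epsilon>"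
  obtains u B where "u \<in> borel_measurable borel" "\<And>x. \<bar>u x\<bar> \<le> B"
    "(\<integral>x. \<bar>u x - kernel_op u x - (g x - (\<integral>y. g y \<partial>\<mu>))\<bar> \<partial>\<mu>) \<le> \<epsilon>"
proof -
  define cl where "cl N x = max (- real N) (min (g x) (real N))" for N x
  have cl_meas [measurable]: "cl N \<in> borel_measurable borel" for N unfolding cl_def by measurable
  have cl_bd: "\<bar>cl N x\<bar> \<le> real N" for N x by (auto simp: cl_def)
  have "(\<lambda>N. \<integral>x. \<bar>g x - cl N x\<bar> \<partial>\<mu>) \<longlonglongrightarrow> (\<integral>x. 0 \<partial>\<mu>)"
  proof (rule integral_dominated_convergence[where w="\<lambda>x. \<bar>g x\<bar>"])
    show "AE x in \<mu>. (\<lambda>N. \<bar>g x - cl N x\<bar>) \<longlonglongrightarrow> 0"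
    proof (intro AE_I2)
      fix x
      obtain N0 :: nat where N0: "\<bar>g x\<bar> \<le> real N0" using real_arch_simple by blast
      have "eventually (\<lambda>N. \<bar>g x - cl N x\<bar> = 0) sequentially"
        using eventually_ge_at_top[of N0]
      proof eventually_elim
        case (elim N)
        then have "\<bar>g x\<bar> \<le> real N" using N0 by linarith
        then show ?case unfolding cl_def by (auto simp: abs_le_iff min_def max_def)
      qed
      then show "(\<lambda>N. \<bar>g x - cl N x\<bar>) \<longlonglongrightarrow> 0" by (simp add: tendsto_eventually)
    qed
    show "AE x in \<mu>. norm \<bar>g x - cl N x\<bar> \<le> \<bar>g x\<bar>" for N
      by (intro AE_I2) (auto simp: cl_def min_def max_def)
  qed (use int in auto)
  then have "eventually (\<lambda>N. (\<integral>x. \<bar>g x - cl N x\<bar> \<partial>\<mu>) < \<epsilon> / 3) sequentially"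
    using \<epsilon> by (intro order_tendstoD) auto
  then obtain N where N: "(\<integral>x. \<bar>g x - cl N x\<bar> \<partial>\<mu>) < \<epsilon> / 3"
    by (auto simp: eventually_sequentially)
  define f where "f = cl N"
  have f [measurable]: "f \<in> borel_measurable borel" and fb: "norm (f x) \<le> real N" for x
    using cl_bd[of N x] by (auto simp: f_def)
  note fint = integrable_bounded[OF f fb]
  define I where "I = (\<integral>y. V y \<partial>\<mu>)"
  have osc: "weighted_osc_le \<beta> V (real N) f"
    unfolding weighted_osc_le_def
  proof (intro allI)
    fix u v
    have "\<bar>f u - f v\<bar> \<le> real N * 2" using fb[of u] fb[of v] by auto
    also have "\<dots> \<le> real N * (2 + \<beta> * V u + \<beta> * V v)"
      using \<beta>_pos V_nonneg[of u] V_nonneg[of v] by (intro mult_left_mono) auto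
    finally show "\<bar>f u - f v\<bar> \<le> real N * (2 + \<beta> * V u + \<beta> * V v)" .
  qed
  have "(\<lambda>L. \<rho> ^ L * (real N * (2 + 2 * \<beta> * I))) \<longlonglongrightarrow> 0 * (real N * (2 + 2 * \<beta> * I))"
    using \<rho>_pos \<rho>_less_1 by (intro tendsto_mult tendsto_const LIMSEQ_power_zero) auto
  then have "eventually (\<lambda>L. \<rho> ^ L * (real N * (2 + 2 * \<beta> * I)) < \<epsilon> / 3) sequentially"
    using \<epsilon> by (intro order_tendstoD) auto
  then obtain L where L: "\<rho> ^ L * (real N * (2 + 2 * \<beta> * I)) < \<epsilon> / 3"
    by (auto simp: eventually_sequentially)
  define u where "u x = (\<Sum>i<L. (kernel_op ^^ i) f x)" for x
  have fn: "norm ((kernel_op ^^ i) f x) \<le> real N" for i x by (rule kernel_op_funpow_bounded[OF f fb])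
  note fnint = integrable_bounded[OF kernel_op_funpow_measurable[OF f] fn]
  define m where "m = (\<integral>x. f x \<partial>\<mu>)"
  define \<sigma> where "\<sigma> = (\<integral>x. g x \<partial>\<mu>)"
  have diff: "u x - kernel_op u x = f x - (kernel_op ^^ L) f x" for x
  proof -
    have "kernel_op u x = (\<Sum>i<L. (kernel_op ^^ Suc i) f x)"
      using fnint unfolding kernel_op_def[of u] u_def by (simp add: kernel_op_def)
    then have "u x - kernel_op u x = (\<Sum>i<L. (kernel_op ^^ i) f x - (kernel_op ^^ Suc i) f x)"
      by (simp add: u_def sum_subtractf)
    also have "\<dots> = f x - (kernel_op ^^ L) f x" by (subst sum_lessThan_telescope') simp
    finally show ?thesis .
  qed
  have mix: "\<bar>(kernel_op ^^ L) f x - m\<bar> \<le> \<rho> ^ L * real N * (2 + \<beta> * V x + \<beta> * I)" for x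
    using geometric_ergodicity[OF f fint(2) _ osc] by (simp add: m_def I_def)
  have \<sigma>m: "\<bar>\<sigma> - m\<bar> \<le> (\<integral>x. \<bar>g x - f x\<bar> \<partial>\<mu>)"
    using integral_abs_bound[of \<mu> "\<lambda>x. g x - f x"] int fint by (simp add: \<sigma>_def m_def)
  have "(\<integral>x. \<bar>u x - kernel_op u x - (g x - \<sigma>)\<bar> \<partial>\<mu>)
      \<le> (\<integral>x. \<bar>g x - f x\<bar> + \<rho> ^ L * real N * (2 + \<beta> * V x + \<beta> * I) + \<bar>\<sigma> - m\<bar> \<partial>\<mu>)"
  proof (rule integral_mono)
    show "integrable \<mu> (\<lambda>x. \<bar>u x - kernel_op u x - (g x - \<sigma>)\<bar>)"
      unfolding diff using int fint fnint by auto
    show "integrable \<mu> (\<lambda>x. \<bar>g x - f x\<bar> + \<rho> ^ L * real N * (2 + \<beta> * V x + \<beta> * I) + \<bar>\<sigma> - m\<bar>)"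
      using int fint V_mu by auto
    show "\<bar>u x - kernel_op u x - (g x - \<sigma>)\<bar>
      \<le> \<bar>g x - f x\<bar> + \<rho> ^ L * real N * (2 + \<beta> * V x + \<beta> * I) + \<bar>\<sigma> - m\<bar>" for x
      using mix[of x] diff[of x] by linarith
  qed
  also have "\<dots> = (\<integral>x. \<bar>g x - f x\<bar> \<partial>\<mu>) + \<rho> ^ L * (real N * (2 + 2 * \<beta> * I)) + \<bar>\<sigma> - m\<bar>"
    using int fint V_mu mu.prob_space by (simp add: I_def algebra_simps)
  also have "\<dots> \<le> \<epsilon>" using N L \<sigma>m by (simp add: f_def)
  finally have "(\<integral>x. \<bar>u x - kernel_op u x - (g x - (\<integral>y. g y \<partial>\<mu>))\<bar> \<partial>\<mu>) \<le> \<epsilon>" by (simp add: \<sigma>_def)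
  moreover have "u \<in> borel_measurable borel" unfolding u_def by measurable
  moreover have "\<bar>u x\<bar> \<le> real L * real N" for x
  proof -
    have "\<bar>u x\<bar> \<le> (\<Sum>i<L. \<bar>(kernel_op ^^ i) f x\<bar>)" unfolding u_def by (rule sum_abs)
    also have "\<dots> \<le> (\<Sum>i<L. real N)" using fn by (intro sum_mono) auto
    finally show ?thesis by simp
  qed
  ultimately show thesis using that by blast
qed

section \<open>Twisted kernels\<close>

text \<open>The \<open>k\<close>-fold iterate applied to \<open>1\<close> is the characteristic function of the partial sum of \<open>h\<close> along the
  first \<open>k\<close> transitions, as a function of the starting point; see \<open>chain_char\<close>.\<close>

definition twist :: "real \<Rightarrow> ('a \<Rightarrow> real) \<Rightarrow> ('a \<Rightarrow> complex) \<Rightarrow> 'a \<Rightarrow> complex" where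
  "twist s h f = kernel_op (\<lambda>y. iexp (s * h y) * f y)"

lemma twist_measurable [measurable (raw)]:
  assumes [measurable]: "h \<in> borel_measurable borel" "f \<in> borel_measurable borel"
  shows "twist s h f \<in> borel_measurable borel"
  unfolding twist_def by measurable

lemma twist_funpow_measurable [measurable (raw)]:
  "h \<in> borel_measurable borel \<Longrightarrow> f \<in> borel_measurable borel \<Longrightarrow> (twist s h ^^ n) f \<in> borel_measurable borel"
  by (induction n) auto

lemma norm_twist_le:
  assumes [measurable]: "h \<in> borel_measurable borel" "f \<in> borel_measurable borel"
    and "\<And>x. norm (f x) \<le> B"
  shows "norm (twist s h f x) \<le> B"
  unfolding twist_def by (rule norm_kernel_op_le) (use assms in \<open>auto simp: norm_mult\<close>)

lemma norm_twist_funpow_le: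
  assumes "h \<in> borel_measurable borel" "f \<in> borel_measurable borel" "\<And>x. norm (f x) \<le> B"
  shows "norm ((twist s h ^^ n) f x) \<le> B"
  using assms(3)
  by (induction n arbitrary: x) (auto intro!: norm_twist_le twist_funpow_measurable assms(1,2))

lemma L1_twist_le:
  assumes [measurable]: "h \<in> borel_measurable borel" "f \<in> borel_measurable borel"
    and B: "\<And>x. norm (f x) \<le> B"
  shows "(\<integral>x. norm (twist s h f x) \<partial>\<mu>) \<le> (\<integral>x. norm (f x) \<partial>\<mu>)"
  unfolding twist_def using L1_kernel_op_le[of "\<lambda>y. iexp (s * h y) * f y" B] B by (simp add: norm_mult)

lemma twist_diff:
  assumes [measurable]: "h \<in> borel_measurable borel" "f \<in> borel_measurable borel" "g \<in> borel_measurable borel"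
    and f: "\<And>x. norm (f x) \<le> B" and g: "\<And>x. norm (g x) \<le> C"
  shows "twist s h (\<lambda>y. f y - c * g y) x = twist s h f x - c * twist s h g x"
proof -
  have fi: "integrable (K x) (\<lambda>y. iexp (s * h y) * f y)"
    by (rule integrable_bounded(1)[where B=B]) (use f in \<open>simp_all add: norm_mult\<close>)
  have gi: "integrable (K x) (\<lambda>y. iexp (s * h y) * g y)"
    by (rule integrable_bounded(1)[where B=C]) (use g in \<open>simp_all add: norm_mult\<close>)
  have "twist s h (\<lambda>y. f y - c * g y) x = (\<integral>y. iexp (s * h y) * f y - c * (iexp (s * h y) * g y) \<partial>K x)"
    unfolding twist_def kernel_op_def by (intro Bochner_Integration.integral_cong) (auto simp: algebra_simps)
  also have "\<dots> = twist s h f x - c * twist s h g x"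
    unfolding twist_def kernel_op_def using fi gi
    by (subst Bochner_Integration.integral_diff) (auto simp only: integral_mult_right_zero integrable_mult_right)
  finally show ?thesis .
qed

text \<open>The defect of an approximate eigenfunction grows only linearly under iteration, because twisting
  contracts \<open>L\<^sup>1(\<mu>)\<close> and \<open>c\<close> has modulus at most \<open>1\<close>.\<close>

lemma twist_funpow_eigen:
  assumes h [measurable]: "h \<in> borel_measurable borel" and \<psi> [measurable]: "\<psi> \<in> borel_measurable borel"
    and B: "\<And>x. norm (\<psi> x) \<le> B" and c: "norm (c :: complex) \<le> 1"
    and \<delta>: "(\<integral>x. norm (twist s h \<psi> x - c * \<psi> x) \<partial>\<mu>) \<le> \<delta>"
  shows "(\<integral>x. norm ((twist s h ^^ k) \<psi> x - c ^ k * \<psi> x) \<partial>\<mu>) \<le> real k * \<delta>"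
proof (induction k)
  case (Suc k)
  let ?f = "(twist s h ^^ k) \<psi>"
  have fb: "norm (?f x) \<le> B" for x by (rule norm_twist_funpow_le[OF h \<psi> B])
  have ck: "norm (c ^ k) \<le> 1" using c by (simp add: norm_power power_le_one)
  have c\<psi>: "norm (c ^ k * \<psi> x) \<le> B" for x
    using mult_mono[OF ck B[of x]] by (simp add: norm_mult)
  have d: "norm (?f x - c ^ k * \<psi> x) \<le> B + B" for x
    by (rule order_trans[OF norm_triangle_ineq4 add_mono[OF fb c\<psi>]])
  have d': "norm (twist s h (\<lambda>y. ?f y - c ^ k * \<psi> y) x) \<le> B + B" for x
    by (rule norm_twist_le[OF h _ d]) measurable
  have \<psi>': "norm (twist s h \<psi> x) \<le> B" for x by (rule norm_twist_le[OF h \<psi> B])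
  have fb': "norm ((twist s h ^^ Suc k) \<psi> x) \<le> B" for x by (rule norm_twist_funpow_le[OF h \<psi> B])
  have int: "integrable \<mu> (\<lambda>x. norm (f x - b * g x))"
    if "f \<in> borel_measurable borel" "g \<in> borel_measurable borel" "\<And>x. norm (f x) \<le> B" "\<And>x. norm (g x) \<le> B"
    for f g :: "'a \<Rightarrow> complex" and b
    using integrable_bounded(2)[OF that(1,3)] integrable_bounded(2)[OF that(2,4)] by auto
  have i1: "integrable \<mu> (\<lambda>x. norm (twist s h (\<lambda>y. ?f y - c ^ k * \<psi> y) x))"
    by (intro integrable_norm integrable_bounded(2)[OF _ d']) measurable
  have i2: "integrable \<mu> (\<lambda>x. norm (twist s h \<psi> x - c * \<psi> x))"
    by (rule int[OF twist_measurable[OF h \<psi>] \<psi> \<psi>' B])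
  have dec: "(twist s h ^^ Suc k) \<psi> x - c ^ Suc k * \<psi> x
     = twist s h (\<lambda>y. ?f y - c ^ k * \<psi> y) x + c ^ k * (twist s h \<psi> x - c * \<psi> x)" for x
    by (subst twist_diff[OF h _ \<psi> fb B]) (auto simp: algebra_simps)
  have "(\<integral>x. norm ((twist s h ^^ Suc k) \<psi> x - c ^ Suc k * \<psi> x) \<partial>\<mu>)
    \<le> (\<integral>x. norm (twist s h (\<lambda>y. ?f y - c ^ k * \<psi> y) x) + norm (twist s h \<psi> x - c * \<psi> x) \<partial>\<mu>)"
  proof (rule integral_mono)
    show "integrable \<mu> (\<lambda>x. norm (twist s h (\<lambda>y. ?f y - c ^ k * \<psi> y) x) + norm (twist s h \<psi> x - c * \<psi> x))"
      using i1 i2 by auto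
    show "integrable \<mu> (\<lambda>x. norm ((twist s h ^^ Suc k) \<psi> x - c ^ Suc k * \<psi> x))"
      by (rule int[OF twist_funpow_measurable[OF h \<psi>] \<psi> fb' B])
    show "norm ((twist s h ^^ Suc k) \<psi> x - c ^ Suc k * \<psi> x)
      \<le> norm (twist s h (\<lambda>y. ?f y - c ^ k * \<psi> y) x) + norm (twist s h \<psi> x - c * \<psi> x)" for x
      unfolding dec using mult_right_mono[OF ck norm_ge_zero[of "twist s h \<psi> x - c * \<psi> x"]]
      by (intro norm_triangle_le add_mono) (auto simp: norm_mult)
  qed
  also have "\<dots> = (\<integral>x. norm (twist s h (\<lambda>y. ?f y - c ^ k * \<psi> y) x) \<partial>\<mu>) + (\<integral>x. norm (twist s h \<psi> x - c * \<psi> x) \<partial>\<mu>)"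
    by (rule Bochner_Integration.integral_add[OF i1 i2])
  also have "(\<integral>x. norm (twist s h (\<lambda>y. ?f y - c ^ k * \<psi> y) x) \<partial>\<mu>) \<le> (\<integral>x. norm (?f x - c ^ k * \<psi> x) \<partial>\<mu>)"
    by (rule L1_twist_le[OF h _ d]) measurable
  also have "\<dots> \<le> real k * \<delta>" by (rule Suc)
  also note \<delta>
  finally show ?case by (simp add: algebra_simps)
qed simp

end

section \<open>The central limit theorem in stationarity\<close>

definition taylor_err :: "real \<Rightarrow> real \<Rightarrow> real" where
  "taylor_err s z =
     cmod (iexp (s * z) - 1 - \<i> * complex_of_real (s * z) + complex_of_real (s\<^sup>2 / 2 * z\<^sup>2)) / s\<^sup>2"

lemma taylor_err_measurable [measurable]: "taylor_err s \<in> borel_measurable borel"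
  unfolding taylor_err_def by measurable

text \<open>Of the two upper bounds the first is an integrable majorant when only second moments exist, and the
  second yields pointwise convergence as \<open>s\<close> tends to \<open>0\<close>. At \<open>s = 0\<close> the quotient is \<open>0\<close>, so null
  sequences may take the value \<open>0\<close>.\<close>

lemma taylor_err_bounds:
  "0 \<le> taylor_err s z" "taylor_err s z \<le> z\<^sup>2" "taylor_err s z \<le> \<bar>s\<bar> * \<bar>z\<bar> ^ 3 / 6"
proof -
  let ?r = "taylor_err s z"
  have eq: "(\<Sum>k\<le>2. (\<i> * complex_of_real (s * z)) ^ k / fact k)
      = 1 + \<i> * complex_of_real (s * z) - complex_of_real (s\<^sup>2 / 2 * z\<^sup>2)"
    by (simp add: numeral_2_eq_2 power_mult_distrib)
  have r: "?r = cmod (iexp (s * z) - (\<Sum>k\<le>2. (\<i> * complex_of_real (s * z)) ^ k / fact k)) / s\<^sup>2"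
    unfolding taylor_err_def eq by (simp add: algebra_simps)
  show "0 \<le> ?r" by (simp add: taylor_err_def)
  show "?r \<le> z\<^sup>2"
  proof (cases "s = 0")
    case False
    have "?r \<le> (2 * \<bar>s * z\<bar>\<^sup>2 / fact 2) / s\<^sup>2"
      unfolding r by (intro divide_right_mono iexp_approx2) auto
    also have "\<dots> = z\<^sup>2" using False by (simp add: power_mult_distrib)
    finally show ?thesis .
  qed (simp add: taylor_err_def)
  show "?r \<le> \<bar>s\<bar> * \<bar>z\<bar> ^ 3 / 6"
  proof (cases "s = 0")
    case False
    have "?r \<le> (\<bar>s * z\<bar> ^ Suc 2 / fact (Suc 2)) / s\<^sup>2"
      unfolding r by (intro divide_right_mono iexp_approx1) auto
    also have "\<dots> = \<bar>s\<bar> * \<bar>z\<bar> ^ 3 / 6"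
      using False by (simp add: abs_mult power_mult_distrib fact_numeral power3_eq_cube power2_eq_square eval_nat_numeral field_simps)
    finally show ?thesis .
  qed (simp add: taylor_err_def)
qed

text \<open>A solution \<open>hh\<close> of Poisson's equation for \<open>h\<close>. It makes \<open>hh (\<Phi> (k + 1)) - w (\<Phi> k)\<close>, with \<open>w = P hh\<close>, a
  martingale increment whose sum differs from that of \<open>h\<close> by a boundary term.\<close>

locale poisson_pair = ergodic_kernel +
  fixes h hh :: "'a \<Rightarrow> real" and C :: real
  assumes hh_measurable [measurable]: "hh \<in> borel_measurable borel"
    and hh_bound: "\<bar>hh x\<bar> \<le> C * V x"
    and poisson: "hh x - kernel_op hh x = h x"
begin

abbreviation "w \<equiv> kernel_op hh"

lemma h_measurable [measurable]: "h \<in> borel_measurable borel"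
proof -
  have "h = (\<lambda>x. hh x - w x)" using poisson by auto
  then show ?thesis by simp
qed

lemma hh_kernel: "integrable (K x) hh"
  by (rule Bochner_Integration.integrable_bound[of "K x" "\<lambda>x. C * V x"])
    (use V_kernel hh_bound in \<open>auto intro!: AE_I2 intro: order_trans[OF hh_bound abs_ge_self] simp del: abs_mult\<close>)

lemma hh_square: "integrable \<mu> (\<lambda>x. (hh x)\<^sup>2)"
proof (rule Bochner_Integration.integrable_bound)
  show "integrable \<mu> (\<lambda>x. C\<^sup>2 * (V x)\<^sup>2)" using V_square by auto
  show "AE x in \<mu>. norm ((hh x)\<^sup>2) \<le> norm (C\<^sup>2 * (V x)\<^sup>2)"
  proof (intro AE_I2)
    fix x
    have "(hh x)\<^sup>2 \<le> (C * V x)\<^sup>2" using hh_bound[of x] by (rule abs_le_square_iff[THEN iffD1, OF order_trans[OF _ abs_ge_self]])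
    then show "norm ((hh x)\<^sup>2) \<le> norm (C\<^sup>2 * (V x)\<^sup>2)" by (simp add: power_mult_distrib)
  qed
qed auto

text \<open>The conditional variance of the martingale increment, given that the chain is at \<open>x\<close>.\<close>

definition cond_var :: "'a \<Rightarrow> real" where
  "cond_var x = kernel_op (\<lambda>y. (hh y)\<^sup>2) x - (w x)\<^sup>2"

lemma cond_var_measurable [measurable]: "cond_var \<in> borel_measurable borel"
  unfolding cond_var_def by measurable

lemma hh_square_kernel: "AE x in \<mu>. integrable (K x) (\<lambda>y. (hh y)\<^sup>2)"
  by (rule nn_kernel_op_AE) (use hh_square in auto)

lemma increment:
  assumes "integrable (K x) (\<lambda>y. (hh y)\<^sup>2)"
  shows "integrable (K x) (\<lambda>y. hh y - w x)" "(\<integral>y. hh y - w x \<partial>K x) = 0"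
    "integrable (K x) (\<lambda>y. (hh y - w x)\<^sup>2)" "(\<integral>y. (hh y - w x)\<^sup>2 \<partial>K x) = cond_var x"
proof -
  show i1: "integrable (K x) (\<lambda>y. hh y - w x)" using hh_kernel by auto
  show "(\<integral>y. hh y - w x \<partial>K x) = 0" using hh_kernel kernel.prob_space by (simp add: kernel_op_def)
  have eq: "(\<lambda>y. (hh y - w x)\<^sup>2) = (\<lambda>y. (hh y)\<^sup>2 - 2 * w x * hh y + (w x)\<^sup>2)"
    by (auto simp: power2_eq_square algebra_simps)
  show "integrable (K x) (\<lambda>y. (hh y - w x)\<^sup>2)" unfolding eq using assms hh_kernel by auto
  show "(\<integral>y. (hh y - w x)\<^sup>2 \<partial>K x) = cond_var x"
    unfolding eq using assms hh_kernel kernel.prob_space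
    by (simp add: cond_var_def kernel_op_def power2_eq_square)
qed

lemma cond_var_nonneg: "AE x in \<mu>. 0 \<le> cond_var x"
  using hh_square_kernel
proof eventually_elim
  case (elim x)
  show ?case using increment(4)[OF elim, symmetric] by simp
qed

lemma kernel_op_hh_square: "integrable \<mu> (kernel_op (\<lambda>y. (hh y)\<^sup>2))"
  "(\<integral>x. kernel_op (\<lambda>y. (hh y)\<^sup>2) x \<partial>\<mu>) = (\<integral>x. (hh x)\<^sup>2 \<partial>\<mu>)"
  by (rule integral_kernel_op; use hh_square in simp)+

lemma w_square: "integrable \<mu> (\<lambda>x. (w x)\<^sup>2)"
proof (rule Bochner_Integration.integrable_bound[OF kernel_op_hh_square(1)])
  show "AE x in \<mu>. norm ((w x)\<^sup>2) \<le> norm (kernel_op (\<lambda>y. (hh y)\<^sup>2) x)"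
    using cond_var_nonneg by eventually_elim (simp add: cond_var_def)
qed auto

lemma cond_var_integrable: "integrable \<mu> cond_var"
  unfolding cond_var_def using kernel_op_hh_square w_square by auto

definition asymp_var :: real where
  "asymp_var = (\<integral>x. cond_var x \<partial>\<mu>)"

lemma asymp_var_nonneg: "0 \<le> asymp_var"
  unfolding asymp_var_def by (rule integral_nonneg_AE[OF cond_var_nonneg])

text \<open>By invariance \<open>hh\<^sup>2\<close> and \<open>P hh\<^sup>2\<close> have the same integral, and \<open>hh\<^sup>2 - w\<^sup>2\<close> factors as \<open>h * (hh + w)\<close>.\<close>

lemma asymp_var_eq: "asymp_var = (\<integral>x. h x * (2 * hh x - h x) \<partial>\<mu>)"
proof -
  have "asymp_var = (\<integral>x. (hh x)\<^sup>2 - (w x)\<^sup>2 \<partial>\<mu>)"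
    unfolding asymp_var_def cond_var_def using kernel_op_hh_square w_square hh_square by simp
  also have "\<dots> = (\<integral>x. h x * (2 * hh x - h x) \<partial>\<mu>)"
  proof (intro Bochner_Integration.integral_cong refl)
    fix x
    have "w x = hh x - h x" using poisson[of x] by simp
    then show "(hh x)\<^sup>2 - (w x)\<^sup>2 = h x * (2 * hh x - h x)"
      by (simp only:) (simp add: power2_eq_square algebra_simps)
  qed
  finally show ?thesis .
qed

text \<open>The second-order Taylor remainder of the conditional characteristic function of the increment
  \<open>hh y - w x\<close>, whose conditional mean is \<open>0\<close>.\<close>

definition taylor_remainder :: "real \<Rightarrow> 'a \<Rightarrow> complex" where
  "taylor_remainder s x =
     iexp (- (s * w x)) * kernel_op (\<lambda>y. iexp (s * hh y)) x - 1 + complex_of_real (s\<^sup>2 / 2 * cond_var x)"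

lemma taylor_remainder_measurable [measurable]: "taylor_remainder s \<in> borel_measurable borel"
  unfolding taylor_remainder_def by measurable

lemma taylor_remainder_bound:
  assumes sq: "integrable (K x) (\<lambda>y. (hh y)\<^sup>2)"
  shows "integrable (K x) (\<lambda>y. taylor_err s (hh y - w x))"
    and "cmod (taylor_remainder s x) / s\<^sup>2 \<le> (\<integral>y. taylor_err s (hh y - w x) \<partial>K x)"
proof -
  note inc = increment[OF sq]
  let ?D = "\<lambda>y. hh y - w x"
  show int: "integrable (K x) (\<lambda>y. taylor_err s (?D y))"
  proof (rule Bochner_Integration.integrable_bound[OF inc(3)])
    show "AE y in K x. norm (taylor_err s (?D y)) \<le> norm ((?D y)\<^sup>2)"
      using taylor_err_bounds[of s] by auto
  qed simp
  let ?R = "\<lambda>y. iexp (s * ?D y) - 1 - \<i> * complex_of_real (s * ?D y) + complex_of_real (s\<^sup>2 / 2 * (?D y)\<^sup>2)"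
  have ie: "integrable (K x) (\<lambda>y. iexp (s * f y))" if "f \<in> borel_measurable borel" for f
    by (rule integrable_bounded(1)[where B=1]) (use that in auto)
  have i1: "integrable (K x) (\<lambda>y. complex_of_real (s * ?D y))"
    by (intro integrable_of_real integrable_mult_right inc)
  have i2: "integrable (K x) (\<lambda>y. complex_of_real (s\<^sup>2 / 2 * (?D y)\<^sup>2))"
    by (intro integrable_of_real integrable_mult_right inc)
  have e1: "(\<integral>y. complex_of_real (s * ?D y) \<partial>K x) = 0"
    unfolding integral_complex_of_real using inc by simp
  have e2: "(\<integral>y. complex_of_real (s\<^sup>2 / 2 * (?D y)\<^sup>2) \<partial>K x) = complex_of_real (s\<^sup>2 / 2 * cond_var x)"
    unfolding integral_complex_of_real integral_mult_right_zero inc(4) by simp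
  have e0: "(\<integral>y. iexp (s * ?D y) \<partial>K x) = iexp (- (s * w x)) * kernel_op (\<lambda>y. iexp (s * hh y)) x"
  proof -
    have "(\<integral>y. iexp (s * ?D y) \<partial>K x) = (\<integral>y. iexp (- (s * w x)) * iexp (s * hh y) \<partial>K x)"
      by (intro Bochner_Integration.integral_cong) (auto simp: exp_add[symmetric] algebra_simps)
    then show ?thesis by (simp add: kernel_op_def)
  qed
  have split: "(\<integral>y. f y - 1 - \<i> * g y + k y \<partial>K x) = (\<integral>y. f y \<partial>K x) - 1 - \<i> * (\<integral>y. g y \<partial>K x) + (\<integral>y. k y \<partial>K x)"
    if "integrable (K x) f" "integrable (K x) g" "integrable (K x) k" for f g k :: "'a \<Rightarrow> complex"
    using that kernel.prob_space by simp
  have "(\<integral>y. ?R y \<partial>K x) = (\<integral>y. iexp (s * ?D y) \<partial>K x) - 1 - \<i> * (\<integral>y. complex_of_real (s * ?D y) \<partial>K x)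
      + (\<integral>y. complex_of_real (s\<^sup>2 / 2 * (?D y)\<^sup>2) \<partial>K x)"
    by (rule split[OF _ i1 i2], rule ie) measurable
  then have "taylor_remainder s x = (\<integral>y. ?R y \<partial>K x)"
    unfolding e0 e1 e2 by (simp add: taylor_remainder_def)
  then have "cmod (taylor_remainder s x) \<le> (\<integral>y. cmod (?R y) \<partial>K x)" by simp
  then have "cmod (taylor_remainder s x) / s\<^sup>2 \<le> (\<integral>y. cmod (?R y) \<partial>K x) / s\<^sup>2"
    by (rule divide_right_mono) simp
  also have "\<dots> = (\<integral>y. taylor_err s (?D y) \<partial>K x)" by (simp add: taylor_err_def)
  finally show "cmod (taylor_remainder s x) / s\<^sup>2 \<le> (\<integral>y. taylor_err s (?D y) \<partial>K x)" .
qed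

text \<open>Dominated convergence is applied twice: under the kernel with the squared increment as majorant, then
  under \<open>\<mu>\<close> with the conditional variance as majorant.\<close>

lemma taylor_remainder_tendsto:
  assumes s: "s \<longlonglongrightarrow> (0::real)"
  shows "(\<lambda>k. \<integral>x. cmod (taylor_remainder (s k) x) / (s k)\<^sup>2 \<partial>\<mu>) \<longlonglongrightarrow> 0"
    and "integrable \<mu> (\<lambda>x. cmod (taylor_remainder (s k) x) / (s k)\<^sup>2)"
proof -
  have bound: "AE x in \<mu>. norm (cmod (taylor_remainder (s k) x) / (s k)\<^sup>2) \<le> cond_var x" for k
    using hh_square_kernel
  proof eventually_elim
    case (elim x)
    note t = taylor_remainder_bound[OF elim, of "s k"] and inc = increment[OF elim]
    have "(\<integral>y. taylor_err (s k) (hh y - w x) \<partial>K x) \<le> (\<integral>y. (hh y - w x)\<^sup>2 \<partial>K x)"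
      by (rule integral_mono[OF t(1) inc(3)]) (rule taylor_err_bounds)
    then show ?case using t(2) inc(4) by simp
  qed
  have lim: "AE x in \<mu>. (\<lambda>k. cmod (taylor_remainder (s k) x) / (s k)\<^sup>2) \<longlonglongrightarrow> 0"
    using hh_square_kernel
  proof eventually_elim
    case (elim x)
    have "(\<lambda>k. \<integral>y. taylor_err (s k) (hh y - w x) \<partial>K x) \<longlonglongrightarrow> (\<integral>y. 0 \<partial>K x)"
    proof (rule integral_dominated_convergence)
      show "integrable (K x) (\<lambda>y. (hh y - w x)\<^sup>2)" by (rule increment[OF elim])
      show "AE y in K x. (\<lambda>k. taylor_err (s k) (hh y - w x)) \<longlonglongrightarrow> 0"
      proof (intro AE_I2)
        fix y
        have "(\<lambda>k. \<bar>s k\<bar> * \<bar>hh y - w x\<bar> ^ 3 / 6) \<longlonglongrightarrow> \<bar>0\<bar> * \<bar>hh y - w x\<bar> ^ 3 / 6"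
          by (intro tendsto_intros s) simp
        then have "(\<lambda>k. \<bar>s k\<bar> * \<bar>hh y - w x\<bar> ^ 3 / 6) \<longlonglongrightarrow> 0" by simp
        then show "(\<lambda>k. taylor_err (s k) (hh y - w x)) \<longlonglongrightarrow> 0"
          by (rule Lim_null_comparison[rotated]) (intro always_eventually allI, use taylor_err_bounds in simp)
      qed
      show "AE y in K x. norm (taylor_err (s k) (hh y - w x)) \<le> (hh y - w x)\<^sup>2" for k
        using taylor_err_bounds[of "s k"] by auto
    qed auto
    then have "(\<lambda>k. \<integral>y. taylor_err (s k) (hh y - w x) \<partial>K x) \<longlonglongrightarrow> 0" by simp
    then show ?case
      by (rule Lim_null_comparison[rotated])
        (intro always_eventually allI, use taylor_remainder_bound(2)[OF elim] in simp)
  qed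
  have "(\<lambda>k. \<integral>x. cmod (taylor_remainder (s k) x) / (s k)\<^sup>2 \<partial>\<mu>) \<longlonglongrightarrow> (\<integral>x. 0 \<partial>\<mu>)"
    by (rule integral_dominated_convergence[OF _ _ cond_var_integrable lim bound]) auto
  then show "(\<lambda>k. \<integral>x. cmod (taylor_remainder (s k) x) / (s k)\<^sup>2 \<partial>\<mu>) \<longlonglongrightarrow> 0" by simp
  show "integrable \<mu> (\<lambda>x. cmod (taylor_remainder (s k) x) / (s k)\<^sup>2)"
    by (rule Bochner_Integration.integrable_bound[OF cond_var_integrable])
      (use bound[of k] in \<open>auto elim!: eventually_mono\<close>)
qed

text \<open>What the phase of the increment changes in \<open>P u\<close>.\<close>

definition phase_remainder :: "('a \<Rightarrow> real) \<Rightarrow> real \<Rightarrow> 'a \<Rightarrow> complex" where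
  "phase_remainder u s x =
     iexp (- (s * w x)) * kernel_op (\<lambda>y. iexp (s * hh y) * complex_of_real (u y)) x - complex_of_real (kernel_op u x)"

lemma phase_remainder_tendsto:
  assumes s: "s \<longlonglongrightarrow> (0::real)" and u [measurable]: "u \<in> borel_measurable borel" and B: "\<And>x. \<bar>u x\<bar> \<le> B"
  shows "(\<lambda>k. \<integral>x. cmod (phase_remainder u (s k) x) \<partial>\<mu>) \<longlonglongrightarrow> 0"
    and "integrable \<mu> (\<lambda>x. cmod (phase_remainder u (s k) x))"
proof -
  have [measurable]: "phase_remainder u s \<in> borel_measurable borel" for s
    unfolding phase_remainder_def by measurable
  have bd: "cmod (phase_remainder u s x) \<le> B + B" for s x
  proof -
    have "cmod (kernel_op (\<lambda>y. iexp (s * hh y) * complex_of_real (u y)) x) \<le> B"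
      by (rule norm_kernel_op_le) (use B in \<open>simp_all add: norm_mult\<close>)
    moreover have "\<bar>kernel_op u x\<bar> \<le> B" using norm_kernel_op_le[OF u, of B x] B by simp
    ultimately show ?thesis unfolding phase_remainder_def
      by (intro order_trans[OF norm_triangle_ineq4] add_mono) (simp_all add: norm_mult)
  qed
  have lim: "(\<lambda>k. cmod (phase_remainder u (s k) x)) \<longlonglongrightarrow> 0" for x
  proof -
    have "(\<lambda>k. kernel_op (\<lambda>y. iexp (s k * hh y) * complex_of_real (u y)) x) \<longlonglongrightarrow> (\<integral>y. complex_of_real (u y) \<partial>K x)"
      unfolding kernel_op_def
    proof (rule integral_dominated_convergence[where w="\<lambda>_. B"])
      show "AE y in K x. (\<lambda>k. iexp (s k * hh y) * complex_of_real (u y)) \<longlonglongrightarrow> complex_of_real (u y)"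
      proof (intro AE_I2)
        fix y
        have "(\<lambda>k. iexp (s k * hh y) * complex_of_real (u y)) \<longlonglongrightarrow> iexp (0 * hh y) * complex_of_real (u y)"
          by (intro tendsto_intros s)
        then show "(\<lambda>k. iexp (s k * hh y) * complex_of_real (u y)) \<longlonglongrightarrow> complex_of_real (u y)" by simp
      qed
      show "AE y in K x. norm (iexp (s k * hh y) * complex_of_real (u y)) \<le> B" for k
        using B by (simp add: norm_mult)
    qed auto
    then have "(\<lambda>k. phase_remainder u (s k) x) \<longlonglongrightarrow> iexp (- (0 * w x)) * (\<integral>y. complex_of_real (u y) \<partial>K x) - complex_of_real (kernel_op u x)"
      unfolding phase_remainder_def by (intro tendsto_intros s)
    then have "(\<lambda>k. phase_remainder u (s k) x) \<longlonglongrightarrow> 0" by (simp add: kernel_op_def)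
    then show ?thesis by (rule tendsto_norm_zero)
  qed
  have "(\<lambda>k. \<integral>x. cmod (phase_remainder u (s k) x) \<partial>\<mu>) \<longlonglongrightarrow> (\<integral>x. 0 \<partial>\<mu>)"
    by (rule integral_dominated_convergence[where w="\<lambda>_. B + B"]) (use bd lim in auto)
  then show "(\<lambda>k. \<integral>x. cmod (phase_remainder u (s k) x) \<partial>\<mu>) \<longlonglongrightarrow> 0" by simp
  show "integrable \<mu> (\<lambda>x. cmod (phase_remainder u (s k) x))"
    by (intro integrable_norm integrable_bounded(2)[OF _ bd]) measurable
qed

text \<open>The phase \<open>exp (i s w)\<close> turns the twist by \<open>h\<close> into the twist by the martingale increment, since
  \<open>h + w = hh\<close>; the factor \<open>1 - s\<^sup>2 u / 2\<close> corrects for the conditional variance not being constant.\<close>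

definition perturbed :: "('a \<Rightarrow> real) \<Rightarrow> real \<Rightarrow> 'a \<Rightarrow> complex" where
  "perturbed u s x = iexp (s * w x) * complex_of_real (1 - s\<^sup>2 / 2 * u x)"

lemma perturbed_measurable [measurable (raw)]:
  assumes [measurable]: "u \<in> borel_measurable borel"
  shows "perturbed u s \<in> borel_measurable borel"
  unfolding perturbed_def by measurable

lemma perturbed_bound:
  assumes "\<And>x. \<bar>u x\<bar> \<le> B"
  shows "cmod (perturbed u s x) \<le> 1 + s\<^sup>2 / 2 * B"
proof -
  have "\<bar>1 - s\<^sup>2 / 2 * u x\<bar> \<le> \<bar>1\<bar> + \<bar>s\<^sup>2 / 2 * u x\<bar>" by (rule abs_triangle_ineq4)
  also have "\<dots> = 1 + s\<^sup>2 / 2 * \<bar>u x\<bar>" by (simp add: abs_mult)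
  also have "\<dots> \<le> 1 + s\<^sup>2 / 2 * B" using assms[of x] by (intro add_left_mono mult_left_mono) auto
  finally have "\<bar>1 - s\<^sup>2 / 2 * u x\<bar> \<le> 1 + s\<^sup>2 / 2 * B" .
  then show ?thesis unfolding perturbed_def norm_mult norm_of_real by simp
qed

text \<open>To order \<open>s\<^sup>2\<close> the twist multiplies \<open>1 - s\<^sup>2 u / 2\<close> by the constant \<open>1 - s\<^sup>2 v / 2\<close>, where \<open>v\<close> is the asymptotic
  variance, exactly when \<open>u - P u = cond_var - v\<close>. The right-hand side collects all deviations from this.\<close>

lemma twist_perturbed:
  assumes u [measurable]: "u \<in> borel_measurable borel" and B: "\<And>x. \<bar>u x\<bar> \<le> B"
  shows "twist s h (perturbed u s) x - complex_of_real (1 - s\<^sup>2 / 2 * asymp_var) * perturbed u s x =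
    iexp (s * w x) * (taylor_remainder s x - complex_of_real (s\<^sup>2 / 2) * phase_remainder u s x
      - complex_of_real (s\<^sup>2 / 2 * (kernel_op u x - u x + cond_var x - asymp_var))
      - complex_of_real (s ^ 4 / 4 * asymp_var * u x))"
proof -
  let ?E = "iexp (s * w x)" and ?E' = "iexp (- (s * w x))"
  have EE: "?E * ?E' = 1" by (simp add: exp_add[symmetric])
  let ?A = "kernel_op (\<lambda>y. iexp (s * hh y)) x" and ?U = "kernel_op (\<lambda>y. iexp (s * hh y) * complex_of_real (u y)) x"
  have i1: "integrable (K x) (\<lambda>y. iexp (s * hh y))"
    by (rule integrable_bounded(1)[where B=1]) auto
  have i2: "integrable (K x) (\<lambda>y. iexp (s * hh y) * complex_of_real (u y))"
    by (rule integrable_bounded(1)[where B=B]) (use B in \<open>simp_all add: norm_mult\<close>)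
  have "twist s h (perturbed u s) x =
    (\<integral>y. iexp (s * hh y) - complex_of_real (s\<^sup>2 / 2) * (iexp (s * hh y) * complex_of_real (u y)) \<partial>K x)"
    unfolding twist_def kernel_op_def[of "\<lambda>y. iexp (s * h y) * perturbed u s y"]
  proof (intro Bochner_Integration.integral_cong refl)
    fix y
    have e: "iexp (s * h y) * iexp (s * w y) = iexp (s * hh y)"
    proof -
      have "hh y = h y + w y" using poisson[of y] by simp
      then show ?thesis by (simp only: distrib_left of_real_add exp_add)
    qed
    have "iexp (s * h y) * perturbed u s y = (iexp (s * h y) * iexp (s * w y)) * (1 - complex_of_real (s\<^sup>2 / 2) * complex_of_real (u y))"
      by (simp add: perturbed_def)
    also have "\<dots> = iexp (s * hh y) - complex_of_real (s\<^sup>2 / 2) * (iexp (s * hh y) * complex_of_real (u y))"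
      unfolding e by (simp add: algebra_simps)
    finally show "iexp (s * h y) * perturbed u s y =
       iexp (s * hh y) - complex_of_real (s\<^sup>2 / 2) * (iexp (s * hh y) * complex_of_real (u y))" .
  qed
  also have "\<dots> = ?A - complex_of_real (s\<^sup>2 / 2) * ?U"
    using i1 i2 by (simp only: Bochner_Integration.integral_diff integrable_mult_right integral_mult_right_zero kernel_op_def)
  finally have tw: "twist s h (perturbed u s) x = ?A - complex_of_real (s\<^sup>2 / 2) * ?U" .
  have alg: "A - S * U - (1 - S * v) * (E * (1 - S * b)) =
      E * ((E' * A - 1 + S * g) - S * (E' * U - k) - (S * (k - b + g - v)) - (S * S * v * b))"
    if "E * E' = 1" for A S U v E b E' g k :: complex
  proof -
    have "E * ((E' * A - 1 + S * g) - S * (E' * U - k) - (S * (k - b + g - v)) - (S * S * v * b))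
      = (E * E') * A - S * ((E * E') * U) - E * (1 - S * b - S * v + S * S * v * b)"
      by (simp add: algebra_simps)
    then show ?thesis unfolding that by (simp add: algebra_simps)
  qed
  have "complex_of_real (s ^ 4 / 4 * asymp_var * u x) =
    complex_of_real (s\<^sup>2 / 2) * complex_of_real (s\<^sup>2 / 2) * complex_of_real asymp_var * complex_of_real (u x)"
    by (simp add: eval_nat_numeral)
  then show ?thesis
    unfolding tw perturbed_def taylor_remainder_def phase_remainder_def
    using alg[OF EE, of ?A "complex_of_real (s\<^sup>2 / 2)" ?U "complex_of_real asymp_var" "complex_of_real (u x)"
        "complex_of_real (cond_var x)" "complex_of_real (kernel_op u x)"]
    by (simp only: of_real_diff of_real_mult of_real_add of_real_1)
qed

text \<open>Relative to \<open>s\<^sup>2\<close>, every term on the right of \<open>twist_perturbed\<close> vanishes in the limit except the one with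
  \<open>u - P u\<close>, which is at most \<open>\<epsilon>\<close> in \<open>L\<^sup>1(\<mu>)\<close> by the choice of \<open>u\<close>.\<close>

lemma approximate_eigenfunction:
  assumes s: "s \<longlonglongrightarrow> (0::real)" and \<epsilon>: "0 < \<epsilon>"
  obtains u B \<delta> where "u \<in> borel_measurable borel" "\<And>x. \<bar>u x\<bar> \<le> B" "\<delta> \<longlonglongrightarrow> (0::real)"
    "\<And>k. (\<integral>x. cmod (twist (s k) h (perturbed u (s k)) x
         - complex_of_real (1 - (s k)\<^sup>2 / 2 * asymp_var) * perturbed u (s k) x) \<partial>\<mu>) \<le> (s k)\<^sup>2 * (\<delta> k + \<epsilon>)"
proof -
  obtain u B where u [measurable]: "u \<in> borel_measurable borel" and B: "\<And>x. \<bar>u x\<bar> \<le> B"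
    and ue: "(\<integral>x. \<bar>u x - kernel_op u x - (cond_var x - asymp_var)\<bar> \<partial>\<mu>) \<le> \<epsilon>"
    using bounded_approximate_poisson_solution[OF cond_var_measurable cond_var_integrable \<epsilon>]
    unfolding asymp_var_def by metis
  define d where "d x = \<bar>u x - kernel_op u x - (cond_var x - asymp_var)\<bar>" for x
  define \<delta> where "\<delta> k = (\<integral>x. cmod (taylor_remainder (s k) x) / (s k)\<^sup>2 \<partial>\<mu>)
     + 1 / 2 * (\<integral>x. cmod (phase_remainder u (s k) x) \<partial>\<mu>) + (s k)\<^sup>2 * (asymp_var * B / 4)" for k
  note T = taylor_remainder_tendsto[OF s] and Ph = phase_remainder_tendsto[OF s u B]
  have "\<delta> \<longlonglongrightarrow> 0 + 1 / 2 * 0 + 0\<^sup>2 * (asymp_var * B / 4)"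
    unfolding \<delta>_def by (intro tendsto_intros T Ph s)
  then have \<delta>: "\<delta> \<longlonglongrightarrow> 0" by simp
  have ub: "norm (u x) \<le> B" for x using B by simp
  have dint: "integrable \<mu> d"
  proof -
    have "norm (kernel_op u x) \<le> B" for x by (rule norm_kernel_op_le[OF u ub])
    then have "integrable \<mu> (kernel_op u)" by (rule integrable_bounded(2)[OF kernel_op_measurable[OF u]])
    then show ?thesis unfolding d_def
      using integrable_bounded(2)[OF u ub] cond_var_integrable by auto
  qed
  have "(\<integral>x. cmod (twist (s k) h (perturbed u (s k)) x
         - complex_of_real (1 - (s k)\<^sup>2 / 2 * asymp_var) * perturbed u (s k) x) \<partial>\<mu>) \<le> (s k)\<^sup>2 * (\<delta> k + \<epsilon>)" for k
  proof -
    let ?r = "\<lambda>x. (s k)\<^sup>2 * (cmod (taylor_remainder (s k) x) / (s k)\<^sup>2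
      + 1 / 2 * cmod (phase_remainder u (s k) x) + 1 / 2 * d x + (s k)\<^sup>2 * (asymp_var * B / 4))"
    have rint: "integrable \<mu> ?r" using T(2) Ph(2) dint by auto
    have le: "cmod (twist (s k) h (perturbed u (s k)) x
         - complex_of_real (1 - (s k)\<^sup>2 / 2 * asymp_var) * perturbed u (s k) x) \<le> ?r x" for x
    proof -
      have t: "cmod (taylor_remainder (s k) x) = (s k)\<^sup>2 * (cmod (taylor_remainder (s k) x) / (s k)\<^sup>2)"
      proof (cases "s k = 0")
        case True
        then show ?thesis using kernel.prob_space by (simp add: taylor_remainder_def kernel_op_def)
      qed simp
      have p: "cmod (complex_of_real ((s k)\<^sup>2 / 2) * phase_remainder u (s k) x)
         = (s k)\<^sup>2 * (1 / 2 * cmod (phase_remainder u (s k) x))"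
        unfolding norm_mult norm_of_real by simp
      have q: "cmod (complex_of_real ((s k)\<^sup>2 / 2 * (kernel_op u x - u x + cond_var x - asymp_var))) = (s k)\<^sup>2 * (1 / 2 * d x)"
      proof -
        have "\<bar>kernel_op u x - u x + cond_var x - asymp_var\<bar> = d x" unfolding d_def by linarith
        then show ?thesis unfolding norm_of_real by (simp add: abs_mult)
      qed
      have v: "cmod (complex_of_real ((s k) ^ 4 / 4 * asymp_var * u x)) \<le> (s k)\<^sup>2 * ((s k)\<^sup>2 * (asymp_var * B / 4))"
      proof -
        have "cmod (complex_of_real ((s k) ^ 4 / 4 * asymp_var * u x)) = (s k) ^ 4 / 4 * asymp_var * \<bar>u x\<bar>"
          unfolding norm_of_real using asymp_var_nonneg by (simp add: abs_mult)
        also have "\<dots> \<le> (s k) ^ 4 / 4 * asymp_var * B"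
          using B[of x] asymp_var_nonneg by (intro mult_left_mono) auto
        also have "\<dots> = (s k)\<^sup>2 * ((s k)\<^sup>2 * (asymp_var * B / 4))" by (simp add: eval_nat_numeral)
        finally show ?thesis .
      qed
      have e: "cmod (iexp (s k * w x)) = 1" by simp
      have four: "cmod (a - b - c - f) \<le> A + B' + C + F"
        if "cmod a \<le> A" "cmod b \<le> B'" "cmod c \<le> C" "cmod f \<le> F" for a b c f :: complex and A B' C F
        using that norm_triangle_ineq4[of "a - b - c" f] norm_triangle_ineq4[of "a - b" c] norm_triangle_ineq4[of a b]
        by linarith
      show ?thesis
        unfolding twist_perturbed[OF u B] norm_mult[of "iexp (s k * w x)"] e mult_1_left distrib_left
        by (rule four[OF eq_refl[OF t] eq_refl[OF p] eq_refl[OF q] v])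
    qed
    have "(\<integral>x. cmod (twist (s k) h (perturbed u (s k)) x
         - complex_of_real (1 - (s k)\<^sup>2 / 2 * asymp_var) * perturbed u (s k) x) \<partial>\<mu>) \<le> (\<integral>x. ?r x \<partial>\<mu>)"
    proof (rule integral_mono[OF _ rint le])
      show "integrable \<mu> (\<lambda>x. cmod (twist (s k) h (perturbed u (s k)) x
         - complex_of_real (1 - (s k)\<^sup>2 / 2 * asymp_var) * perturbed u (s k) x))"
      proof (rule Bochner_Integration.integrable_bound[OF rint _ AE_I2])
        fix x
        show "norm (cmod (twist (s k) h (perturbed u (s k)) x
         - complex_of_real (1 - (s k)\<^sup>2 / 2 * asymp_var) * perturbed u (s k) x)) \<le> norm (?r x)"
          using order_trans[OF le[of x] abs_ge_self] by (simp only: real_norm_def abs_norm_cancel)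
      qed measurable
    qed
    also have "\<dots> = (s k)\<^sup>2 * (\<delta> k + 1 / 2 * (\<integral>x. d x \<partial>\<mu>))"
    proof -
      have "(\<integral>x. c * (f x + 1 / 2 * g x + 1 / 2 * d x + b) \<partial>\<mu>)
        = c * ((\<integral>x. f x \<partial>\<mu>) + 1 / 2 * (\<integral>x. g x \<partial>\<mu>) + b + 1 / 2 * (\<integral>x. d x \<partial>\<mu>))"
        if "integrable \<mu> f" "integrable \<mu> g" for f g b c
        using that dint mu.prob_space by simp
      from this[OF T(2)[of k] Ph(2)[of k]] show ?thesis by (simp only: \<delta>_def)
    qed
    also have "\<dots> \<le> (s k)\<^sup>2 * (\<delta> k + \<epsilon>)"
      using ue \<epsilon> by (intro mult_left_mono add_left_mono) (auto simp: d_def)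
    finally show ?thesis .
  qed
  then show thesis using that u B \<delta> by blast
qed

lemma perturbed_tendsto:
  assumes s: "s \<longlonglongrightarrow> (0::real)" and u [measurable]: "u \<in> borel_measurable borel" and B: "\<And>x. \<bar>u x\<bar> \<le> B"
  shows "(\<lambda>k. \<integral>x. cmod (1 - perturbed u (s k) x) \<partial>\<mu>) \<longlonglongrightarrow> 0"
proof -
  have B0: "0 \<le> B" using B[of undefined] by linarith
  obtain S where S: "\<And>k. \<bar>s k\<bar> \<le> S"
    using s convergent_imp_Bseq[of s] by (auto simp: convergent_def Bseq_def)
  have "(\<lambda>k. \<integral>x. cmod (1 - perturbed u (s k) x) \<partial>\<mu>) \<longlonglongrightarrow> (\<integral>x. 0 \<partial>\<mu>)"
  proof (rule integral_dominated_convergence[where w="\<lambda>_. 2 + S\<^sup>2 / 2 * B"])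
    show "AE x in \<mu>. (\<lambda>k. cmod (1 - perturbed u (s k) x)) \<longlonglongrightarrow> 0"
    proof (intro AE_I2)
      fix x
      have "(\<lambda>k. cmod (1 - perturbed u (s k) x)) \<longlonglongrightarrow> cmod (1 - iexp (0 * w x) * complex_of_real (1 - 0\<^sup>2 / 2 * u x))"
        unfolding perturbed_def by (intro tendsto_intros s) auto
      then show "(\<lambda>k. cmod (1 - perturbed u (s k) x)) \<longlonglongrightarrow> 0" by simp
    qed
    show "AE x in \<mu>. norm (cmod (1 - perturbed u (s k) x)) \<le> 2 + S\<^sup>2 / 2 * B" for k
    proof (intro AE_I2)
      fix x
      have "(s k)\<^sup>2 \<le> S\<^sup>2" using S[of k] abs_le_square_iff by fastforce
      then have "(s k)\<^sup>2 / 2 * B \<le> S\<^sup>2 / 2 * B" using B0 by (intro mult_right_mono) auto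
      then show "norm (cmod (1 - perturbed u (s k) x)) \<le> 2 + S\<^sup>2 / 2 * B"
        using norm_triangle_ineq4[of 1 "perturbed u (s k) x"] perturbed_bound[of u B "s k" x, OF B] by simp
    qed
  qed auto
  then show ?thesis by simp
qed

text \<open>At \<open>s = t / sqrt k\<close> the defects of \<open>k\<close> iterations add up to at most \<open>t\<^sup>2\<close> times an arbitrarily small
  constant, and \<open>(1 - s\<^sup>2 v / 2)\<^sup>k\<close> tends to \<open>exp (- v t\<^sup>2 / 2)\<close>.\<close>

lemma char_stationary:
  "(\<lambda>k. \<integral>x. (twist (t / sqrt (real k)) h ^^ k) (\<lambda>_. 1) x \<partial>\<mu>) \<longlonglongrightarrow> complex_of_real (exp (- (asymp_var * t\<^sup>2 / 2)))"
proof (rule tendstoI)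
  fix e :: real assume e: "0 < e"
  define s where "s k = t / sqrt (real k)" for k
  have s0: "s \<longlonglongrightarrow> 0"
    unfolding s_def by (intro tendsto_divide_0[OF tendsto_const] filterlim_at_top_imp_at_infinity
        filterlim_compose[OF sqrt_at_top filterlim_real_sequentially])
  \<comment> \<open>The accumulated defect is about \<open>t\<^sup>2 * \<epsilon>\<close>, which this makes smaller than \<open>e\<close>, also for \<open>t = 0\<close>.\<close>
  define \<epsilon> where "\<epsilon> = e / (t\<^sup>2 + 1)"
  have pos: "0 < t\<^sup>2 + 1" by (simp add: add_nonneg_pos)
  have \<epsilon>: "0 < \<epsilon>" using e pos by (simp add: \<epsilon>_def)
  have t\<epsilon>: "t\<^sup>2 * \<epsilon> < e"
  proof -
    have "e = \<epsilon> * (t\<^sup>2 + 1)" using pos by (simp add: \<epsilon>_def)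
    also have "\<dots> = t\<^sup>2 * \<epsilon> + \<epsilon>" by (simp add: algebra_simps)
    finally show ?thesis using \<epsilon> by linarith
  qed
  obtain u B \<delta> where u [measurable]: "u \<in> borel_measurable borel" and B: "\<And>x. \<bar>u x\<bar> \<le> B" and \<delta>: "\<delta> \<longlonglongrightarrow> (0::real)"
    and eig: "\<And>k. (\<integral>x. cmod (twist (s k) h (perturbed u (s k)) x
         - complex_of_real (1 - (s k)\<^sup>2 / 2 * asymp_var) * perturbed u (s k) x) \<partial>\<mu>) \<le> (s k)\<^sup>2 * (\<delta> k + \<epsilon>)"
    by (rule approximate_eigenfunction[OF s0 \<epsilon>], rule that)
  define c where "c k = 1 - (s k)\<^sup>2 / 2 * asymp_var" for k
  define D where "D k = (\<integral>x. cmod (1 - perturbed u (s k) x) \<partial>\<mu>)" for k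
  define l where "l = exp (- (asymp_var * t\<^sup>2 / 2))"
  have D0: "D \<longlonglongrightarrow> 0" unfolding D_def by (rule perturbed_tendsto[OF s0 u B])
  have ck: "(\<lambda>k. c k ^ k) \<longlonglongrightarrow> l"
  proof (rule Lim_transform_eventually)
    show "(\<lambda>k. (1 + (- (asymp_var * t\<^sup>2 / 2)) / real k) ^ k) \<longlonglongrightarrow> l"
      unfolding l_def by (rule tendsto_exp_limit_sequentially)
    show "\<forall>\<^sub>F k in sequentially. (1 + (- (asymp_var * t\<^sup>2 / 2)) / real k) ^ k = c k ^ k"
      using eventually_gt_at_top[of 0]
    proof eventually_elim
      case (elim k)
      have "(s k)\<^sup>2 = t\<^sup>2 / real k" by (simp add: s_def power_divide)
      then show ?case by (simp add: c_def field_simps)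
    qed
  qed
  have "(\<lambda>k. (s k)\<^sup>2 / 2 * asymp_var) \<longlonglongrightarrow> 0\<^sup>2 / 2 * asymp_var" by (intro tendsto_intros s0) auto
  then have "eventually (\<lambda>k. (s k)\<^sup>2 / 2 * asymp_var < 1) sequentially"
    by (rule order_tendstoD(2)) simp
  then have c1: "eventually (\<lambda>k. \<bar>c k\<bar> \<le> 1) sequentially"
  proof eventually_elim
    case (elim k)
    have "0 \<le> (s k)\<^sup>2 / 2 * asymp_var" using asymp_var_nonneg by simp
    then show ?case using elim unfolding c_def by linarith
  qed
  have "(\<lambda>k. D k + t\<^sup>2 * (\<delta> k + \<epsilon>) + D k + \<bar>c k ^ k - l\<bar>) \<longlonglongrightarrow> 0 + t\<^sup>2 * (0 + \<epsilon>) + 0 + \<bar>l - l\<bar>"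
    by (intro tendsto_intros D0 \<delta> ck)
  then have "eventually (\<lambda>k. D k + t\<^sup>2 * (\<delta> k + \<epsilon>) + D k + \<bar>c k ^ k - l\<bar> < e) sequentially"
    by (rule order_tendstoD(2)) (use t\<epsilon> in simp)
  then show "eventually (\<lambda>k. dist (\<integral>x. (twist (t / sqrt (real k)) h ^^ k) (\<lambda>_. 1) x \<partial>\<mu>)
      (complex_of_real (exp (- (asymp_var * t\<^sup>2 / 2)))) < e) sequentially"
    using c1 eventually_gt_at_top[of 0]
  proof eventually_elim
    case (elim k)
    let ?\<psi> = "perturbed u (s k)" and ?R = "twist (s k) h ^^ k" and ?P = "1 + (s k)\<^sup>2 / 2 * B"
    have B0: "0 \<le> B" using B[of undefined] by linarith
    have P: "1 \<le> ?P" using B0 by simp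
    have \<psi>: "norm (?\<psi> x) \<le> ?P" for x by (rule perturbed_bound[OF B])
    have m1 [measurable]: "?R (\<lambda>_. 1) \<in> borel_measurable borel" "?R ?\<psi> \<in> borel_measurable borel" by measurable
    have b1: "norm (?R (\<lambda>_. 1) x) \<le> ?P" and b2: "norm (?R ?\<psi> x) \<le> ?P" for x
      by (rule norm_twist_funpow_le; use P \<psi> in simp)+
    note i1 = integrable_bounded(2)[OF m1(1) b1] and i2 = integrable_bounded(2)[OF m1(2) b2]
    have i3: "integrable \<mu> ?\<psi>" by (rule integrable_bounded(2)[OF _ \<psi>]) measurable
    have sk: "real k * (s k)\<^sup>2 = t\<^sup>2" using elim by (simp add: s_def power_divide)
    have e1: "(\<integral>x. cmod (?R (\<lambda>_. 1) x - ?R ?\<psi> x) \<partial>\<mu>) \<le> D k"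
    proof -
      have "(\<integral>x. cmod ((twist (s k) h ^^ n) (\<lambda>_. 1) x - (twist (s k) h ^^ n) ?\<psi> x) \<partial>\<mu>) \<le> D k" for n
      proof (induction n)
        case (Suc n)
        let ?f = "(twist (s k) h ^^ n) (\<lambda>_. 1)" and ?g = "(twist (s k) h ^^ n) ?\<psi>"
        have fb: "norm (?f x) \<le> ?P" and gb: "norm (?g x) \<le> ?P" for x
          by (rule norm_twist_funpow_le; use P \<psi> in simp)+
        have fg: "norm (?f x - 1 * ?g x) \<le> ?P + ?P" for x
          using order_trans[OF norm_triangle_ineq4 add_mono[OF fb gb], of x x] by (simp only: mult_1_left)
        have "(\<integral>x. cmod ((twist (s k) h ^^ Suc n) (\<lambda>_. 1) x - (twist (s k) h ^^ Suc n) ?\<psi> x) \<partial>\<mu>)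
          = (\<integral>x. cmod (twist (s k) h (\<lambda>y. ?f y - 1 * ?g y) x) \<partial>\<mu>)"
          by (subst twist_diff[OF _ _ _ fb gb]) (auto intro!: twist_funpow_measurable)
        also have "\<dots> \<le> (\<integral>x. cmod (?f x - 1 * ?g x) \<partial>\<mu>)"
          by (rule L1_twist_le[OF _ _ fg]) measurable
        finally show ?case using Suc by simp
      qed (simp add: D_def)
      then show ?thesis by blast
    qed
    have e2: "(\<integral>x. cmod (?R ?\<psi> x - complex_of_real (c k) ^ k * ?\<psi> x) \<partial>\<mu>) \<le> t\<^sup>2 * (\<delta> k + \<epsilon>)"
    proof -
      have "(\<integral>x. cmod (?R ?\<psi> x - complex_of_real (c k) ^ k * ?\<psi> x) \<partial>\<mu>) \<le> real k * ((s k)\<^sup>2 * (\<delta> k + \<epsilon>))"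
      proof (rule twist_funpow_eigen[OF h_measurable perturbed_measurable[OF u] \<psi>])
        show "norm (complex_of_real (c k)) \<le> 1" using elim by simp
      qed (rule eig[of k, folded c_def])
      then show ?thesis using sk by (simp add: mult.assoc[symmetric])
    qed
    have e3: "(\<integral>x. cmod (complex_of_real (c k) ^ k * (?\<psi> x - 1)) \<partial>\<mu>) \<le> D k"
    proof -
      have "cmod (complex_of_real (c k) ^ k) \<le> 1"
        using elim by (simp add: norm_power power_le_one)
      then have le: "cmod (complex_of_real (c k) ^ k * (?\<psi> x - 1)) \<le> cmod (1 - ?\<psi> x)" for x
        unfolding norm_mult norm_minus_commute[of 1] by (rule mult_left_le_one_le[rotated 2]) auto
      show ?thesis unfolding D_def by (rule integral_mono[OF _ _ le]) (use i3 in auto)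
    qed
    have split: "(\<integral>x. ?R (\<lambda>_. 1) x \<partial>\<mu>) - complex_of_real l
      = (\<integral>x. (?R (\<lambda>_. 1) x - ?R ?\<psi> x) + (?R ?\<psi> x - complex_of_real (c k) ^ k * ?\<psi> x)
           + complex_of_real (c k) ^ k * (?\<psi> x - 1) + (complex_of_real (c k) ^ k - complex_of_real l) \<partial>\<mu>)"
      using i1 i2 i3 mu.prob_space by (simp add: algebra_simps)
    have bd: "cmod ((\<integral>x. ?R (\<lambda>_. 1) x \<partial>\<mu>) - complex_of_real l) \<le> (\<integral>x. cmod (?R (\<lambda>_. 1) x - ?R ?\<psi> x) \<partial>\<mu>) + (\<integral>x. cmod (?R ?\<psi> x - complex_of_real (c k) ^ k * ?\<psi> x) \<partial>\<mu>)
           + (\<integral>x. cmod (complex_of_real (c k) ^ k * (?\<psi> x - 1)) \<partial>\<mu>) + cmod (complex_of_real (c k) ^ k - complex_of_real l)"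
    proof -
      have *: "cmod (\<integral>x. f x + g x + h' x + d \<partial>\<mu>)
        \<le> (\<integral>x. cmod (f x) \<partial>\<mu>) + (\<integral>x. cmod (g x) \<partial>\<mu>) + (\<integral>x. cmod (h' x) \<partial>\<mu>) + cmod d"
        if "integrable \<mu> f" "integrable \<mu> g" "integrable \<mu> h'" for f g h' :: "'a \<Rightarrow> complex" and d
      proof -
        have "(\<integral>x. f x + g x + h' x + d \<partial>\<mu>) = (\<integral>x. f x \<partial>\<mu>) + (\<integral>x. g x \<partial>\<mu>) + (\<integral>x. h' x \<partial>\<mu>) + d"
          using that mu.prob_space by simp
        then show ?thesis by (simp only:) (intro norm_triangle_mono integral_norm_bound order_refl)
      qed
      show ?thesis unfolding split by (rule *) (use i1 i2 i3 in simp_all)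
    qed
    have l: "cmod (complex_of_real (c k) ^ k - complex_of_real l) = \<bar>c k ^ k - l\<bar>"
      by (metis norm_of_real of_real_diff of_real_power)
    have "cmod ((\<integral>x. ?R (\<lambda>_. 1) x \<partial>\<mu>) - complex_of_real l) < e"
      using bd e1 e2 e3 elim unfolding l by linarith
    then show ?case by (simp add: dist_norm s_def l_def)
  qed
qed

end

section \<open>Arbitrary initial laws\<close>

context ergodic_kernel
begin

text \<open>For a fixed number of steps the phases become negligible as \<open>s\<close> tends to \<open>0\<close>, even when the function that is
  propagated varies with \<open>s\<close>.\<close>

lemma twist_kernel_op_close:
  fixes F :: "nat \<Rightarrow> 'a \<Rightarrow> complex"
  assumes h [measurable]: "h \<in> borel_measurable borel" and s: "s \<longlonglongrightarrow> (0::real)"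
    and F [measurable]: "\<And>k. F k \<in> borel_measurable borel" and F1: "\<And>k x. cmod (F k x) \<le> 1"
  shows "(\<lambda>k. (twist (s k) h ^^ N) (F k) x - (kernel_op ^^ N) (F k) x) \<longlonglongrightarrow> 0"
proof (induction N arbitrary: x)
  case (Suc N)
  define G where "G k = (twist (s k) h ^^ N) (F k)" for k
  define G' where "G' k = (kernel_op ^^ N) (F k)" for k
  have [measurable]: "G k \<in> borel_measurable borel" "G' k \<in> borel_measurable borel" for k
    unfolding G_def G'_def by measurable
  have G1: "cmod (G k y) \<le> 1" for k y
    unfolding G_def by (rule norm_twist_funpow_le[OF h F F1])
  have G'1: "cmod (G' k y) \<le> 1" for k y
    unfolding G'_def by (rule kernel_op_funpow_bounded[OF F F1])
  have IH: "(\<lambda>k. G k y - G' k y) \<longlonglongrightarrow> 0" for y using Suc unfolding G_def G'_def .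
  have "(\<lambda>k. \<integral>y. iexp (s k * h y) * G k y - G' k y \<partial>K x) \<longlonglongrightarrow> (\<integral>y. 0 \<partial>K x)"
  proof (rule integral_dominated_convergence[where w="\<lambda>_. 2"])
    show "AE y in K x. (\<lambda>k. iexp (s k * h y) * G k y - G' k y) \<longlonglongrightarrow> 0"
    proof (intro AE_I2)
      fix y
      have "(\<lambda>k. iexp (s k * h y) - 1) \<longlonglongrightarrow> iexp (0 * h y) - 1" by (intro tendsto_intros s)
      then have e0: "(\<lambda>k. iexp (s k * h y) - 1) \<longlonglongrightarrow> 0" by simp
      have "(\<lambda>k. cmod (iexp (s k * h y) - 1)) \<longlonglongrightarrow> 0" by (rule tendsto_norm_zero[OF e0])
      then have "(\<lambda>k. (iexp (s k * h y) - 1) * G k y) \<longlonglongrightarrow> 0"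
        by (rule Lim_null_comparison[rotated])
          (use G1 in \<open>auto intro!: always_eventually mult_right_le_one_le simp: norm_mult\<close>)
      then have "(\<lambda>k. (iexp (s k * h y) - 1) * G k y + (G k y - G' k y)) \<longlonglongrightarrow> 0 + 0"
        by (intro tendsto_add IH)
      then show "(\<lambda>k. iexp (s k * h y) * G k y - G' k y) \<longlonglongrightarrow> 0" by (simp add: algebra_simps)
    qed
    show "AE y in K x. norm (iexp (s k * h y) * G k y - G' k y) \<le> 2" for k
    proof (intro AE_I2)
      fix y
      have "norm (iexp (s k * h y) * G k y - G' k y) \<le> cmod (iexp (s k * h y) * G k y) + cmod (G' k y)"
        by (rule norm_triangle_ineq4)
      also have "\<dots> \<le> 2" using G1[of k y] G'1[of k y] by (simp add: norm_mult)
      finally show "norm (iexp (s k * h y) * G k y - G' k y) \<le> 2" .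
    qed
  qed auto
  moreover have "(\<integral>y. iexp (s k * h y) * G k y - G' k y \<partial>K x) = twist (s k) h (G k) x - kernel_op (G' k) x" for k
  proof -
    have "integrable (K x) (\<lambda>y. iexp (s k * h y) * G k y)"
      by (rule integrable_bounded(1)[where B=1]) (use G1 in \<open>simp_all add: norm_mult\<close>)
    moreover have "integrable (K x) (G' k)" by (rule integrable_bounded(1)[OF _ G'1]) measurable
    ultimately show ?thesis unfolding twist_def kernel_op_def by simp
  qed
  ultimately show ?case by (simp add: G_def G'_def)
qed simp

text \<open>The contraction concerns real functions, so it is applied to real and imaginary parts; this is the
  origin of the factor \<open>2\<close>.\<close>

lemma complex_mixing:
  assumes f [measurable]: "f \<in> borel_measurable borel" and f1: "\<And>x. cmod (f x) \<le> 1"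
  shows "cmod ((kernel_op ^^ N) f x - (\<integral>y. f y \<partial>\<mu>)) \<le> 2 * \<rho> ^ N * (2 + \<beta> * V x + \<beta> * (\<integral>y. V y \<partial>\<mu>))"
proof -
  have fn: "cmod ((kernel_op ^^ n) f x) \<le> 1" for n x by (rule kernel_op_funpow_bounded[OF f f1])
  note int = integrable_bounded[OF kernel_op_funpow_measurable[OF f] fn]
  have ReIm: "Re ((kernel_op ^^ n) f x) = (kernel_op ^^ n) (\<lambda>x. Re (f x)) x \<and> Im ((kernel_op ^^ n) f x) = (kernel_op ^^ n) (\<lambda>x. Im (f x)) x" for n x
  proof (induction n arbitrary: x)
    case (Suc n)
    have "Re (kernel_op ((kernel_op ^^ n) f) x) = kernel_op (\<lambda>y. Re ((kernel_op ^^ n) f y)) x"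
      "Im (kernel_op ((kernel_op ^^ n) f) x) = kernel_op (\<lambda>y. Im ((kernel_op ^^ n) f y)) x"
      using int(1)[of x n] by (simp_all add: kernel_op_def[where f="(kernel_op ^^ n) f"] kernel_op_def[where f="\<lambda>y. Re ((kernel_op ^^ n) f y)"]
          kernel_op_def[where f="\<lambda>y. Im ((kernel_op ^^ n) f y)"])
    then show ?case using Suc by simp
  qed simp
  have osc: "weighted_osc_le \<beta> V 1 g" if "\<And>x. \<bar>g x\<bar> \<le> 1" for g
    unfolding weighted_osc_le_def
  proof (intro allI)
    fix u v
    have "\<bar>g u - g v\<bar> \<le> 2" using that[of u] that[of v] by linarith
    moreover have "0 \<le> \<beta> * V u" "0 \<le> \<beta> * V v" using \<beta>_pos V_nonneg by auto
    ultimately show "\<bar>g u - g v\<bar> \<le> 1 * (2 + \<beta> * V u + \<beta> * V v)"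
      unfolding mult_1_left by linarith
  qed
  have real_case: "\<bar>(kernel_op ^^ N) g x - (\<integral>y. g y \<partial>\<mu>)\<bar> \<le> \<rho> ^ N * (2 + \<beta> * V x + \<beta> * (\<integral>y. V y \<partial>\<mu>))"
    if "g \<in> borel_measurable borel" "\<And>x. \<bar>g x\<bar> \<le> 1" for g
    using geometric_ergodicity[of g 1 N x] osc[OF that(2)] integrable_bounded(2)[of g 1] that by simp
  have fi: "integrable \<mu> f" by (rule integrable_bounded(2)[OF f f1])
  have "cmod ((kernel_op ^^ N) f x - (\<integral>y. f y \<partial>\<mu>)) \<le> \<bar>Re ((kernel_op ^^ N) f x - (\<integral>y. f y \<partial>\<mu>))\<bar> + \<bar>Im ((kernel_op ^^ N) f x - (\<integral>y. f y \<partial>\<mu>))\<bar>"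
    by (rule cmod_le)
  also have "Re ((kernel_op ^^ N) f x - (\<integral>y. f y \<partial>\<mu>)) = (kernel_op ^^ N) (\<lambda>x. Re (f x)) x - (\<integral>y. Re (f y) \<partial>\<mu>)"
    using ReIm fi by simp
  also have "Im ((kernel_op ^^ N) f x - (\<integral>y. f y \<partial>\<mu>)) = (kernel_op ^^ N) (\<lambda>x. Im (f x)) x - (\<integral>y. Im (f y) \<partial>\<mu>)"
    using ReIm fi by simp
  also have "\<bar>(kernel_op ^^ N) (\<lambda>x. Re (f x)) x - (\<integral>y. Re (f y) \<partial>\<mu>)\<bar> + \<bar>(kernel_op ^^ N) (\<lambda>x. Im (f x)) x - (\<integral>y. Im (f y) \<partial>\<mu>)\<bar>
    \<le> \<rho> ^ N * (2 + \<beta> * V x + \<beta> * (\<integral>y. V y \<partial>\<mu>)) + \<rho> ^ N * (2 + \<beta> * V x + \<beta> * (\<integral>y. V y \<partial>\<mu>))"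
    using order_trans[OF abs_Re_le_cmod f1] order_trans[OF abs_Im_le_cmod f1]
    by (intro add_mono real_case) measurable
  finally show ?thesis by simp
qed

text \<open>The first \<open>N\<close> steps contribute almost no phase but bring the law of the chain close to \<open>\<mu>\<close>, uniformly
  over the bounded functions that represent the remaining \<open>k - N\<close> steps.\<close>

lemma initial_law_forgotten:
  assumes h [measurable]: "h \<in> borel_measurable borel" and s: "s \<longlonglongrightarrow> (0::real)"
    and \<nu>: "prob_space \<nu>" "sets \<nu> = sets borel" and e: "0 < e"
  shows "\<forall>\<^sub>F N in sequentially. \<forall>\<^sub>F k in sequentially.
    cmod ((\<integral>x. (twist (s k) h ^^ k) (\<lambda>_. 1) x \<partial>\<nu>) - (\<integral>x. (twist (s k) h ^^ (k - N)) (\<lambda>_. 1) x \<partial>\<mu>)) < e"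
proof -
  interpret \<nu>: prob_space \<nu> by fact
  have [measurable_cong]: "sets \<nu> = sets borel" by fact
  define b where "b N x = min 2 (2 * \<rho> ^ N * (2 + \<beta> * V x + \<beta> * (\<integral>y. V y \<partial>\<mu>)))" for N x
  have b_meas [measurable]: "b N \<in> borel_measurable borel" for N unfolding b_def by measurable
  have b0: "0 \<le> b N x" for N x
    unfolding b_def using \<rho>_pos \<beta>_pos V_nonneg V_mean_nonneg by auto
  have "(\<lambda>N. \<integral>x. b N x \<partial>\<nu>) \<longlonglongrightarrow> (\<integral>x. 0 \<partial>\<nu>)"
  proof (rule integral_dominated_convergence[where w="\<lambda>_. 2"])
    show "AE x in \<nu>. (\<lambda>N. b N x) \<longlonglongrightarrow> 0"
    proof (intro AE_I2)
      fix x
      have "(\<lambda>N. min 2 (2 * \<rho> ^ N * (2 + \<beta> * V x + \<beta> * (\<integral>y. V y \<partial>\<mu>)))) \<longlonglongrightarrow>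
          min 2 (2 * 0 * (2 + \<beta> * V x + \<beta> * (\<integral>y. V y \<partial>\<mu>)))"
        using \<rho>_pos \<rho>_less_1 by (intro tendsto_intros LIMSEQ_power_zero) auto
      then show "(\<lambda>N. b N x) \<longlonglongrightarrow> 0" by (simp add: b_def)
    qed
    show "AE x in \<nu>. norm (b N x) \<le> 2" for N
      using b0 by (auto simp: b_def)
  qed auto
  then have "\<forall>\<^sub>F N in sequentially. (\<integral>x. b N x \<partial>\<nu>) < e / 2"
    using e by (intro order_tendstoD(2)[where a="e/2"]) auto
  then show ?thesis
  proof eventually_elim
    case (elim N)
    define F where "F k = (twist (s k) h ^^ (k - N)) (\<lambda>_. 1)" for k
    have F [measurable]: "F k \<in> borel_measurable borel" for k unfolding F_def by measurable
    have F1: "cmod (F k x) \<le> 1" for k x unfolding F_def by (rule norm_twist_funpow_le[OF h]) auto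
    define d where "d k x = (twist (s k) h ^^ N) (F k) x - (kernel_op ^^ N) (F k) x" for k x
    have [measurable]: "d k \<in> borel_measurable borel" for k unfolding d_def by measurable
    have T1: "cmod ((twist (s k) h ^^ N) (F k) x) \<le> 1" for k x by (rule norm_twist_funpow_le[OF h F F1])
    have P1: "cmod ((kernel_op ^^ N) (F k) x) \<le> 1" for k x by (rule kernel_op_funpow_bounded[OF F F1])
    have d2: "cmod (d k x) \<le> 2" for k x
      using norm_triangle_ineq4[of "(twist (s k) h ^^ N) (F k) x" "(kernel_op ^^ N) (F k) x"] T1[of k x] P1[of k x]
      unfolding d_def by linarith
    have "(\<lambda>k. \<integral>x. cmod (d k x) \<partial>\<nu>) \<longlonglongrightarrow> (\<integral>x. 0 \<partial>\<nu>)"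
    proof (rule integral_dominated_convergence[where w="\<lambda>_. 2"])
      show "AE x in \<nu>. (\<lambda>k. cmod (d k x)) \<longlonglongrightarrow> 0"
        unfolding d_def by (intro AE_I2 tendsto_norm_zero twist_kernel_op_close[OF h s F F1])
    qed (use d2 in auto)
    then have "\<forall>\<^sub>F k in sequentially. (\<integral>x. cmod (d k x) \<partial>\<nu>) < e / 2"
      using e by (intro order_tendstoD(2)[where a="e/2"]) auto
    then show ?case using eventually_ge_at_top[of N]
    proof eventually_elim
      case k: (elim k)
      \<comment> \<open>The stationary value over the last \<open>k - N\<close> steps, to which both \<open>\<nu>\<close> and \<open>\<mu>\<close> are compared later.\<close>
      define m where "m = (\<integral>x. F k x \<partial>\<mu>)"
      have m1: "cmod m \<le> 1"
      proof -
        have "cmod m \<le> (\<integral>x. cmod (F k x) \<partial>\<mu>)" unfolding m_def by (rule integral_norm_bound)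
        also have "\<dots> \<le> (\<integral>x. 1 \<partial>\<mu>)"
          using integrable_bounded(2)[OF F F1, of k] F1 by (intro integral_mono) auto
        finally show ?thesis using mu.prob_space by simp
      qed
      have bnd: "cmod ((kernel_op ^^ N) (F k) x - m) \<le> b N x" for x
      proof -
        have "cmod ((kernel_op ^^ N) (F k) x - m) \<le> 2"
          using norm_triangle_ineq4[of "(kernel_op ^^ N) (F k) x" m] P1[of k x] m1 by linarith
        then show ?thesis unfolding b_def using complex_mixing[OF F F1, of N k x] by (simp add: m_def)
      qed
      have split: "(twist (s k) h ^^ k) (\<lambda>_. 1) x - m = d k x + ((kernel_op ^^ N) (F k) x - m)" for x
      proof -
        have "(twist (s k) h ^^ (N + (k - N))) (\<lambda>_. 1) = (twist (s k) h ^^ N) (F k)"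
          unfolding funpow_add F_def by simp
        then show ?thesis using k by (simp add: d_def)
      qed
      have i0: "integrable \<nu> ((twist (s k) h ^^ k) (\<lambda>_. 1))"
        by (rule \<nu>.integrable_const_bound[where B=1]) (auto intro!: norm_twist_funpow_le)
      have i1: "integrable \<nu> (d k)" by (rule \<nu>.integrable_const_bound[where B=2]) (use d2 in auto)
      have i2: "integrable \<nu> (b N)"
        by (rule \<nu>.integrable_const_bound[where B=2]) (use b0 in \<open>auto simp: b_def\<close>)
      have "cmod ((\<integral>x. (twist (s k) h ^^ k) (\<lambda>_. 1) x \<partial>\<nu>) - m) = cmod (\<integral>x. (twist (s k) h ^^ k) (\<lambda>_. 1) x - m \<partial>\<nu>)"
        using i0 \<nu>.prob_space by simp
      also have "\<dots> \<le> (\<integral>x. cmod ((twist (s k) h ^^ k) (\<lambda>_. 1) x - m) \<partial>\<nu>)" by (rule integral_norm_bound)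
      also have "\<dots> \<le> (\<integral>x. cmod (d k x) + b N x \<partial>\<nu>)"
      proof (rule integral_mono)
        show "cmod ((twist (s k) h ^^ k) (\<lambda>_. 1) x - m) \<le> cmod (d k x) + b N x" for x
          unfolding split using bnd[of x] by (intro norm_triangle_le add_left_mono)
      qed (use i0 i1 i2 in auto)
      also have "\<dots> = (\<integral>x. cmod (d k x) \<partial>\<nu>) + (\<integral>x. b N x \<partial>\<nu>)" using i1 i2 by simp
      also have "\<dots> < e" using k elim by simp
      finally show ?case by (simp add: m_def F_def)
    qed
  qed
qed

end

context poisson_pair
begin

text \<open>The given initial law and \<open>\<mu>\<close> are compared with the same stationary value over the last \<open>k - N\<close> steps, so
  the limit of \<open>char_stationary\<close> carries over.\<close>

theorem characteristic_function_limit: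
  assumes \<nu>: "prob_space \<nu>" "sets \<nu> = sets borel"
  shows "(\<lambda>k. \<integral>x. (twist (t / sqrt (real k)) h ^^ k) (\<lambda>_. 1) x \<partial>\<nu>) \<longlonglongrightarrow> complex_of_real (exp (- (asymp_var * t\<^sup>2 / 2)))"
proof -
  define s where "s k = t / sqrt (real k)" for k
  have s0: "s \<longlonglongrightarrow> 0"
    unfolding s_def by (intro tendsto_divide_0[OF tendsto_const] filterlim_at_top_imp_at_infinity
        filterlim_compose[OF sqrt_at_top filterlim_real_sequentially])
  let ?I = "\<lambda>k. \<integral>x. (twist (s k) h ^^ k) (\<lambda>_. 1) x \<partial>\<nu>" and ?J = "\<lambda>k. \<integral>x. (twist (s k) h ^^ k) (\<lambda>_. 1) x \<partial>\<mu>"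
  have "(\<lambda>k. ?I k - ?J k) \<longlonglongrightarrow> 0"
  proof (rule tendstoI)
    fix e :: real assume e: "0 < e"
    then have e2: "0 < e / 2" by simp
    have "\<forall>\<^sub>F N in sequentially. (\<forall>\<^sub>F k in sequentially. cmod (?I k - (\<integral>x. (twist (s k) h ^^ (k - N)) (\<lambda>_. 1) x \<partial>\<mu>)) < e / 2)
      \<and> (\<forall>\<^sub>F k in sequentially. cmod (?J k - (\<integral>x. (twist (s k) h ^^ (k - N)) (\<lambda>_. 1) x \<partial>\<mu>)) < e / 2)"
      using initial_law_forgotten[OF h_measurable s0 \<nu> e2] initial_law_forgotten[OF h_measurable s0 mu_prob sets_mu e2]
      by (rule eventually_conj)
    then obtain N where "\<forall>\<^sub>F k in sequentially. cmod (?I k - (\<integral>x. (twist (s k) h ^^ (k - N)) (\<lambda>_. 1) x \<partial>\<mu>)) < e / 2"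
      and "\<forall>\<^sub>F k in sequentially. cmod (?J k - (\<integral>x. (twist (s k) h ^^ (k - N)) (\<lambda>_. 1) x \<partial>\<mu>)) < e / 2"
      unfolding eventually_sequentially[where P="\<lambda>N. _ N \<and> _ N"] by blast
    then show "\<forall>\<^sub>F k in sequentially. dist (?I k - ?J k) 0 < e"
    proof eventually_elim
      case (elim k)
      then show ?case
        using norm_triangle_ineq4[of "?I k - (\<integral>x. (twist (s k) h ^^ (k - N)) (\<lambda>_. 1) x \<partial>\<mu>)"
            "?J k - (\<integral>x. (twist (s k) h ^^ (k - N)) (\<lambda>_. 1) x \<partial>\<mu>)"] by (simp add: dist_norm)
    qed
  qed
  then have "(\<lambda>k. (?I k - ?J k) + ?J k) \<longlonglongrightarrow> 0 + complex_of_real (exp (- (asymp_var * t\<^sup>2 / 2)))"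
    unfolding s_def by (rule tendsto_add[OF _ char_stationary])
  then show ?thesis by (simp add: s_def)
qed

end

section \<open>The central limit theorem along Markov chains\<close>

context ergodic_kernel
begin

text \<open>The Markov property, which is given for rectangles, identifies the joint law of the past and the next
  state with the law built from the kernel, since rectangles generate the product
  \<open>\<sigma>\<close>-algebra.\<close>

lemma chain_step_nn:
  fixes \<Phi> :: "nat \<Rightarrow> 'w \<Rightarrow> 'a" and k :: nat
  assumes chain: "markov_chain K M \<Phi>"
  defines "past \<equiv> \<lambda>\<omega>. \<lambda>i\<in>{..k}. \<Phi> i \<omega>"
  defines "PP \<equiv> PiM {..k} (\<lambda>_. borel :: 'a measure) \<Otimes>\<^sub>M (borel :: 'a measure)"
  defines "N \<equiv> \<lambda>\<omega>. distr (K (\<Phi> k \<omega>)) PP (Pair (past \<omega>))"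
  shows "past \<in> M \<rightarrow>\<^sub>M PiM {..k} (\<lambda>_. borel)" "N \<in> M \<rightarrow>\<^sub>M subprob_algebra PP"
    and "g \<in> borel_measurable PP \<Longrightarrow>
      (\<integral>\<^sup>+\<omega>. g (past \<omega>, \<Phi> (Suc k) \<omega>) \<partial>M) = (\<integral>\<^sup>+\<omega>. (\<integral>\<^sup>+z. g z \<partial>N \<omega>) \<partial>M)"
proof -
  have M: "prob_space M" and \<Phi> [measurable]: "\<And>i. \<Phi> i \<in> borel_measurable M"
    using chain by (auto simp: markov_chain_def)
  interpret prob_space M by fact
  show past [measurable]: "past \<in> M \<rightarrow>\<^sub>M PiM {..k} (\<lambda>_. borel)"
    unfolding past_def by measurable
  have KK [measurable]: "(\<lambda>\<omega>. K (\<Phi> k \<omega>)) \<in> M \<rightarrow>\<^sub>M subprob_algebra borel" by measurable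
  show N [measurable]: "N \<in> M \<rightarrow>\<^sub>M subprob_algebra PP"
    unfolding N_def PP_def by (rule measurable_distr2[OF _ KK]) measurable
  define D1 where "D1 = distr M PP (\<lambda>\<omega>. (past \<omega>, \<Phi> (Suc k) \<omega>))"
  define D2 where "D2 = M \<bind> N"
  have pm [measurable]: "(\<lambda>\<omega>. (past \<omega>, \<Phi> (Suc k) \<omega>)) \<in> M \<rightarrow>\<^sub>M PP" unfolding PP_def by measurable
  let ?E = "{a \<times> b | a b. a \<in> sets (PiM {..k} (\<lambda>_. borel :: 'a measure)) \<and> b \<in> sets (borel :: 'a measure)}"
  have eqD: "D1 = D2"
  proof (rule measure_eqI_generator_eq[OF Int_stable_pair_measure_generator, where A="\<lambda>_. space PP"])
    show "?E \<subseteq> Pow (space PP)"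
      unfolding PP_def space_pair_measure
      using sets.space_closed[of "PiM {..k} (\<lambda>_. borel :: 'a measure)"] by auto
    show "sets D1 = sigma_sets (space PP) ?E"
      by (simp add: D1_def PP_def sets_pair_measure space_pair_measure)
    have "sets D2 = sets PP" unfolding D2_def using sets_kernel[OF N] by (intro sets_bind) (auto simp: not_empty)
    then show "sets D2 = sigma_sets (space PP) ?E"
      by (simp add: PP_def sets_pair_measure space_pair_measure)
    have "space PP \<in> ?E"
      unfolding PP_def space_pair_measure
      by (intro CollectI exI[of _ "space (PiM {..k} (\<lambda>_. borel))"] exI[of _ "space borel"] conjI refl sets.top)
    then show "range (\<lambda>_. space PP) \<subseteq> ?E" by blast
    show "(\<Union>i::nat. space PP) = space PP" by simp
    show "emeasure D1 (space PP) \<noteq> \<infinity>" for i :: nat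
      unfolding D1_def by (subst emeasure_distr) (auto simp: pm)
  next
    fix X assume "X \<in> ?E"
    then obtain B A where X: "X = B \<times> A" and B [measurable]: "B \<in> sets (PiM {..k} (\<lambda>_. borel))"
      and A [measurable]: "A \<in> sets borel" by auto
    have XP [measurable]: "X \<in> sets PP" unfolding X PP_def by measurable
    have "emeasure D1 X = emeasure M {\<omega>\<in>space M. (\<lambda>i\<in>{..k}. \<Phi> i \<omega>) \<in> B \<and> \<Phi> (Suc k) \<omega> \<in> A}"
      unfolding D1_def by (subst emeasure_distr[OF pm XP]) (auto simp: X past_def intro!: arg_cong[where f="emeasure M"])
    also have "\<dots> = (\<integral>\<^sup>+\<omega>. indicator B (past \<omega>) * emeasure (K (\<Phi> k \<omega>)) A \<partial>M)"
      using chain A B unfolding markov_chain_def past_def by blast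
    also have "\<dots> = (\<integral>\<^sup>+\<omega>. emeasure (N \<omega>) X \<partial>M)"
    proof (rule nn_integral_cong)
      fix \<omega> assume \<omega>: "\<omega> \<in> space M"
      have pw: "past \<omega> \<in> space (PiM {..k} (\<lambda>_. borel))" using measurable_space[OF past \<omega>] .
      have "Pair (past \<omega>) \<in> K (\<Phi> k \<omega>) \<rightarrow>\<^sub>M PP"
        unfolding PP_def measurable_cong_sets[OF sets_kernel_borel refl] by (rule measurable_Pair1'[OF pw])
      then have "emeasure (N \<omega>) X = emeasure (K (\<Phi> k \<omega>)) (Pair (past \<omega>) -` X)"
        unfolding N_def using XP by (simp add: emeasure_distr)
      also have "Pair (past \<omega>) -` X = (if past \<omega> \<in> B then A else {})" by (auto simp: X)
      finally show "indicator B (past \<omega>) * emeasure (K (\<Phi> k \<omega>)) A = emeasure (N \<omega>) X" by simp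
    qed
    also have "\<dots> = emeasure D2 X"
      unfolding D2_def by (rule emeasure_bind[OF not_empty N XP, symmetric])
    finally show "emeasure D1 X = emeasure D2 X" .
  qed
  show "(\<integral>\<^sup>+\<omega>. g (past \<omega>, \<Phi> (Suc k) \<omega>) \<partial>M) = (\<integral>\<^sup>+\<omega>. (\<integral>\<^sup>+z. g z \<partial>N \<omega>) \<partial>M)"
    if g: "g \<in> borel_measurable PP"
  proof -
    have "(\<integral>\<^sup>+z. g z \<partial>D1) = (\<integral>\<^sup>+\<omega>. g (past \<omega>, \<Phi> (Suc k) \<omega>) \<partial>M)"
      unfolding D1_def by (rule nn_integral_distr[OF pm]) (simp add: g)
    moreover have "(\<integral>\<^sup>+z. g z \<partial>D2) = (\<integral>\<^sup>+\<omega>. (\<integral>\<^sup>+z. g z \<partial>N \<omega>) \<partial>M)"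
      unfolding D2_def by (rule nn_integral_bind[OF g N])
    ultimately show ?thesis unfolding eqD by simp
  qed
qed

lemma chain_step_complex:
  fixes \<Phi> :: "nat \<Rightarrow> 'w \<Rightarrow> 'a" and k :: nat and G :: "(nat \<Rightarrow> 'a) \<Rightarrow> complex"
  assumes chain: "markov_chain K M \<Phi>"
    and G [measurable]: "G \<in> borel_measurable (PiM {..k} (\<lambda>_. borel))" and G1: "\<And>p. cmod (G p) \<le> 1"
    and f [measurable]: "f \<in> borel_measurable borel" and f1: "\<And>x. cmod (f x) \<le> 1"
  shows "(\<integral>\<omega>. G (\<lambda>i\<in>{..k}. \<Phi> i \<omega>) * f (\<Phi> (Suc k) \<omega>) \<partial>M) = (\<integral>\<omega>. G (\<lambda>i\<in>{..k}. \<Phi> i \<omega>) * kernel_op f (\<Phi> k \<omega>) \<partial>M)"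
proof -
  have M: "prob_space M" and \<Phi> [measurable]: "\<And>i. \<Phi> i \<in> borel_measurable M"
    using chain by (auto simp: markov_chain_def)
  interpret prob_space M by fact
  define past where "past = (\<lambda>\<omega>. \<lambda>i\<in>{..k}. \<Phi> i \<omega>)"
  define PP where "PP = PiM {..k} (\<lambda>_. borel :: 'a measure) \<Otimes>\<^sub>M (borel :: 'a measure)"
  define N where "N = (\<lambda>\<omega>. distr (K (\<Phi> k \<omega>)) PP (Pair (past \<omega>)))"
  have step: "past \<in> M \<rightarrow>\<^sub>M PiM {..k} (\<lambda>_. borel)" "N \<in> M \<rightarrow>\<^sub>M subprob_algebra PP"
    "\<And>g. g \<in> borel_measurable PP \<Longrightarrow>
      (\<integral>\<^sup>+\<omega>. g (past \<omega>, \<Phi> (Suc k) \<omega>) \<partial>M) = (\<integral>\<^sup>+\<omega>. (\<integral>\<^sup>+z. g z \<partial>N \<omega>) \<partial>M)"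
    using chain_step_nn[OF chain, where k=k] unfolding past_def PP_def N_def .
  note [measurable] = step(1,2)
  have pm [measurable]: "(\<lambda>\<omega>. (past \<omega>, \<Phi> (Suc k) \<omega>)) \<in> M \<rightarrow>\<^sub>M PP" unfolding PP_def by measurable
  have pw: "Pair (past \<omega>) \<in> K (\<Phi> k \<omega>) \<rightarrow>\<^sub>M PP" if "\<omega> \<in> space M" for \<omega>
    unfolding PP_def measurable_cong_sets[OF sets_kernel_borel refl]
    by (rule measurable_Pair1'[OF measurable_space[OF step(1) that]])
  have Nprob: "prob_space (N \<omega>)" if "\<omega> \<in> space M" for \<omega>
    unfolding N_def by (rule prob_space.prob_space_distr[OF kernel_prob pw[OF that]])
  have real_step: "(\<integral>\<omega>. g (past \<omega>, \<Phi> (Suc k) \<omega>) \<partial>M) = (\<integral>\<omega>. (\<integral>z. g z \<partial>N \<omega>) \<partial>M)"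
    if g [measurable]: "g \<in> borel_measurable PP" and g1: "\<And>z. \<bar>g z\<bar> \<le> 1" for g :: "_ \<Rightarrow> real"
  proof -
    have g_nn: "0 \<le> g z + 1" for z using g1[of z] by linarith
    have gN: "integrable (N \<omega>) g" if "\<omega> \<in> space M" for \<omega>
    proof -
      interpret Nw: prob_space "N \<omega>" by (rule Nprob[OF that])
      show ?thesis
        by (rule Nw.integrable_const_bound[where B=1]) (use g1 g in \<open>auto simp: N_def\<close>)
    qed
    have m: "(\<lambda>\<omega>. \<integral>z. g z \<partial>N \<omega>) \<in> borel_measurable M"
      by (rule measurable_compose[OF step(2) integral_measurable_subprob_algebra[OF g]])
    have i1: "integrable M (\<lambda>\<omega>. g (past \<omega>, \<Phi> (Suc k) \<omega>))"
      by (rule integrable_const_bound[where B=1]) (use g1 in auto)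
    have b: "\<bar>\<integral>z. g z \<partial>N \<omega>\<bar> \<le> 1" if "\<omega> \<in> space M" for \<omega>
    proof -
      interpret Nw: prob_space "N \<omega>" by (rule Nprob[OF that])
      have "\<bar>\<integral>z. g z \<partial>N \<omega>\<bar> \<le> (\<integral>z. \<bar>g z\<bar> \<partial>N \<omega>)" by (rule integral_abs_bound)
      also have "\<dots> \<le> (\<integral>z. 1 \<partial>N \<omega>)" using gN[OF that] g1 by (intro integral_mono) auto
      finally show ?thesis using Nw.prob_space by simp
    qed
    have i2: "integrable M (\<lambda>\<omega>. \<integral>z. g z \<partial>N \<omega>)"
      by (rule integrable_const_bound[where B=1]) (use b m in auto)
    \<comment> \<open>Adding \<open>1\<close> makes \<open>g\<close> nonnegative.\<close>
    have "(\<integral>\<^sup>+\<omega>. ennreal (g (past \<omega>, \<Phi> (Suc k) \<omega>) + 1) \<partial>M) = (\<integral>\<^sup>+\<omega>. (\<integral>\<^sup>+z. ennreal (g z + 1) \<partial>N \<omega>) \<partial>M)"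
      by (rule step(3)) measurable
    also have "\<dots> = (\<integral>\<^sup>+\<omega>. ennreal ((\<integral>z. g z \<partial>N \<omega>) + 1) \<partial>M)"
    proof (rule nn_integral_cong)
      fix \<omega> assume \<omega>: "\<omega> \<in> space M"
      interpret Nw: prob_space "N \<omega>" by (rule Nprob[OF \<omega>])
      show "(\<integral>\<^sup>+z. ennreal (g z + 1) \<partial>N \<omega>) = ennreal ((\<integral>z. g z \<partial>N \<omega>) + 1)"
        using gN[OF \<omega>] g_nn Nw.prob_space by (subst nn_integral_eq_integral) auto
    qed
    finally have "ennreal (\<integral>\<omega>. g (past \<omega>, \<Phi> (Suc k) \<omega>) + 1 \<partial>M) = ennreal (\<integral>\<omega>. (\<integral>z. g z \<partial>N \<omega>) + 1 \<partial>M)"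
    proof (subst (asm) (1 2) nn_integral_eq_integral)
      show "AE \<omega> in M. 0 \<le> (\<integral>z. g z \<partial>N \<omega>) + 1"
      proof (intro AE_I2)
        fix \<omega> assume "\<omega> \<in> space M"
        then show "0 \<le> (\<integral>z. g z \<partial>N \<omega>) + 1" using b[of \<omega>] by linarith
      qed
    qed (use i1 i2 g_nn in auto)
    moreover have "0 \<le> (\<integral>\<omega>. g (past \<omega>, \<Phi> (Suc k) \<omega>) + 1 \<partial>M)" using g_nn by simp
    moreover have "0 \<le> (\<integral>\<omega>. (\<integral>z. g z \<partial>N \<omega>) + 1 \<partial>M)"
      by (rule integral_nonneg_AE) (intro AE_I2, use b in fastforce)
    ultimately have "(\<integral>\<omega>. g (past \<omega>, \<Phi> (Suc k) \<omega>) + 1 \<partial>M) = (\<integral>\<omega>. (\<integral>z. g z \<partial>N \<omega>) + 1 \<partial>M)"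
      by simp
    then show ?thesis using i1 i2 prob_space by simp
  qed
  define g where "g z = G (fst z) * f (snd z)" for z
  have g [measurable]: "g \<in> borel_measurable PP" unfolding g_def PP_def by measurable
  have g1: "cmod (g z) \<le> 1" for z
    unfolding g_def norm_mult using mult_mono[OF G1 f1] by simp
  have gi: "integrable M (\<lambda>\<omega>. g (past \<omega>, \<Phi> (Suc k) \<omega>))"
    by (rule integrable_const_bound[where B=1]) (use g1 in auto)
  have inner: "(\<integral>z. g z \<partial>N \<omega>) = G (past \<omega>) * kernel_op f (\<Phi> k \<omega>)" and gNi: "integrable (N \<omega>) g"
    if "\<omega> \<in> space M" for \<omega>
  proof -
    show "(\<integral>z. g z \<partial>N \<omega>) = G (past \<omega>) * kernel_op f (\<Phi> k \<omega>)"
      unfolding N_def by (subst integral_distr[OF pw[OF that] g]) (simp add: g_def kernel_op_def)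
    interpret Nw: prob_space "N \<omega>" by (rule Nprob[OF that])
    show "integrable (N \<omega>) g"
      by (rule Nw.integrable_const_bound[where B=1]) (use g1 g in \<open>auto simp: N_def\<close>)
  qed
  have K1: "cmod (kernel_op f x) \<le> 1" for x by (rule norm_kernel_op_le[OF f f1])
  note [measurable] = measurable_compose[OF \<Phi> kernel_op_measurable[OF f]]
  have GK: "integrable M (\<lambda>\<omega>. G (past \<omega>) * kernel_op f (\<Phi> k \<omega>))"
  proof (rule integrable_const_bound[where B=1])
    show "AE \<omega> in M. cmod (G (past \<omega>) * kernel_op f (\<Phi> k \<omega>)) \<le> 1"
      unfolding norm_mult using mult_mono[OF G1 K1] by (intro AE_I2) simp
  qed measurable
  have re: "(\<integral>\<omega>. (\<integral>z. Re (g z) \<partial>N \<omega>) \<partial>M) = (\<integral>\<omega>. Re (G (past \<omega>) * kernel_op f (\<Phi> k \<omega>)) \<partial>M)"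
    using gNi by (intro Bochner_Integration.integral_cong refl) (simp flip: inner)
  have im: "(\<integral>\<omega>. (\<integral>z. Im (g z) \<partial>N \<omega>) \<partial>M) = (\<integral>\<omega>. Im (G (past \<omega>) * kernel_op f (\<Phi> k \<omega>)) \<partial>M)"
    using gNi by (intro Bochner_Integration.integral_cong refl) (simp flip: inner)
  have "(\<integral>\<omega>. g (past \<omega>, \<Phi> (Suc k) \<omega>) \<partial>M) = (\<integral>\<omega>. G (past \<omega>) * kernel_op f (\<Phi> k \<omega>) \<partial>M)"
  proof (rule complex_eqI)
    show "Re (\<integral>\<omega>. g (past \<omega>, \<Phi> (Suc k) \<omega>) \<partial>M) = Re (\<integral>\<omega>. G (past \<omega>) * kernel_op f (\<Phi> k \<omega>) \<partial>M)"
      unfolding integral_Re[OF gi, symmetric] integral_Re[OF GK, symmetric] re[symmetric]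
      by (rule real_step) (use order_trans[OF abs_Re_le_cmod g1] in auto)
    show "Im (\<integral>\<omega>. g (past \<omega>, \<Phi> (Suc k) \<omega>) \<partial>M) = Im (\<integral>\<omega>. G (past \<omega>) * kernel_op f (\<Phi> k \<omega>) \<partial>M)"
      unfolding integral_Im[OF gi, symmetric] integral_Im[OF GK, symmetric] im[symmetric]
      by (rule real_step) (use order_trans[OF abs_Im_le_cmod g1] in auto)
  qed
  then show ?thesis by (simp add: g_def past_def)
qed

text \<open>Each application of the Markov property integrates out the last state and leaves one twist behind.\<close>

lemma chain_char:
  fixes \<Phi> :: "nat \<Rightarrow> 'w \<Rightarrow> 'a"
  assumes chain: "markov_chain K M \<Phi>" and h [measurable]: "h \<in> borel_measurable borel"
    and f: "f \<in> borel_measurable borel" "\<And>x. cmod (f x) \<le> 1"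
  shows "(\<integral>\<omega>. iexp (s * (\<Sum>i=1..k. h (\<Phi> i \<omega>))) * f (\<Phi> k \<omega>) \<partial>M) = (\<integral>\<omega>. (twist s h ^^ k) f (\<Phi> 0 \<omega>) \<partial>M)"
  using f
proof (induction k arbitrary: f)
  case (Suc k)
  note [measurable] = Suc.prems(1)
  define G where "G p = iexp (s * (\<Sum>i=1..k. h (p i)))" for p :: "nat \<Rightarrow> 'a"
  have pm: "(\<lambda>p. h (p i)) \<in> borel_measurable (PiM {..k} (\<lambda>_. borel :: 'a measure))" if "i \<in> {1..k}" for i
    using that by (intro measurable_compose[OF _ h] measurable_component_singleton) auto
  have G: "G \<in> borel_measurable (PiM {..k} (\<lambda>_. borel))"
  proof -
    have [measurable]: "(\<lambda>p. \<Sum>i=1..k. h (p i)) \<in> borel_measurable (PiM {..k} (\<lambda>_. borel :: 'a measure))"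
      by (intro borel_measurable_sum pm)
    show ?thesis unfolding G_def by measurable
  qed
  have past: "G (\<lambda>i\<in>{..k}. \<Phi> i \<omega>) = iexp (s * (\<Sum>i=1..k. h (\<Phi> i \<omega>)))" for \<omega>
    unfolding G_def by (simp add: atLeastAtMost_iff cong: sum.cong_simp)
  have "(\<integral>\<omega>. iexp (s * (\<Sum>i=1..Suc k. h (\<Phi> i \<omega>))) * f (\<Phi> (Suc k) \<omega>) \<partial>M)
    = (\<integral>\<omega>. G (\<lambda>i\<in>{..k}. \<Phi> i \<omega>) * (iexp (s * h (\<Phi> (Suc k) \<omega>)) * f (\<Phi> (Suc k) \<omega>)) \<partial>M)"
    unfolding past by (intro Bochner_Integration.integral_cong refl) (simp add: exp_add distrib_left)
  also have "\<dots> = (\<integral>\<omega>. G (\<lambda>i\<in>{..k}. \<Phi> i \<omega>) * twist s h f (\<Phi> k \<omega>) \<partial>M)"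
    unfolding twist_def
    by (rule chain_step_complex[OF chain G, where f="\<lambda>y. iexp (s * h y) * f y"])
      (use Suc.prems(2) in \<open>auto simp: G_def norm_mult\<close>)
  also have "\<dots> = (\<integral>\<omega>. (twist s h ^^ k) (twist s h f) (\<Phi> 0 \<omega>) \<partial>M)"
    unfolding past by (rule Suc.IH) (auto intro!: norm_twist_le Suc.prems)
  finally show ?case by (simp add: funpow_swap1)
qed simp

end

lemma char_scaled_normal:
  "char (distr std_normal_distribution borel (\<lambda>z. c * z)) t = complex_of_real (exp (- ((c * t)\<^sup>2 / 2)))"
proof -
  have "char (distr std_normal_distribution borel (\<lambda>z. c * z)) t = char std_normal_distribution (t * c)"
    unfolding char_def by (subst integral_distr) (auto simp: mult.assoc)
  then show ?thesis by (simp add: char_std_normal_distribution mult.commute)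
qed

lemma real_distribution_scaled_normal:
  "real_distribution (distr std_normal_distribution borel (\<lambda>z. c * z))"
proof -
  interpret real_distribution std_normal_distribution by (rule real_dist_normal_dist)
  show ?thesis by (rule real_distribution_distr) simp
qed

text \<open>The characteristic functions converge by \<open>characteristic_function_limit\<close> for the law of \<open>\<Phi> 0\<close>;
  Levy's theorem does the rest.\<close>

theorem (in poisson_pair) chain_clt:
  fixes \<Phi> :: "nat \<Rightarrow> 'w \<Rightarrow> 'a"
  assumes chain: "markov_chain K M \<Phi>" and h: "\<And>x. h x = H x - (\<integral>y. H y \<partial>\<mu>)"
  shows "clt_along M \<Phi> \<mu> H asymp_var"
proof -
  have M: "prob_space M" and \<Phi> [measurable]: "\<And>i. \<Phi> i \<in> borel_measurable M"
    using chain by (auto simp: markov_chain_def)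
  interpret prob_space M by fact
  define m where "m = (\<integral>y. H y \<partial>\<mu>)"
  have [measurable]: "H \<in> borel_measurable borel"
  proof -
    have "H = (\<lambda>x. h x + m)" using h by (auto simp: m_def)
    then show ?thesis by simp
  qed
  let ?Y = "\<lambda>k \<omega>. sqrt (real k) * (ergodic_average \<Phi> H k \<omega> - m)"
  have Y [measurable]: "?Y k \<in> borel_measurable M" for k
    unfolding ergodic_average_def by measurable
  have "weak_conv_m (\<lambda>k. distr M borel (?Y k)) (distr std_normal_distribution borel (\<lambda>z. sqrt asymp_var * z))"
  proof (rule levy_continuity)
    show "real_distribution (distr M borel (?Y k))" for k
      by (rule real_distribution_distr) (rule Y)
    show "real_distribution (distr std_normal_distribution borel (\<lambda>z. sqrt asymp_var * z))"
      by (rule real_distribution_scaled_normal)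
    fix t
    have init: "prob_space (distr M borel (\<Phi> 0))" "sets (distr M borel (\<Phi> 0)) = sets borel"
      by (auto intro: prob_space_distr)
    have "\<forall>\<^sub>F k in sequentially. (\<integral>x. (twist (t / sqrt (real k)) h ^^ k) (\<lambda>_. 1) x \<partial>distr M borel (\<Phi> 0))
        = char (distr M borel (?Y k)) t"
      using eventually_gt_at_top[of 0]
    proof eventually_elim
      case (elim k)
      have eq: "t * ?Y k \<omega> = t / sqrt (real k) * (\<Sum>i=1..k. h (\<Phi> i \<omega>))" for \<omega>
      proof -
        have "(\<Sum>i=1..k. h (\<Phi> i \<omega>)) = (\<Sum>i=1..k. H (\<Phi> i \<omega>)) - real k * m"
          using h by (simp add: sum_subtractf m_def)
        also have "\<dots> = real k * (ergodic_average \<Phi> H k \<omega> - m)"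
          using elim by (simp add: ergodic_average_def field_simps)
        finally have "t / sqrt (real k) * (\<Sum>i=1..k. h (\<Phi> i \<omega>)) = t * (real k / sqrt (real k) * (ergodic_average \<Phi> H k \<omega> - m))"
          by simp
        also have "real k / sqrt (real k) = sqrt (real k)" by (simp add: real_div_sqrt)
        finally show ?thesis by simp
      qed
      have "(\<integral>x. (twist (t / sqrt (real k)) h ^^ k) (\<lambda>_. 1) x \<partial>distr M borel (\<Phi> 0))
        = (\<integral>\<omega>. (twist (t / sqrt (real k)) h ^^ k) (\<lambda>_. 1) (\<Phi> 0 \<omega>) \<partial>M)"
        by (rule integral_distr) (auto intro!: twist_funpow_measurable)
      also have "\<dots> = (\<integral>\<omega>. iexp (t / sqrt (real k) * (\<Sum>i=1..k. h (\<Phi> i \<omega>))) * 1 \<partial>M)"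
        by (rule chain_char[OF chain, symmetric]) auto
      also have "\<dots> = char (distr M borel (?Y k)) t"
        unfolding char_def by (subst integral_distr[OF Y]) (auto simp only: eq mult_1_right, measurable)
      finally show ?case .
    qed
    from Lim_transform_eventually[OF characteristic_function_limit[OF init] this]
    have "(\<lambda>k. char (distr M borel (?Y k)) t) \<longlonglongrightarrow> complex_of_real (exp (- (asymp_var * t\<^sup>2 / 2)))" .
    moreover have "complex_of_real (exp (- (asymp_var * t\<^sup>2 / 2))) = char (distr std_normal_distribution borel (\<lambda>z. sqrt asymp_var * z)) t"
      using asymp_var_nonneg by (simp add: char_scaled_normal power_mult_distrib)
    ultimately show "(\<lambda>k. char (distr M borel (?Y k)) t) \<longlonglongrightarrow> char (distr std_normal_distribution borel (\<lambda>z. sqrt asymp_var * z)) t"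
      by simp
  qed
  then show ?thesis
    unfolding clt_along_def m_def using asymp_var_nonneg by blast
qed

text \<open>The limiting characteristic function at \<open>1\<close> determines the variance.\<close>

lemma clt_variance_unique:
  assumes "prob_space M" "\<And>i. \<Phi> i \<in> borel_measurable M" "H \<in> borel_measurable borel"
    and v: "clt_along M \<Phi> \<mu> H v" and v': "clt_along M \<Phi> \<mu> H v'"
  shows "v = v'"
proof -
  interpret prob_space M by fact
  note [measurable] = assms(2,3)
  let ?D = "\<lambda>k. distr M borel (\<lambda>\<omega>. sqrt (real k) * (ergodic_average \<Phi> H k \<omega> - (\<integral>x. H x \<partial>\<mu>)))"
  have D: "real_distribution (?D k)" for k
    by (rule real_distribution_distr) (unfold ergodic_average_def, measurable)
  have "(\<lambda>k. char (?D k) 1) \<longlonglongrightarrow> complex_of_real (exp (- (u / 2)))" if "clt_along M \<Phi> \<mu> H u" for u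
    using levy_continuity1[OF D real_distribution_scaled_normal[of "sqrt u"], where t=1] that
    by (simp add: clt_along_def char_scaled_normal)
  from LIMSEQ_unique[OF this[OF v] this[OF v']] show ?thesis by simp
qed

text \<open>The definite description behind the asymptotic variance quantifies over chains on the path space. The
  law of the given chain shows that there is at least one, so the variance is unique.\<close>

lemma markov_chain_path_space:
  fixes \<Phi> :: "nat \<Rightarrow> 'w \<Rightarrow> 'a::euclidean_space"
  assumes chain: "markov_chain P M \<Phi>"
    and P: "\<And>A. A \<in> sets borel \<Longrightarrow> (\<lambda>x. emeasure (P x) A) \<in> borel_measurable borel"
  shows "markov_chain P (distr M (PiM UNIV (\<lambda>_. borel)) (\<lambda>\<omega> i. \<Phi> i \<omega>)) (\<lambda>i x. x i)"
proof -
  have M: "prob_space M" and \<Phi> [measurable]: "\<And>i. \<Phi> i \<in> borel_measurable M"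
    using chain by (auto simp: markov_chain_def)
  interpret prob_space M by fact
  have path [measurable]: "(\<lambda>\<omega> i. \<Phi> i \<omega>) \<in> M \<rightarrow>\<^sub>M PiM UNIV (\<lambda>_. borel)"
    by (rule measurable_PiM_single') (auto simp: space_PiM)
  let ?N = "distr M (PiM UNIV (\<lambda>_. borel)) (\<lambda>\<omega> i. \<Phi> i \<omega>)"
  have coord [measurable]: "(\<lambda>x. x i) \<in> borel_measurable (PiM UNIV (\<lambda>_. borel :: 'a measure))" for i :: nat
    by (rule measurable_component_singleton) simp
  show ?thesis
    unfolding markov_chain_def
  proof (intro conjI allI ballI)
    show "prob_space ?N" by (rule prob_space_distr[OF path])
    show "(\<lambda>x. x i) \<in> borel_measurable ?N" for i by simp
    fix k and A :: "'a set" and B :: "(nat \<Rightarrow> 'a) set"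
    assume A [measurable]: "A \<in> sets borel" and B [measurable]: "B \<in> sets (PiM {..k} (\<lambda>_. borel))"
    have PA [measurable]: "(\<lambda>x. emeasure (P x) A) \<in> borel_measurable borel" by (rule P[OF A])
    have restr [measurable]: "(\<lambda>x. \<lambda>i\<in>{..k}. x i) \<in> PiM UNIV (\<lambda>_. borel :: 'a measure) \<rightarrow>\<^sub>M PiM {..k} (\<lambda>_. borel)"
      by measurable
    have [measurable]: "{x\<in>space ?N. (\<lambda>i\<in>{..k}. x i) \<in> B \<and> x (Suc k) \<in> A} \<in> sets (PiM UNIV (\<lambda>_. borel))"
      unfolding space_distr by measurable
    have "emeasure ?N {x\<in>space ?N. (\<lambda>i\<in>{..k}. x i) \<in> B \<and> x (Suc k) \<in> A}
      = emeasure M ((\<lambda>\<omega> i. \<Phi> i \<omega>) -` {x\<in>space ?N. (\<lambda>i\<in>{..k}. x i) \<in> B \<and> x (Suc k) \<in> A} \<inter> space M)"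
      by (rule emeasure_distr[OF path]) fact
    also have "(\<lambda>\<omega> i. \<Phi> i \<omega>) -` {x\<in>space ?N. (\<lambda>i\<in>{..k}. x i) \<in> B \<and> x (Suc k) \<in> A} \<inter> space M
      = {\<omega>\<in>space M. (\<lambda>i\<in>{..k}. \<Phi> i \<omega>) \<in> B \<and> \<Phi> (Suc k) \<omega> \<in> A}"
      by (auto simp: space_PiM)
    also have "emeasure M \<dots> = (\<integral>\<^sup>+\<omega>. indicator B (\<lambda>i\<in>{..k}. \<Phi> i \<omega>) * emeasure (P (\<Phi> k \<omega>)) A \<partial>M)"
      using chain A B unfolding markov_chain_def by blast
    also have "\<dots> = (\<integral>\<^sup>+x. indicator B (\<lambda>i\<in>{..k}. x i) * emeasure (P (x k)) A \<partial>?N)"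
      by (subst nn_integral_distr[OF path]) auto
    finally show "emeasure ?N {x\<in>space ?N. (\<lambda>i\<in>{..k}. x i) \<in> B \<and> x (Suc k) \<in> A}
      = (\<integral>\<^sup>+x. indicator B (\<lambda>i\<in>{..k}. x i) * emeasure (P (x k)) A \<partial>?N)" .
  qed
qed

theorem (in poisson_pair) asymptotic_variance_eq:
  fixes \<Phi> :: "nat \<Rightarrow> 'w \<Rightarrow> 'a"
  assumes chain: "markov_chain K M \<Phi>" and h: "\<And>x. h x = H x - (\<integral>y. H y \<partial>\<mu>)"
  shows "asymptotic_variance K \<mu> H = asymp_var"
  unfolding asymptotic_variance_def
proof (rule the_equality)
  show "\<forall>(M :: (nat \<Rightarrow> 'a) measure) \<Phi>. markov_chain K M \<Phi> \<longrightarrow> clt_along M \<Phi> \<mu> H asymp_var"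
    using chain_clt[OF _ h] by blast
  fix v assume v: "\<forall>(M :: (nat \<Rightarrow> 'a) measure) \<Phi>. markov_chain K M \<Phi> \<longrightarrow> clt_along M \<Phi> \<mu> H v"
  have H: "H \<in> borel_measurable borel"
  proof -
    define m where "m = (\<integral>y. H y \<partial>\<mu>)"
    have "H = (\<lambda>x. h x + m)" using h by (auto simp: m_def)
    then show ?thesis by simp
  qed
  let ?N = "distr M (PiM UNIV (\<lambda>_. borel)) (\<lambda>\<omega> i. \<Phi> i \<omega>)"
  have path: "markov_chain K ?N (\<lambda>i x. x i)"
    by (rule markov_chain_path_space[OF chain measurable_compose[OF kernel_measurable measurable_emeasure_subprob_algebra]])
  show "v = asymp_var"
  proof (rule clt_variance_unique)
    show "prob_space ?N" "\<And>i. (\<lambda>x. x i) \<in> borel_measurable ?N"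
      using path by (auto simp: markov_chain_def)
    show "clt_along ?N (\<lambda>i x. x i) \<mu> H v" using v path by blast
    show "clt_along ?N (\<lambda>i x. x i) \<mu> H asymp_var" by (rule chain_clt[OF path h])
  qed (rule H)
qed

section \<open>Smallness of the asymptotic variance\<close>

context ergodic_kernel
begin

text \<open>A bound by \<open>V\<close> up to an arbitrary constant \<open>c\<close> is enough, as centring \<open>H\<close> also centres \<open>c\<close> away.\<close>

lemma poisson_pair_exists:
  assumes H [measurable]: "H \<in> borel_measurable borel" and C: "0 \<le> C" and bound: "\<And>x. \<bar>H x - c\<bar> \<le> C * V x"
  defines "C' \<equiv> C * (1 + (\<integral>x. V x \<partial>\<mu>))"
  obtains hh where "poisson_pair K \<mu> V \<beta> \<rho> (\<lambda>x. H x - (\<integral>y. H y \<partial>\<mu>)) hh (poisson_const * C')"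
    "\<And>x. \<bar>H x - (\<integral>y. H y \<partial>\<mu>)\<bar> \<le> C' * V x" "integrable \<mu> H"
proof -
  have C'0: "0 \<le> C'" using C V_mean_nonneg by (simp add: C'_def)
  have int: "integrable \<mu> (\<lambda>x. H x - c)"
    by (rule Bochner_Integration.integrable_bound[of \<mu> "\<lambda>x. C * V x"])
      (use V_mu bound V_nonneg C in \<open>auto intro!: AE_I2 simp: abs_mult\<close>)
  then have Hint: "integrable \<mu> H"
    using Bochner_Integration.integrable_add[OF int mu.integrable_const[of c]] by simp
  have mean: "\<bar>(\<integral>y. H y \<partial>\<mu>) - c\<bar> \<le> C * (\<integral>x. V x \<partial>\<mu>)"
  proof -
    have "(\<integral>y. H y \<partial>\<mu>) - c = (\<integral>y. H y - c \<partial>\<mu>)" using Hint mu.prob_space by simp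
    also have "\<bar>\<dots>\<bar> \<le> (\<integral>y. \<bar>H y - c\<bar> \<partial>\<mu>)" by (rule integral_abs_bound)
    also have "\<dots> \<le> (\<integral>y. C * V y \<partial>\<mu>)" using int V_mu bound by (intro integral_mono) auto
    finally show ?thesis by simp
  qed
  have b: "\<bar>H x - (\<integral>y. H y \<partial>\<mu>)\<bar> \<le> C' * V x" for x
  proof -
    have "\<bar>H x - (\<integral>y. H y \<partial>\<mu>)\<bar> \<le> C * V x + C * (\<integral>x. V x \<partial>\<mu>) * 1" using bound[of x] mean by linarith
    also have "\<dots> \<le> C * V x + C * (\<integral>x. V x \<partial>\<mu>) * V x"
      using C V_mean_nonneg V_ge_1[of x] by (intro add_left_mono mult_left_mono) auto
    finally show ?thesis by (simp add: C'_def algebra_simps)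
  qed
  have mean0: "(\<integral>x. H x - (\<integral>y. H y \<partial>\<mu>) \<partial>\<mu>) = 0" using Hint mu.prob_space by simp
  have hm: "(\<lambda>x. H x - (\<integral>y. H y \<partial>\<mu>)) \<in> borel_measurable borel" by measurable
  obtain hh where hh: "hh \<in> borel_measurable borel" "\<And>x. \<bar>hh x\<bar> \<le> poisson_const * C' * V x"
    "\<And>x. hh x - kernel_op hh x = H x - (\<integral>y. H y \<partial>\<mu>)"
    by (rule poisson_solution[OF hm C'0 b mean0], rule that)
  have "poisson_pair K \<mu> V \<beta> \<rho> (\<lambda>x. H x - (\<integral>y. H y \<partial>\<mu>)) hh (poisson_const * C')"
    by unfold_locales (use hh in auto)
  then show thesis using that b Hint by blast
qed

theorem clt_asymptotic_variance:
  fixes \<Phi> :: "nat \<Rightarrow> 'w \<Rightarrow> 'a"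
  assumes chain: "markov_chain K M \<Phi>" and H: "H \<in> borel_measurable borel" and C: "0 \<le> C" "\<And>x. \<bar>H x\<bar> \<le> C * V x"
  shows "clt_along M \<Phi> \<mu> H (asymptotic_variance K \<mu> H)"
proof -
  have b0: "\<bar>H x - 0\<bar> \<le> C * V x" for x using C(2) by simp
  obtain hh where "poisson_pair K \<mu> V \<beta> \<rho> (\<lambda>x. H x - (\<integral>y. H y \<partial>\<mu>)) hh (poisson_const * (C * (1 + (\<integral>x. V x \<partial>\<mu>))))"
    by (rule poisson_pair_exists[OF H C(1) b0], rule that)
  then interpret P: poisson_pair K \<mu> V \<beta> \<rho> "\<lambda>x. H x - (\<integral>y. H y \<partial>\<mu>)" hh "poisson_const * (C * (1 + (\<integral>x. V x \<partial>\<mu>)))" .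
  show ?thesis
    using P.chain_clt[OF chain refl] P.asymptotic_variance_eq[OF chain refl] by simp
qed

text \<open>By \<open>asymp_var_eq\<close> the variance is at most a fixed multiple of the integral of \<open>\<bar>h n\<bar> * V\<close>, with \<open>h n\<close>
  the centred \<open>H n\<close>, and this tends to \<open>0\<close> by dominated convergence with majorant a multiple of
  \<open>V\<^sup>2\<close>.\<close>

theorem asymptotic_variance_tendsto_0:
  fixes \<Phi> :: "nat \<Rightarrow> 'w \<Rightarrow> 'a"
  assumes chain: "markov_chain K M \<Phi>" and H [measurable]: "\<And>n. H n \<in> borel_measurable borel"
    and C: "0 \<le> C" "\<And>n x. \<bar>H n x - c n\<bar> \<le> C * V x"
    and lim: "AE x in \<mu>. (\<lambda>n. H n x - c n) \<longlonglongrightarrow> 0"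
  shows "(\<lambda>n. asymptotic_variance K \<mu> (H n)) \<longlonglongrightarrow> 0"
proof -
  define C' where "C' = C * (1 + (\<integral>x. V x \<partial>\<mu>))"
  have C'0: "0 \<le> C'" using C V_mean_nonneg by (simp add: C'_def)
  define h where "h n x = H n x - (\<integral>y. H n y \<partial>\<mu>)" for n x
  have [measurable]: "h n \<in> borel_measurable borel" for n unfolding h_def by measurable
  have pair: "\<exists>hh. poisson_pair K \<mu> V \<beta> \<rho> (h n) hh (poisson_const * C')" and hb: "\<bar>h n x\<bar> \<le> C' * V x"
    and Hint: "integrable \<mu> (H n)" for n x
    using poisson_pair_exists[OF H C(1) C(2), of n] unfolding h_def C'_def by metis+
  have "(\<lambda>n. \<integral>x. H n x - c n \<partial>\<mu>) \<longlonglongrightarrow> (\<integral>x. 0 \<partial>\<mu>)"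
    by (rule integral_dominated_convergence[where w="\<lambda>x. C * V x"]) (use lim C V_mu in auto)
  then have mean: "(\<lambda>n. (\<integral>x. H n x \<partial>\<mu>) - c n) \<longlonglongrightarrow> 0" using Hint mu.prob_space by simp
  have h0: "AE x in \<mu>. (\<lambda>n. h n x) \<longlonglongrightarrow> 0"
    using lim
  proof eventually_elim
    case (elim x)
    have "(\<lambda>n. (H n x - c n) - ((\<integral>x. H n x \<partial>\<mu>) - c n)) \<longlonglongrightarrow> 0 - 0" by (rule tendsto_diff[OF elim mean])
    then show ?case by (simp add: h_def)
  qed
  have "(\<lambda>n. \<integral>x. \<bar>h n x\<bar> * V x \<partial>\<mu>) \<longlonglongrightarrow> (\<integral>x. 0 \<partial>\<mu>)"
  proof (rule integral_dominated_convergence[where w="\<lambda>x. C' * (V x)\<^sup>2"])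
    show "AE x in \<mu>. (\<lambda>n. \<bar>h n x\<bar> * V x) \<longlonglongrightarrow> 0"
      using h0 by eventually_elim (intro tendsto_mult_left_zero tendsto_rabs_zero)
    show "AE x in \<mu>. norm (\<bar>h n x\<bar> * V x) \<le> C' * (V x)\<^sup>2" for n
    proof (intro AE_I2)
      fix x
      have "\<bar>h n x\<bar> * V x \<le> C' * V x * V x" using hb[of n x] V_nonneg by (intro mult_right_mono) auto
      then show "norm (\<bar>h n x\<bar> * V x) \<le> C' * (V x)\<^sup>2"
        using V_nonneg[of x] by (simp add: power2_eq_square abs_mult mult.assoc)
    qed
  qed (use V_square in auto)
  then have lim0: "(\<lambda>n. 2 * (poisson_const * C') * (\<integral>x. \<bar>h n x\<bar> * V x \<partial>\<mu>)) \<longlonglongrightarrow> 0"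
    using tendsto_mult_right_zero by auto
  have "0 \<le> asymptotic_variance K \<mu> (H n) \<and> asymptotic_variance K \<mu> (H n) \<le> 2 * (poisson_const * C') * (\<integral>x. \<bar>h n x\<bar> * V x \<partial>\<mu>)" for n
  proof -
    obtain hh where "poisson_pair K \<mu> V \<beta> \<rho> (h n) hh (poisson_const * C')" using pair by blast
    then interpret P: poisson_pair K \<mu> V \<beta> \<rho> "h n" hh "poisson_const * C'" .
    have eq: "asymptotic_variance K \<mu> (H n) = P.asymp_var"
      by (rule P.asymptotic_variance_eq[OF chain]) (simp add: h_def)
    have hV: "integrable \<mu> (\<lambda>x. 2 * (poisson_const * C') * (\<bar>h n x\<bar> * V x))"
    proof (rule Bochner_Integration.integrable_bound[of \<mu> "\<lambda>x. 2 * (poisson_const * C') * (C' * (V x)\<^sup>2)"])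
      show "AE x in \<mu>. norm (2 * (poisson_const * C') * (\<bar>h n x\<bar> * V x)) \<le> norm (2 * (poisson_const * C') * (C' * (V x)\<^sup>2))"
      proof (intro AE_I2)
        fix x
        have "\<bar>h n x\<bar> * V x \<le> C' * V x * V x" using hb[of n x] V_nonneg by (intro mult_right_mono) auto
        then have "2 * (poisson_const * C') * (\<bar>h n x\<bar> * V x) \<le> 2 * (poisson_const * C') * (C' * (V x)\<^sup>2)"
          using poisson_const_nonneg C'0 by (intro mult_left_mono) (auto simp: power2_eq_square mult.assoc)
        moreover have "0 \<le> 2 * (poisson_const * C') * (\<bar>h n x\<bar> * V x)"
          using poisson_const_nonneg C'0 V_nonneg by simp
        ultimately show "norm (2 * (poisson_const * C') * (\<bar>h n x\<bar> * V x)) \<le> norm (2 * (poisson_const * C') * (C' * (V x)\<^sup>2))"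
          by simp
      qed
    qed (use V_square in auto)
    have "P.asymp_var \<le> (\<integral>x. 2 * (poisson_const * C') * (\<bar>h n x\<bar> * V x) \<partial>\<mu>)"
      unfolding P.asymp_var_eq
    proof (rule integral_mono'[OF hV])
      fix x
      have "h n x * (2 * hh x - h n x) \<le> 2 * (h n x * hh x)" by (simp add: algebra_simps)
      also have "\<dots> \<le> 2 * (\<bar>h n x\<bar> * \<bar>hh x\<bar>)" by (metis abs_ge_self abs_mult mult_left_mono zero_le_numeral)
      also have "\<dots> \<le> 2 * (\<bar>h n x\<bar> * (poisson_const * C' * V x))"
        by (intro mult_left_mono P.hh_bound) auto
      finally show "h n x * (2 * hh x - h n x) \<le> 2 * (poisson_const * C') * (\<bar>h n x\<bar> * V x)"
        by (simp add: ac_simps)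
      show "0 \<le> 2 * (poisson_const * C') * (\<bar>h n x\<bar> * V x)"
        using poisson_const_nonneg C'0 V_nonneg by simp
    qed
    then show ?thesis using eq P.asymp_var_nonneg by simp
  qed
  then show ?thesis
    by (intro tendsto_sandwich[OF _ _ tendsto_const lim0]) auto
qed

end

section \<open>The Metropolis-Hastings kernel\<close>

text \<open>The transition density is continuous and strictly positive because the target and the proposal are;
  the upper bound on the proposal makes it at most a multiple of the target, with a factor that
  depends on the starting point.\<close>

locale metropolis_hastings =
  fixes \<pi> :: "'a::euclidean_space \<Rightarrow> real" and q :: "'a \<Rightarrow> 'a \<Rightarrow> real" and B :: real
  assumes target: "prob_density \<pi>" and proposal: "\<And>x. prob_density (q x)"
    and target_cont: "continuous_on UNIV \<pi>" and target_pos: "\<And>x. 0 < \<pi> x"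
    and proposal_cont: "continuous_on UNIV (\<lambda>(x, y). q x y)" and proposal_pos: "\<And>x y. 0 < q x y"
    and proposal_le: "\<And>x y. q x y \<le> B"
begin

definition trans_density :: "'a \<Rightarrow> 'a \<Rightarrow> real" where
  "trans_density x y = mh_accept \<pi> q x y * q x y"

definition reject_prob :: "'a \<Rightarrow> real" where
  "reject_prob x = 1 - (\<integral>y. trans_density x y \<partial>lborel)"

abbreviation "K \<equiv> mh_kernel \<pi> q"
abbreviation "\<mu> \<equiv> target_measure \<pi>"

lemma trans_density_eq: "trans_density x y = min (q x y) (\<pi> y * q y x / \<pi> x)"
proof -
  have "0 < \<pi> x * q x y" using target_pos proposal_pos by simp
  then have "trans_density x y = min 1 ((\<pi> y * q y x) / (\<pi> x * q x y)) * q x y"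
    by (simp add: trans_density_def mh_accept_def)
  also have "\<dots> = min (1 * q x y) ((\<pi> y * q y x) / (\<pi> x * q x y) * q x y)"
    using proposal_pos[of x y] by (simp add: min_mult_distrib_right)
  also have "(\<pi> y * q y x) / (\<pi> x * q x y) * q x y = \<pi> y * q y x / \<pi> x"
    using proposal_pos[of x y] by simp
  finally show ?thesis by simp
qed

lemma trans_density_pos: "0 < trans_density x y"
  using target_pos[of x] target_pos[of y] proposal_pos[of x y] proposal_pos[of y x]
  by (simp add: trans_density_eq)

lemma trans_density_nonneg: "0 \<le> trans_density x y"
  using trans_density_pos[of x y] by simp

lemma trans_density_le_proposal: "trans_density x y \<le> q x y"
  by (simp add: trans_density_eq)

text \<open>This domination by \<open>\<pi>\<close>, locally uniform in \<open>x\<close>, makes integrals of \<open>V\<close>-dominated functions depend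
  continuously on \<open>x\<close>.\<close>

lemma trans_density_le_target: "trans_density x y \<le> B * \<pi> y / \<pi> x"
proof -
  have "trans_density x y \<le> \<pi> y * q y x / \<pi> x" by (simp add: trans_density_eq)
  also have "\<dots> \<le> \<pi> y * B / \<pi> x"
    using target_pos[of x] target_pos[of y] proposal_le[of y x] by (intro divide_right_mono mult_left_mono) auto
  finally show ?thesis by (simp add: mult.commute)
qed

lemma detailed_balance: "\<pi> x * trans_density x y = \<pi> y * trans_density y x"
proof -
  have "\<pi> x * trans_density x y = min (\<pi> x * q x y) (\<pi> y * q y x)" for x y
    using target_pos[of x] by (simp add: trans_density_eq min_mult_distrib_left)
  from this[of x y] this[of y x] show ?thesis by (simp add: min.commute)
qed

lemma trans_density_cont: "continuous_on UNIV (\<lambda>z. trans_density (fst z) (snd z))"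
proof -
  have q1: "continuous_on UNIV (\<lambda>z. q (fst z) (snd z))"
    using proposal_cont by (simp add: case_prod_unfold)
  have "continuous_on UNIV (\<lambda>z :: 'a \<times> 'a. (snd z, fst z))" by (intro continuous_intros)
  from continuous_on_compose2[OF proposal_cont this]
  have q2: "continuous_on UNIV (\<lambda>z. q (snd z) (fst z))" by simp
  have \<pi>1: "continuous_on UNIV (\<lambda>z :: 'a \<times> 'a. \<pi> (fst z))" and \<pi>2: "continuous_on UNIV (\<lambda>z :: 'a \<times> 'a. \<pi> (snd z))"
    by (rule continuous_on_compose2[OF target_cont]; auto intro!: continuous_intros)+
  show ?thesis
    unfolding trans_density_eq
    by (intro continuous_on_min continuous_on_divide continuous_on_mult q1 q2 \<pi>1 \<pi>2) (use target_pos less_imp_neq in fastforce)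
qed

lemma trans_density_cont_left: "continuous_on UNIV (\<lambda>x. trans_density x y)"
proof -
  have "continuous_on UNIV (\<lambda>x :: 'a. (x, y))" by (intro continuous_intros)
  from continuous_on_compose2[OF trans_density_cont this] show ?thesis by simp
qed

lemma trans_density_measurable_pair [measurable]:
  "(\<lambda>z. trans_density (fst z) (snd z)) \<in> borel_measurable (borel \<Otimes>\<^sub>M borel)"
  using borel_measurable_continuous_onI[OF trans_density_cont] by (simp add: borel_prod)

lemma trans_density_measurable [measurable (raw)]:
  assumes [measurable]: "f \<in> borel_measurable N" "g \<in> borel_measurable N"
  shows "(\<lambda>z. trans_density (f z) (g z)) \<in> borel_measurable N"
proof -
  have "(\<lambda>z. (f z, g z)) \<in> N \<rightarrow>\<^sub>M borel \<Otimes>\<^sub>M borel" by measurable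
  from measurable_compose[OF this trans_density_measurable_pair] show ?thesis by simp
qed

lemma target_measurable [measurable]: "\<pi> \<in> borel_measurable borel"
  using target by (simp add: prob_density_def)

lemma trans_density_integrable: "integrable lborel (trans_density x)"
  and trans_density_integral: "(\<integral>\<^sup>+y. ennreal (trans_density x y) \<partial>lborel) + ennreal (reject_prob x) = 1"
  and reject_prob_nonneg: "0 \<le> reject_prob x" and reject_prob_le_1: "reject_prob x \<le> 1"
proof -
  have le: "(\<integral>\<^sup>+y. ennreal (trans_density x y) \<partial>lborel) \<le> 1"
  proof -
    have "(\<integral>\<^sup>+y. ennreal (trans_density x y) \<partial>lborel) \<le> (\<integral>\<^sup>+y. ennreal (q x y) \<partial>lborel)"
      by (intro nn_integral_mono ennreal_leI trans_density_le_proposal)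
    then show ?thesis using proposal[of x] by (simp add: prob_density_def)
  qed
  show int: "integrable lborel (trans_density x)"
    using le by (intro integrableI_nonneg) (auto simp: trans_density_nonneg intro: le_less_trans)
  have eq: "(\<integral>\<^sup>+y. ennreal (trans_density x y) \<partial>lborel) = ennreal (\<integral>y. trans_density x y \<partial>lborel)"
    by (rule nn_integral_eq_integral[OF int]) (simp add: trans_density_nonneg)
  have nn: "0 \<le> (\<integral>y. trans_density x y \<partial>lborel)" by (simp add: trans_density_nonneg)
  have le1: "(\<integral>y. trans_density x y \<partial>lborel) \<le> 1" using le eq by simp
  show "0 \<le> reject_prob x" "reject_prob x \<le> 1" using nn le1 by (auto simp: reject_prob_def)
  show "(\<integral>\<^sup>+y. ennreal (trans_density x y) \<partial>lborel) + ennreal (reject_prob x) = 1"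
    unfolding eq reject_prob_def using nn le1 by (simp flip: ennreal_plus)
qed

lemma reject_prob_measurable [measurable]: "reject_prob \<in> borel_measurable borel"
  unfolding reject_prob_def by measurable

lemma emeasure_K:
  assumes "A \<in> sets borel"
  shows "emeasure (K x) A = (\<integral>\<^sup>+y. ennreal (trans_density x y) * indicator A y \<partial>lborel) + ennreal (reject_prob x) * indicator A x"
proof -
  have "(\<lambda>y. mh_accept \<pi> q x y * q x y) \<in> borel_measurable borel"
    unfolding trans_density_def[symmetric] by measurable
  from emeasure_mh_kernel[OF this assms] show ?thesis
    by (simp add: trans_density_def reject_prob_def)
qed

lemma nn_integral_K:
  assumes "f \<in> borel_measurable borel"
  shows "(\<integral>\<^sup>+y. f y \<partial>K x) = (\<integral>\<^sup>+y. ennreal (trans_density x y) * f y \<partial>lborel) + ennreal (reject_prob x) * f x"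
  using assms
proof (induction rule: borel_measurable_induct)
  case (cong f g)
  then have "f = g" by (simp add: fun_eq_iff)
  then show ?case using cong by simp
next
  case (set A)
  then show ?case using emeasure_K by simp
next
  case (mult u c)
  then show ?case
    by (simp add: nn_integral_cmult measurable_cong_sets[OF sets_mh_kernel refl] distrib_left mult.left_commute)
next
  case (add u v)
  let ?A = "\<lambda>w. \<integral>\<^sup>+y. ennreal (trans_density x y) * w y \<partial>lborel" and ?R = "\<lambda>w. ennreal (reject_prob x) * w x"
  have "(\<integral>\<^sup>+y. u y + v y \<partial>K x) = (\<integral>\<^sup>+y. u y \<partial>K x) + (\<integral>\<^sup>+y. v y \<partial>K x)"
    using add by (intro nn_integral_add) (auto simp: measurable_cong_sets[OF sets_mh_kernel refl])
  also have "\<dots> = (?A u + ?A v) + (?R u + ?R v)"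
    unfolding add.IH by (simp only: ac_simps)
  also have "?A u + ?A v = ?A (\<lambda>y. u y + v y)"
    using add by (simp add: distrib_left nn_integral_add)
  also have "?R u + ?R v = ?R (\<lambda>y. u y + v y)" by (simp add: distrib_left)
  finally show ?case by (simp only: add.commute[of "v _"])
next
  case (seq U)
  have inc: "incseq (\<lambda>i y. ennreal (trans_density x y) * U i y)"
    using \<open>incseq U\<close> by (auto simp: incseq_def le_fun_def intro!: mult_left_mono)
  have inc': "incseq (\<lambda>i. \<integral>\<^sup>+y. ennreal (trans_density x y) * U i y \<partial>lborel)"
    using inc by (auto simp: incseq_def le_fun_def intro!: nn_integral_mono)
  have incx: "incseq (\<lambda>i. ennreal (reject_prob x) * U i x)"
    using \<open>incseq U\<close> by (auto simp: incseq_def le_fun_def intro!: mult_left_mono)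
  have "(\<integral>\<^sup>+y. (SUP i. U i) y \<partial>K x) = (SUP i. \<integral>\<^sup>+y. U i y \<partial>K x)"
    unfolding SUP_apply using seq by (intro nn_integral_monotone_convergence_SUP) (auto simp: measurable_cong_sets[OF sets_mh_kernel refl])
  also have "\<dots> = (SUP i. (\<integral>\<^sup>+y. ennreal (trans_density x y) * U i y \<partial>lborel) + ennreal (reject_prob x) * U i x)"
    using seq by simp
  also have "\<dots> = (SUP i. \<integral>\<^sup>+y. ennreal (trans_density x y) * U i y \<partial>lborel) + (SUP i. ennreal (reject_prob x) * U i x)"
    by (rule ennreal_SUP_add[OF inc' incx])
  also have "(SUP i. \<integral>\<^sup>+y. ennreal (trans_density x y) * U i y \<partial>lborel) = (\<integral>\<^sup>+y. (SUP i. ennreal (trans_density x y) * U i y) \<partial>lborel)"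
    using seq inc by (intro nn_integral_monotone_convergence_SUP[symmetric]) auto
  finally show ?case by (simp add: SUP_mult_left_ennreal SUP_apply image_image)
qed

lemma K_prob: "prob_space (K x)"
proof
  show "emeasure (K x) (space (K x)) = 1"
    using emeasure_K[of UNIV x] trans_density_integral[of x] by simp
qed

lemma K_measurable [measurable]: "K \<in> borel \<rightarrow>\<^sub>M subprob_algebra borel"
proof (rule measurable_subprob_algebra)
  show "subprob_space (K x)" for x using K_prob by (rule prob_space_imp_subprob_space)
  fix A :: "'a set" assume A [measurable]: "A \<in> sets borel"
  show "(\<lambda>x. emeasure (K x) A) \<in> borel_measurable borel"
    unfolding emeasure_K[OF A] by measurable
qed simp

lemma mu_prob: "prob_space \<mu>"
proof
  show "emeasure \<mu> (space \<mu>) = 1"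
    using target by (simp add: target_measure_def emeasure_density prob_density_def)
qed

lemma sets_mu: "sets \<mu> = sets borel" by (simp add: target_measure_def)

text \<open>Fubini and detailed balance move the accepted part onto \<open>f y\<close>, where acceptance and rejection
  probabilities add up to \<open>1\<close>.\<close>

lemma K_invariant:
  assumes f [measurable]: "f \<in> borel_measurable borel"
  shows "(\<integral>\<^sup>+x. (\<integral>\<^sup>+y. f y \<partial>K x) \<partial>\<mu>) = (\<integral>\<^sup>+x. f x \<partial>\<mu>)"
proof -
  have "(\<integral>\<^sup>+x. (\<integral>\<^sup>+y. f y \<partial>K x) \<partial>\<mu>)
    = (\<integral>\<^sup>+x. ennreal (\<pi> x) * ((\<integral>\<^sup>+y. ennreal (trans_density x y) * f y \<partial>lborel) + ennreal (reject_prob x) * f x) \<partial>lborel)"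
    unfolding target_measure_def nn_integral_K[OF f] by (subst nn_integral_density) auto
  also have "\<dots> = (\<integral>\<^sup>+x. (\<integral>\<^sup>+y. ennreal (\<pi> x) * ennreal (trans_density x y) * f y \<partial>lborel) \<partial>lborel)
      + (\<integral>\<^sup>+x. ennreal (\<pi> x) * (ennreal (reject_prob x) * f x) \<partial>lborel)"
    by (subst nn_integral_add[symmetric]) (auto simp: distrib_left nn_integral_cmult[symmetric] mult.assoc)
  also have "(\<integral>\<^sup>+x. (\<integral>\<^sup>+y. ennreal (\<pi> x) * ennreal (trans_density x y) * f y \<partial>lborel) \<partial>lborel)
      = (\<integral>\<^sup>+y. (\<integral>\<^sup>+x. ennreal (\<pi> x) * ennreal (trans_density x y) * f y \<partial>lborel) \<partial>lborel)"
    by (rule lborel_pair.Fubini'[symmetric]) measurable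
  also have "\<dots> = (\<integral>\<^sup>+y. (\<integral>\<^sup>+x. ennreal (\<pi> y) * f y * ennreal (trans_density y x) \<partial>lborel) \<partial>lborel)"
  proof (intro nn_integral_cong)
    fix x y
    have "ennreal (\<pi> x) * ennreal (trans_density x y) = ennreal (\<pi> y) * ennreal (trans_density y x)"
      using detailed_balance[of x y] target_pos trans_density_nonneg by (simp flip: ennreal_mult' add: less_imp_le)
    then show "ennreal (\<pi> x) * ennreal (trans_density x y) * f y = ennreal (\<pi> y) * f y * ennreal (trans_density y x)"
      by (simp add: ac_simps)
  qed
  also have "\<dots> = (\<integral>\<^sup>+y. ennreal (\<pi> y) * f y * (\<integral>\<^sup>+x. ennreal (trans_density y x) \<partial>lborel) \<partial>lborel)"
    by (intro nn_integral_cong nn_integral_cmult) measurable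
  also have "\<dots> + (\<integral>\<^sup>+x. ennreal (\<pi> x) * (ennreal (reject_prob x) * f x) \<partial>lborel)
    = (\<integral>\<^sup>+y. ennreal (\<pi> y) * f y * ((\<integral>\<^sup>+x. ennreal (trans_density y x) \<partial>lborel) + ennreal (reject_prob y)) \<partial>lborel)"
    by (subst nn_integral_add[symmetric]) (auto simp: distrib_left ac_simps)
  also have "\<dots> = (\<integral>\<^sup>+x. f x \<partial>\<mu>)"
    unfolding trans_density_integral target_measure_def by (subst nn_integral_density) auto
  finally show ?thesis .
qed

lemma K_integral:
  fixes f :: "'a \<Rightarrow> real"
  assumes f: "integrable (K x) f"
  shows "integrable lborel (\<lambda>y. trans_density x y * f y)"
    and "(\<integral>y. f y \<partial>K x) = (\<integral>y. trans_density x y * f y \<partial>lborel) + reject_prob x * f x"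
proof -
  have fm [measurable]: "f \<in> borel_measurable borel"
    using borel_measurable_integrable[OF f] by (simp add: measurable_cong_sets[OF sets_mh_kernel refl])
  have nonneg: "integrable lborel (\<lambda>y. trans_density x y * g y) \<and>
      (\<integral>y. g y \<partial>K x) = (\<integral>y. trans_density x y * g y \<partial>lborel) + reject_prob x * g x"
    if g: "integrable (K x) g" and nn: "\<And>y. 0 \<le> g y" and gm [measurable]: "g \<in> borel_measurable borel" for g
  proof -
    have eq: "ennreal (\<integral>y. g y \<partial>K x) = (\<integral>\<^sup>+y. ennreal (trans_density x y * g y) \<partial>lborel) + ennreal (reject_prob x * g x)"
      using nn_integral_K[of "\<lambda>y. ennreal (g y)" x] nn g trans_density_nonneg reject_prob_nonneg
      by (simp add: nn_integral_eq_integral ennreal_mult)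
    have "(\<integral>\<^sup>+y. ennreal (trans_density x y * g y) \<partial>lborel) \<le> ennreal (\<integral>y. g y \<partial>K x)"
      unfolding eq by simp
    then have fin: "(\<integral>\<^sup>+y. ennreal (trans_density x y * g y) \<partial>lborel) < \<infinity>"
      by (rule le_less_trans) simp
    have int: "integrable lborel (\<lambda>y. trans_density x y * g y)"
      by (rule integrableI_nonneg) (use fin nn trans_density_nonneg in auto)
    have "(\<integral>\<^sup>+y. ennreal (trans_density x y * g y) \<partial>lborel) = ennreal (\<integral>y. trans_density x y * g y \<partial>lborel)"
      by (rule nn_integral_eq_integral[OF int]) (use nn trans_density_nonneg in auto)
    moreover have "0 \<le> (\<integral>y. trans_density x y * g y \<partial>lborel)" "0 \<le> reject_prob x * g x" "0 \<le> (\<integral>y. g y \<partial>K x)"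
      using nn trans_density_nonneg reject_prob_nonneg by simp_all
    ultimately have "(\<integral>y. g y \<partial>K x) = (\<integral>y. trans_density x y * g y \<partial>lborel) + reject_prob x * g x"
      using eq by (metis ennreal_plus ennreal_inj add_nonneg_nonneg)
    then show ?thesis using int by simp
  qed
  let ?p = "\<lambda>y. max (f y) 0" and ?m = "\<lambda>y. max (- f y) 0"
  have p: "integrable (K x) ?p" and m: "integrable (K x) ?m" using f by auto
  note P = nonneg[OF p] and M = nonneg[OF m]
  have fpm: "f y = ?p y - ?m y" for y by auto
  have d: "(\<lambda>y. trans_density x y * f y) = (\<lambda>y. trans_density x y * ?p y - trans_density x y * ?m y)"
    by (subst fpm) (simp only: right_diff_distrib)
  show "integrable lborel (\<lambda>y. trans_density x y * f y)" unfolding d using P M by auto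
  have "(\<integral>y. f y \<partial>K x) = (\<integral>y. ?p y - ?m y \<partial>K x)" by (intro Bochner_Integration.integral_cong) auto
  also have "\<dots> = (\<integral>y. ?p y \<partial>K x) - (\<integral>y. ?m y \<partial>K x)" using p m by simp
  also have "\<dots> = ((\<integral>y. trans_density x y * ?p y \<partial>lborel) - (\<integral>y. trans_density x y * ?m y \<partial>lborel)) + reject_prob x * (?p x - ?m x)"
    using P M by (simp add: algebra_simps)
  also have "\<dots> = (\<integral>y. trans_density x y * f y \<partial>lborel) + reject_prob x * f x"
    unfolding d fpm[symmetric] using P M by simp
  finally show "(\<integral>y. f y \<partial>K x) = (\<integral>y. trans_density x y * f y \<partial>lborel) + reject_prob x * f x" .
qed

text \<open>Sublevel sets of \<open>V\<close> are compact, so the positive continuous transition density is bounded below on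
  the square of such a set. The set has positive Lebesgue measure because \<open>V 0 < R\<close>.\<close>

lemma minorization:
  assumes V: "continuous_on UNIV V" "bounded {x. V x \<le> R}" and R: "V 0 < (R :: real)"
  obtains \<alpha> \<nu> where "0 < \<alpha>" "\<alpha> < 1" "sets \<nu> = sets borel" "emeasure \<nu> UNIV = ennreal \<alpha>"
    "\<And>x A. V x \<le> R \<Longrightarrow> A \<in> sets borel \<Longrightarrow> emeasure \<nu> A \<le> emeasure (K x) A"
proof -
  define D where "D = {x. V x \<le> R}"
  have "closed D" unfolding D_def by (rule closed_Collect_le[OF V(1)]) (rule continuous_on_const)
  then have D: "compact D" using V(2) by (simp add: compact_eq_bounded_closed D_def)
  have Dm [measurable]: "D \<in> sets borel" using \<open>closed D\<close> by simp
  have "0 \<in> D" using R by (simp add: D_def)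
  then have "D \<times> D \<noteq> {}" by auto
  obtain z where z: "z \<in> D \<times> D" "\<And>w. w \<in> D \<times> D \<Longrightarrow> trans_density (fst z) (snd z) \<le> trans_density (fst w) (snd w)"
    using continuous_attains_inf[OF compact_Times[OF D D] \<open>D \<times> D \<noteq> {}\<close> continuous_on_subset[OF trans_density_cont]] by blast
  define m where "m = trans_density (fst z) (snd z)"
  have m: "0 < m" "\<And>x y. x \<in> D \<Longrightarrow> y \<in> D \<Longrightarrow> m \<le> trans_density x y"
    using trans_density_pos z(2) by (auto simp: m_def)
  define L where "L = measure lborel D"
  have fin: "emeasure lborel D < \<infinity>" using emeasure_compact_finite[OF D] by simp
  have L: "emeasure lborel D = ennreal L" using fin by (simp add: L_def emeasure_eq_ennreal_measure)
  have "open {x. V x < R}" by (rule open_Collect_less[OF V(1)]) (rule continuous_on_const)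
  moreover have "0 \<in> {x. V x < R}" using R by simp
  ultimately obtain r where r: "0 < r" "ball 0 r \<subseteq> {x. V x < R}" using open_contains_ball by blast
  have "0 < measure lborel (ball (0 :: 'a) r)" by (rule content_ball_pos[OF r(1)])
  also have "\<dots> \<le> L"
    unfolding L_def using r(2) fin Dm by (intro measure_mono_fmeasurable) (auto simp: D_def fmeasurable_def)
  finally have Lpos: "0 < L" .
  \<comment> \<open>The second argument of the minimum keeps the mass \<open>\<epsilon> * L\<close> below \<open>1\<close>.\<close>
  define \<epsilon> where "\<epsilon> = min m (1 / (2 * L))"
  have \<epsilon>: "0 < \<epsilon>" "\<epsilon> \<le> m" using m Lpos by (auto simp: \<epsilon>_def)
  have "\<epsilon> * L \<le> 1 / (2 * L) * L" using Lpos by (intro mult_right_mono) (auto simp: \<epsilon>_def)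
  then have \<alpha>: "0 < \<epsilon> * L" "\<epsilon> * L < 1" using \<epsilon> Lpos by auto
  define \<nu> where "\<nu> = density lborel (\<lambda>y. ennreal \<epsilon> * indicator D y)"
  have \<nu>: "emeasure \<nu> A = (\<integral>\<^sup>+y. ennreal \<epsilon> * indicator D y * indicator A y \<partial>lborel)" if "A \<in> sets borel" for A
    unfolding \<nu>_def using that by (subst emeasure_density) auto
  have "emeasure \<nu> UNIV = ennreal \<epsilon> * ennreal L" using \<nu>[of UNIV] L by (simp add: nn_integral_cmult)
  then have "emeasure \<nu> UNIV = ennreal (\<epsilon> * L)" using \<epsilon> Lpos by (simp add: ennreal_mult)
  moreover have "emeasure \<nu> A \<le> emeasure (K x) A" if x: "V x \<le> R" and A: "A \<in> sets borel" for x A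
  proof -
    have "emeasure \<nu> A \<le> (\<integral>\<^sup>+y. ennreal (trans_density x y) * indicator A y \<partial>lborel)"
      unfolding \<nu>[OF A]
    proof (rule nn_integral_mono)
      fix y
      show "ennreal \<epsilon> * indicator D y * indicator A y \<le> ennreal (trans_density x y) * indicator A y"
      proof (cases "y \<in> D")
        case True
        then have "\<epsilon> \<le> trans_density x y" using m(2)[of x y] x \<epsilon> by (simp add: D_def)
        then show ?thesis by (auto simp: indicator_def intro: ennreal_leI)
      qed simp
    qed
    also have "\<dots> \<le> emeasure (K x) A" unfolding emeasure_K[OF A] by simp
    finally show ?thesis .
  qed
  ultimately show thesis using that[of "\<epsilon> * L" \<nu>] \<alpha> by (simp add: \<nu>_def)
qed

end

section \<open>Discretised kernels\<close>

text \<open>The sublevel sets of \<open>V\<close> serve as small sets, so the drift inequality carries its additive constant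
  everywhere.\<close>

locale metropolis_hastings_drift = metropolis_hastings +
  fixes V :: "'a \<Rightarrow> real" and l k :: real
  assumes V_cont: "continuous_on UNIV V" and V_ge_1: "\<And>x. 1 \<le> V x"
    and V_square: "(\<integral>\<^sup>+x. ennreal ((V x)\<^sup>2) \<partial>\<mu>) < \<infinity>"
    and V_sublevel: "\<And>c. 1 \<le> c \<Longrightarrow> bounded (V -` {1..c})"
    and l: "0 < l" "l < 1" and k: "0 < k"
    and drift: "\<And>x. (\<integral>\<^sup>+y. ennreal (V y) \<partial>K x) \<le> ennreal (l * V x + k)"
begin

lemma V_measurable [measurable]: "V \<in> borel_measurable borel"
  by (rule borel_measurable_continuous_onI[OF V_cont])

lemma V_nonneg: "0 \<le> V x"
  using V_ge_1[of x] by simp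

lemma V_kernel: "integrable (K x) V" and V_kernel_le: "(\<integral>y. V y \<partial>K x) \<le> l * V x + k"
proof -
  show int: "integrable (K x) V"
    by (rule integrableI_nonneg) (use drift[of x] V_nonneg in \<open>auto simp: measurable_cong_sets[OF sets_mh_kernel refl] intro: le_less_trans\<close>)
  have "0 \<le> l * V x + k" using l k V_nonneg[of x] by simp
  then show "(\<integral>y. V y \<partial>K x) \<le> l * V x + k"
    using drift[of x] V_nonneg nn_integral_eq_integral[OF int] by simp
qed

text \<open>The kernel whose Poisson equation the Scheme solves, with \<open>rep\<close> mapping a point to the representative of
  its cell; for the identity it is the kernel itself.\<close>

definition discretised :: "('a \<Rightarrow> 'a) \<Rightarrow> 'a \<Rightarrow> 'a measure" where
  "discretised rep x = distr (K (rep x)) borel rep"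

text \<open>Moving to a representative multiplies \<open>V\<close> by at most \<open>1 + \<delta>\<close>. It happens before and after a transition, so
  the drift rate grows to at most \<open>l * (1 + \<delta>)\<^sup>2\<close>, still below \<open>1\<close> for small \<open>\<delta>\<close>. For the same reason the
  minorization is taken on the sublevel set of \<open>2 * R\<close>: representatives of points in that of \<open>R\<close>
  belong to it, and the image of the minorizing measure under \<open>rep\<close> has the same mass.\<close>

lemma uniform_harris:
  obtains \<gamma> R \<alpha> \<delta> where "0 < \<gamma>" "\<gamma> < 1" "2 * (2 * k) < (1 - \<gamma>) * R" "0 < \<alpha>" "\<alpha> < 1" "0 < \<delta>" "\<delta> \<le> 1"
    "\<And>rep. rep \<in> borel_measurable borel \<Longrightarrow> (\<And>x. V (rep x) \<le> (1 + \<delta>) * V x) \<Longrightarrow>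
       harris_kernel V \<gamma> (2 * k) R \<alpha> (discretised rep)"
proof -
  define \<gamma> where "\<gamma> = (1 + l) / 2"
  have \<gamma>: "0 < \<gamma>" "\<gamma> < 1" "l < \<gamma>" using l by (auto simp: \<gamma>_def)
  \<comment> \<open>Then \<open>(1 + \<delta>)\<^sup>2 \<le> 1 + 3 * \<delta> \<le> \<gamma> / l\<close>.\<close>
  define \<delta> where "\<delta> = min 1 ((\<gamma> / l - 1) / 3)"
  have gl: "0 < \<gamma> / l - 1" using \<gamma> l by simp
  have \<delta>: "0 < \<delta>" "\<delta> \<le> 1" using gl by (auto simp: \<delta>_def)
  have \<delta>sq: "l * ((1 + \<delta>) * (1 + \<delta>)) \<le> \<gamma>"
  proof -
    have "\<delta> * \<delta> \<le> 1 * \<delta>" using \<delta> by (intro mult_right_mono) auto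
    then have "(1 + \<delta>) * (1 + \<delta>) \<le> 1 + 3 * \<delta>" by (simp add: algebra_simps)
    also have "\<dots> \<le> \<gamma> / l"
    proof -
      have "\<delta> \<le> (\<gamma> / l - 1) / 3" unfolding \<delta>_def by (rule min.cobounded2)
      then have "3 * \<delta> \<le> 3 * ((\<gamma> / l - 1) / 3)" by (intro mult_left_mono) auto
      then show ?thesis by simp
    qed
    finally show ?thesis using l by (simp add: field_simps)
  qed
  define R where "R = max (V 0 + 1) (2 * (2 * k) / (1 - \<gamma>) + 1)"
  have R: "2 * (2 * k) < (1 - \<gamma>) * R" "V 0 < R"
  proof -
    have "2 * (2 * k) / (1 - \<gamma>) < R" by (simp add: R_def)
    then show "2 * (2 * k) < (1 - \<gamma>) * R" using \<gamma> by (simp add: field_simps)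
  qed (simp add: R_def)
  have R1: "1 \<le> R" using R(2) V_ge_1[of 0] by linarith
  have bdd: "bounded {x. V x \<le> 2 * R}"
  proof -
    have "{x. V x \<le> 2 * R} = V -` {1..2 * R}" using V_ge_1 by auto
    then show ?thesis using V_sublevel[of "2 * R"] R1 by simp
  qed
  have R2: "V 0 < 2 * R" using R R1 by linarith
  obtain \<alpha> \<nu> where \<alpha>: "0 < \<alpha>" "\<alpha> < 1" and \<nu>: "sets \<nu> = sets borel" "emeasure \<nu> UNIV = ennreal \<alpha>"
    "\<And>x A. V x \<le> 2 * R \<Longrightarrow> A \<in> sets borel \<Longrightarrow> emeasure \<nu> A \<le> emeasure (K x) A"
    by (rule minorization[OF V_cont bdd R2], rule that, assumption, assumption, assumption, assumption, assumption)
  have "harris_kernel V \<gamma> (2 * k) R \<alpha> (discretised rep)"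
    if rep [measurable]: "rep \<in> borel_measurable borel" and repV: "\<And>x. V (rep x) \<le> (1 + \<delta>) * V x" for rep
    unfolding harris_kernel_def
  proof (intro conjI allI)
    fix x
    have repK: "rep \<in> K z \<rightarrow>\<^sub>M borel" for z by (simp add: measurable_cong_sets[OF sets_mh_kernel refl])
    show "prob_space (discretised rep x)"
      unfolding discretised_def by (rule prob_space.prob_space_distr[OF K_prob repK])
    show "sets (discretised rep x) = sets borel" by (simp add: discretised_def)
    have Vrep: "integrable (K z) (\<lambda>y. V (rep y))" for z
      by (rule Bochner_Integration.integrable_bound[of "K z" "\<lambda>y. (1 + \<delta>) * V y"])
        (use V_kernel repV V_nonneg \<delta> in \<open>auto intro!: AE_I2 simp: measurable_cong_sets[OF sets_mh_kernel refl] abs_mult\<close>)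
    then show "integrable (discretised rep x) V"
      unfolding discretised_def by (subst integrable_distr_eq[OF repK]) auto
    have "(\<integral>y. V y \<partial>discretised rep x) = (\<integral>y. V (rep y) \<partial>K (rep x))"
      unfolding discretised_def by (rule integral_distr[OF repK]) measurable
    also have "\<dots> \<le> (\<integral>y. (1 + \<delta>) * V y \<partial>K (rep x))"
      using Vrep V_kernel repV by (intro integral_mono) auto
    also have "\<dots> = (1 + \<delta>) * (\<integral>y. V y \<partial>K (rep x))" by simp
    also have "\<dots> \<le> (1 + \<delta>) * (l * ((1 + \<delta>) * V x) + k)"
    proof (rule mult_left_mono)
      have "l * V (rep x) \<le> l * ((1 + \<delta>) * V x)" using repV[of x] l by (intro mult_left_mono) auto
      then show "(\<integral>y. V y \<partial>K (rep x)) \<le> l * ((1 + \<delta>) * V x) + k" using V_kernel_le[of "rep x"] by linarith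
    qed (use \<delta> in simp)
    also have "\<dots> = l * ((1 + \<delta>) * (1 + \<delta>)) * V x + (1 + \<delta>) * k" by (simp add: algebra_simps)
    also have "\<dots> \<le> \<gamma> * V x + 2 * k"
      using \<delta>sq \<delta> k V_nonneg[of x] by (intro add_mono mult_right_mono) auto
    finally show "(\<integral>y. V y \<partial>discretised rep x) \<le> \<gamma> * V x + 2 * k" .
  next
    have rep\<nu>: "rep \<in> \<nu> \<rightarrow>\<^sub>M borel" by (simp add: measurable_cong_sets[OF \<nu>(1) refl])
    have repK: "rep \<in> K z \<rightarrow>\<^sub>M borel" for z by (simp add: measurable_cong_sets[OF sets_mh_kernel refl])
    have sp: "space \<nu> = UNIV" using sets_eq_imp_space_eq[OF \<nu>(1)] by simp
    have "emeasure (distr \<nu> borel rep) A \<le> emeasure (discretised rep x) A"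
      if x: "V x \<le> R" and A: "A \<in> sets borel" for x A
    proof -
      have "V (rep x) \<le> (1 + \<delta>) * R"
        using repV[of x] x \<delta> by (meson mult_left_mono order_trans add_nonneg_nonneg zero_le_one less_imp_le)
      also have "\<dots> \<le> 2 * R" using \<delta> R1 by (intro mult_right_mono) auto
      finally have "emeasure \<nu> (rep -` A) \<le> emeasure (K (rep x)) (rep -` A)"
        by (rule \<nu>(3)) (use measurable_sets[OF rep A] in simp)
      then show ?thesis
        unfolding discretised_def using A by (simp add: emeasure_distr[OF rep\<nu>] emeasure_distr[OF repK] sp)
    qed
    moreover have "emeasure (distr \<nu> borel rep) UNIV = ennreal \<alpha>"
      using \<nu>(2) by (simp add: emeasure_distr[OF rep\<nu>] sp)
    ultimately show "\<exists>\<nu>. sets \<nu> = sets borel \<and> emeasure \<nu> UNIV = ennreal \<alpha> \<and>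
        (\<forall>x. V x \<le> R \<longrightarrow> (\<forall>A\<in>sets borel. emeasure \<nu> A \<le> emeasure (discretised rep x) A))"
      by (intro exI[of _ "distr \<nu> borel rep"]) auto
  qed
  then show thesis by (rule that[OF \<gamma>(1,2) R(1) \<alpha> \<delta>])
qed

lemma discretised_id: "discretised (\<lambda>x. x) = K"
  unfolding discretised_def by (intro ext distr_id2) simp

lemma uniform_contraction:
  obtains \<beta> \<rho> \<delta> where "ergodic_kernel K \<mu> V \<beta> \<rho>" "0 < \<delta>" "\<delta> \<le> 1"
    "\<And>rep f A. rep \<in> borel_measurable borel \<Longrightarrow> (\<And>x. V (rep x) \<le> (1 + \<delta>) * V x) \<Longrightarrow>
       f \<in> borel_measurable borel \<Longrightarrow> 0 \<le> A \<Longrightarrow> weighted_osc_le \<beta> V A f \<Longrightarrow>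
       weighted_osc_le \<beta> V (\<rho> * A) (\<lambda>x. \<integral>y. f (rep y) \<partial>K (rep x))"
proof (rule uniform_harris)
  fix \<gamma> R \<alpha> \<delta> :: real
  assume c: "0 < \<gamma>" "\<gamma> < 1" "2 * (2 * k) < (1 - \<gamma>) * R" "0 < \<alpha>" "\<alpha> < 1" and \<delta>: "0 < \<delta>" "\<delta> \<le> 1"
    and harris: "\<And>rep. rep \<in> borel_measurable borel \<Longrightarrow> (\<And>x. V (rep x) \<le> (1 + \<delta>) * V x) \<Longrightarrow>
       harris_kernel V \<gamma> (2 * k) R \<alpha> (discretised rep)"
  have k2: "0 < 2 * k" using k by simp
  show thesis
  proof (rule harris_contraction[OF c(1,2) k2 c(3,4,5), where 'a='a])
    fix \<beta> \<rho> :: real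
    assume \<beta>: "0 < \<beta>" and \<rho>: "0 < \<rho>" "\<rho> < 1"
      and contr: "\<And>V (K :: 'a \<Rightarrow> 'a measure) f A. harris_kernel V \<gamma> (2 * k) R \<alpha> K \<Longrightarrow> (\<And>x. 1 \<le> V x) \<Longrightarrow>
         f \<in> borel_measurable borel \<Longrightarrow> 0 \<le> A \<Longrightarrow> weighted_osc_le \<beta> V A f \<Longrightarrow>
         weighted_osc_le \<beta> V (\<rho> * A) (\<lambda>x. \<integral>y. f y \<partial>K x)"
    have VV: "V x \<le> (1 + \<delta>) * V x" for x
      using \<delta> V_nonneg[of x] by (simp add: mult_le_cancel_right1 algebra_simps)
    have hK: "harris_kernel V \<gamma> (2 * k) R \<alpha> K"
      using harris[of "\<lambda>x. x"] VV by (simp add: discretised_id)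
    have "ergodic_kernel K \<mu> V \<beta> \<rho>"
    proof (rule ergodic_kernel.intro)
      show "integrable \<mu> (\<lambda>x. (V x)\<^sup>2)"
        by (rule integrableI_nonneg) (use V_square in \<open>auto simp: measurable_cong_sets[OF sets_mu refl]\<close>)
    qed (rule K_measurable K_prob mu_prob sets_mu K_invariant V_measurable V_ge_1 V_kernel \<beta> \<rho> contr[OF hK V_ge_1] | assumption)+
    moreover have "weighted_osc_le \<beta> V (\<rho> * A) (\<lambda>x. \<integral>y. f (rep y) \<partial>K (rep x))"
      if rep [measurable]: "rep \<in> borel_measurable borel" and repV: "\<And>x. V (rep x) \<le> (1 + \<delta>) * V x"
        and f [measurable]: "f \<in> borel_measurable borel" and A: "0 \<le> A" "weighted_osc_le \<beta> V A f" for rep f A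
    proof -
      have repK: "rep \<in> K z \<rightarrow>\<^sub>M borel" for z by (simp add: measurable_cong_sets[OF sets_mh_kernel refl])
      have "(\<lambda>x. \<integral>y. f (rep y) \<partial>K (rep x)) = (\<lambda>x. \<integral>y. f y \<partial>discretised rep x)"
        unfolding discretised_def by (intro ext integral_distr[OF repK, symmetric]) measurable
      then show ?thesis using contr[OF harris[OF rep repV] V_ge_1 f A] by simp
    qed
    ultimately show thesis using that \<delta> by blast
  qed
qed

section \<open>Residuals of discrete solutions\<close>

text \<open>As \<open>g n\<close> agrees at \<open>x\<close> and \<open>z n\<close>, the difference of the rejection terms is \<open>g n x\<close> times a difference of rejection
  probabilities. What remains are integrals against the difference of the transition densities, which
  tends to \<open>0\<close> pointwise and is dominated by a multiple of \<open>\<pi>\<close>; dominated convergence applies with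
  majorant a multiple of \<open>\<pi> * V\<close>.\<close>

lemma kernel_integral_continuous:
  fixes g :: "nat \<Rightarrow> 'a \<Rightarrow> real"
  assumes z: "z \<longlonglongrightarrow> x" and g [measurable]: "\<And>n. g n \<in> borel_measurable borel"
    and A: "0 \<le> A" "\<And>n y. \<bar>g n y\<bar> \<le> A * V y" and gz: "\<And>n. g n (z n) = g n x"
    and V_mu: "integrable \<mu> V"
  shows "(\<lambda>n. (\<integral>y. g n y \<partial>K x) - (\<integral>y. g n y \<partial>K (z n))) \<longlonglongrightarrow> 0"
proof -
  have gK: "integrable (K u) (g n)" for u n
    by (rule Bochner_Integration.integrable_bound[of "K u" "\<lambda>y. A * V y"])
      (use V_kernel A V_nonneg in \<open>auto intro!: AE_I2 simp: measurable_cong_sets[OF sets_mh_kernel refl] abs_mult\<close>)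
  have B: "0 \<le> B" using proposal_pos[of x x] proposal_le[of x x] by linarith
  have "(\<lambda>n. \<pi> (z n)) \<longlonglongrightarrow> \<pi> x"
    using z target_cont continuous_on_tendsto_compose by fastforce
  then have "(\<lambda>n. inverse (\<pi> (z n))) \<longlonglongrightarrow> inverse (\<pi> x)"
    using target_pos[of x] by (intro tendsto_inverse) auto
  then have "Bseq (\<lambda>n. inverse (\<pi> (z n)))" by (intro convergent_imp_Bseq) (auto simp: convergent_def)
  then obtain Q where Q: "0 < Q" "\<And>n. \<bar>inverse (\<pi> (z n))\<bar> \<le> Q" by (auto simp: Bseq_def)
  have Qn: "inverse (\<pi> (z n)) \<le> Q" for n by (rule order_trans[OF abs_ge_self Q(2)])
  define c where "c = B * inverse (\<pi> x) + B * Q"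
  have c: "0 \<le> c" using B Q target_pos[of x] by (simp add: c_def)
  have pdiff: "\<bar>trans_density x y - trans_density (z n) y\<bar> \<le> c * \<pi> y" for n y
  proof -
    have a: "trans_density x y \<le> B * inverse (\<pi> x) * \<pi> y"
      using trans_density_le_target[of x y] by (simp add: field_simps)
    have "trans_density (z n) y \<le> B * inverse (\<pi> (z n)) * \<pi> y"
      using trans_density_le_target[of "z n" y] by (simp add: field_simps)
    also have "\<dots> \<le> B * Q * \<pi> y"
      using Qn[of n] B target_pos[of y] by (intro mult_right_mono mult_left_mono) auto
    finally have b: "trans_density (z n) y \<le> B * Q * \<pi> y" .
    have "\<bar>trans_density x y - trans_density (z n) y\<bar> \<le> trans_density x y + trans_density (z n) y"
      using trans_density_nonneg[of x y] trans_density_nonneg[of "z n" y] by linarith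
    also have "\<dots> \<le> c * \<pi> y" using a b unfolding c_def distrib_right by linarith
    finally show ?thesis .
  qed
  have plim: "(\<lambda>n. trans_density x y - trans_density (z n) y) \<longlonglongrightarrow> 0" for y
  proof -
    have "(\<lambda>n. trans_density (z n) y) \<longlonglongrightarrow> trans_density x y"
      using continuous_on_tendsto_compose[OF trans_density_cont_left z] by simp
    then have "(\<lambda>n. trans_density x y - trans_density (z n) y) \<longlonglongrightarrow> trans_density x y - trans_density x y"
      by (intro tendsto_diff tendsto_const)
    then show ?thesis by simp
  qed
  have piV: "integrable lborel (\<lambda>y. \<pi> y * V y)"
  proof -
    have "integrable (density lborel (\<lambda>y. ennreal (\<pi> y))) V"
      using V_mu by (simp add: target_measure_def)
    then show ?thesis using target_pos by (subst (asm) integrable_density) (auto simp: less_imp_le)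
  qed
  have lim: "(\<lambda>n. \<integral>y. (trans_density x y - trans_density (z n) y) * f n y \<partial>lborel) \<longlonglongrightarrow> 0"
    if [measurable]: "\<And>n. f n \<in> borel_measurable borel" and f: "\<And>n y. \<bar>f n y\<bar> \<le> b * V y" and b: "0 \<le> b"
    for f :: "nat \<Rightarrow> 'a \<Rightarrow> real" and b
  proof -
    have "(\<lambda>n. \<integral>y. (trans_density x y - trans_density (z n) y) * f n y \<partial>lborel) \<longlonglongrightarrow> (\<integral>y. (0 :: real) \<partial>(lborel :: 'a measure))"
    proof (rule integral_dominated_convergence[where w="\<lambda>y. c * b * (\<pi> y * V y)"])
      show "AE y in lborel. (\<lambda>n. (trans_density x y - trans_density (z n) y) * f n y) \<longlonglongrightarrow> 0"
      proof (intro AE_I2)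
        fix y
        have "(\<lambda>n. \<bar>trans_density x y - trans_density (z n) y\<bar> * (b * V y)) \<longlonglongrightarrow> 0"
          by (intro tendsto_mult_left_zero tendsto_rabs_zero plim)
        then show "(\<lambda>n. (trans_density x y - trans_density (z n) y) * f n y) \<longlonglongrightarrow> 0"
          by (rule Lim_null_comparison[rotated])
            (use f in \<open>auto intro!: always_eventually mult_left_mono simp: abs_mult\<close>)
      qed
      show "AE y in lborel. norm ((trans_density x y - trans_density (z n) y) * f n y) \<le> c * b * (\<pi> y * V y)" for n
      proof (intro AE_I2)
        fix y
        have "\<bar>trans_density x y - trans_density (z n) y\<bar> * \<bar>f n y\<bar> \<le> (c * \<pi> y) * (b * V y)"
          using c target_pos[of y] by (intro mult_mono pdiff f) auto
        then show "norm ((trans_density x y - trans_density (z n) y) * f n y) \<le> c * b * (\<pi> y * V y)"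
          by (simp add: abs_mult ac_simps)
      qed
    qed (use piV in auto)
    then show ?thesis by simp
  qed
  have eq: "(\<integral>y. g n y \<partial>K x) - (\<integral>y. g n y \<partial>K (z n))
    = (\<integral>y. (trans_density x y - trans_density (z n) y) * g n y \<partial>lborel)
      - (\<integral>y. (trans_density x y - trans_density (z n) y) * 1 \<partial>lborel) * g n x" for n
  proof -
    have e1: "(\<integral>y. (trans_density x y - trans_density (z n) y) * g n y \<partial>lborel)
      = (\<integral>y. trans_density x y * g n y \<partial>lborel) - (\<integral>y. trans_density (z n) y * g n y \<partial>lborel)"
      using K_integral(1)[OF gK] by (simp add: left_diff_distrib)
    have e2: "(\<integral>y. (trans_density x y - trans_density (z n) y) * 1 \<partial>lborel)
      = reject_prob (z n) - reject_prob x"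
      using trans_density_integrable by (simp add: reject_prob_def)
    show ?thesis
      unfolding K_integral(2)[OF gK] gz e1 e2 by (simp add: algebra_simps)
  qed
  have l1: "(\<lambda>n. \<integral>y. (trans_density x y - trans_density (z n) y) * g n y \<partial>lborel) \<longlonglongrightarrow> 0"
    by (rule lim[OF g A(2) A(1)])
  have "(\<lambda>n. \<integral>y. (trans_density x y - trans_density (z n) y) * 1 \<partial>lborel) \<longlonglongrightarrow> 0"
    by (rule lim[where b=1]) (use V_ge_1 in auto)
  then have "(\<lambda>n. \<bar>\<integral>y. (trans_density x y - trans_density (z n) y) * 1 \<partial>lborel\<bar> * (A * V x)) \<longlonglongrightarrow> 0"
    by (intro tendsto_mult_left_zero tendsto_rabs_zero)
  then have l2: "(\<lambda>n. (\<integral>y. (trans_density x y - trans_density (z n) y) * 1 \<partial>lborel) * g n x) \<longlonglongrightarrow> 0"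
    by (rule Lim_null_comparison[rotated])
      (use A(2) in \<open>auto intro!: always_eventually mult_left_mono simp del: mult_1_right simp: abs_mult\<close>)
  show ?thesis unfolding eq using tendsto_diff[OF l1 l2] by simp
qed

text \<open>The Scheme makes \<open>G n\<close> a fixed point of the discretised kernel plus \<open>F \<circ> rep n\<close>, so its oscillation is bounded
  uniformly in \<open>n\<close>; after subtraction of \<open>G n 0\<close>, which changes no residual, it is dominated by a multiple
  of \<open>V\<close>. Substituting the Scheme into the residual leaves the differences of \<open>F\<close> and of \<open>P (G n)\<close> between \<open>x\<close>
  and \<open>rep n x\<close>.\<close>

lemma residual_variance_tendsto_0:
  fixes \<Phi> :: "nat \<Rightarrow> 'w \<Rightarrow> 'a"
  assumes chain: "markov_chain K M \<Phi>"
    and erg: "ergodic_kernel K \<mu> V \<beta> \<rho>" and \<delta>: "0 < \<delta>" "\<delta> \<le> 1"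
    and contr: "\<And>rep f A. rep \<in> borel_measurable borel \<Longrightarrow> (\<And>x. V (rep x) \<le> (1 + \<delta>) * V x) \<Longrightarrow>
       f \<in> borel_measurable borel \<Longrightarrow> 0 \<le> A \<Longrightarrow> weighted_osc_le \<beta> V A f \<Longrightarrow>
       weighted_osc_le \<beta> V (\<rho> * A) (\<lambda>x. \<integral>y. f (rep y) \<partial>K (rep x))"
    and rep [measurable]: "\<And>n. rep n \<in> borel_measurable borel" and repV: "\<And>n x. V (rep n x) \<le> (1 + \<delta>) * V x"
    and rep_lim: "\<And>x. (\<lambda>n. rep n x) \<longlonglongrightarrow> x"
    and F [measurable]: "F \<in> borel_measurable borel" and b: "0 \<le> b" "\<And>x. \<bar>F x\<bar> \<le> b * V x"
    and F_cont: "AE x in \<mu>. isCont F x"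
    and G [measurable]: "\<And>n. G n \<in> borel_measurable borel" and G_bdd: "\<And>n x. \<bar>G n x\<bar> \<le> S n"
    and G_rep: "\<And>n x. G n (rep n x) = G n x"
    and scheme: "\<And>n x. G n x - (\<integral>y. G n y \<partial>K (rep n x)) = F (rep n x) - c n"
  shows "(\<lambda>n. asymptotic_variance K \<mu> (poisson_residual K F (G n))) \<longlonglongrightarrow> 0"
proof -
  interpret ergodic_kernel K \<mu> V \<beta> \<rho> by (rule erg)
  define A where "A = (4 * b / \<beta>) / (1 - \<rho>)"
  have A0: "0 \<le> A" using b \<beta>_pos \<rho>_less_1 by (simp add: A_def)
  have r2: "V (rep n x) \<le> 2 * V x" for n x
  proof -
    have "(1 + \<delta>) * V x \<le> 2 * V x" using \<delta> V_nonneg[of x] by (intro mult_right_mono) auto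
    then show ?thesis using repV[of n x] by linarith
  qed
  have Frep: "\<bar>F (rep n x)\<bar> \<le> 2 * b * V x" for n x
  proof -
    have "b * V (rep n x) \<le> b * (2 * V x)" using b(1) r2 by (intro mult_left_mono)
    then show ?thesis using b(2)[of "rep n x"] by simp
  qed
  have osc: "weighted_osc_le \<beta> V A (G n)" for n
    unfolding A_def
  proof (rule weighted_osc_le_fixpoint[OF _ \<rho>_less_1 _ _ V_nonneg G_bdd[of n]])
    fix A' :: real assume A': "0 \<le> A'" "weighted_osc_le \<beta> V A' (G n)"
    have T: "weighted_osc_le \<beta> V (\<rho> * A') (\<lambda>x. \<integral>y. G n y \<partial>K (rep n x))"
      using contr[OF rep[of n] repV G[of n] A'] by (simp add: G_rep)
    show "weighted_osc_le \<beta> V (\<rho> * A' + 4 * b / \<beta>) (G n)"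
      unfolding weighted_osc_le_def
    proof (intro allI)
      fix u v
      let ?W = "2 + \<beta> * V u + \<beta> * V v"
      have "\<bar>(\<integral>y. G n y \<partial>K (rep n u)) - (\<integral>y. G n y \<partial>K (rep n v))\<bar> \<le> \<rho> * A' * ?W"
        using T unfolding weighted_osc_le_def by blast
      moreover have "\<bar>F (rep n u) - F (rep n v)\<bar> \<le> 4 * b / \<beta> * ?W"
      proof -
        have "\<bar>F (rep n u) - F (rep n v)\<bar> \<le> 2 * b * V u + 2 * b * V v"
          using Frep[of n u] Frep[of n v] by linarith
        also have "\<dots> \<le> 4 * b / \<beta> * ?W"
        proof -
          have nn: "0 \<le> b * V u" "0 \<le> b * V v" "0 \<le> b / \<beta>" using b V_nonneg \<beta>_pos by auto
          have "2 * b * V u + 2 * b * V v = 2 * (b * V u) + 2 * (b * V v)" by simp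
          also have "\<dots> \<le> 8 * (b / \<beta>) + 4 * (b * V u) + 4 * (b * V v)"
            using nn by (intro add_mono mult_right_mono add_increasing) auto
          also have "\<dots> = 4 * b / \<beta> * ?W" using \<beta>_pos by (simp add: field_simps)
          finally show ?thesis .
        qed
        finally show ?thesis .
      qed
      ultimately show "\<bar>G n u - G n v\<bar> \<le> (\<rho> * A' + 4 * b / \<beta>) * ?W"
        using scheme[of n u] scheme[of n v] unfolding distrib_right by linarith
    qed
  qed (use \<rho>_pos \<beta>_pos b in auto)
  define g where "g n x = G n x - G n 0" for n x
  have [measurable]: "g n \<in> borel_measurable borel" for n unfolding g_def by measurable
  define A' where "A' = A * (2 + \<beta> + \<beta> * V 0)"
  have A'0: "0 \<le> A'" using A0 \<beta>_pos V_nonneg[of 0] by (simp add: A'_def)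
  have gV: "\<bar>g n x\<bar> \<le> A' * V x" for n x
  proof -
    have "\<bar>g n x\<bar> \<le> A * (2 + \<beta> * V x + \<beta> * V 0)" using osc[of n] unfolding weighted_osc_le_def g_def by blast
    also have "\<dots> \<le> A * (2 * V x + \<beta> * V x + \<beta> * V 0 * V x)"
    proof (intro mult_left_mono add_mono A0)
      show "\<beta> * V 0 \<le> \<beta> * V 0 * V x"
        using mult_left_mono[OF V_ge_1[of x], of "\<beta> * V 0"] \<beta>_pos V_nonneg[of 0] by simp
    qed (use V_ge_1[of x] \<beta>_pos in auto)
    also have "\<dots> = A' * V x" by (simp add: A'_def algebra_simps)
    finally show ?thesis .
  qed
  have Gint: "integrable (K x) (G n)" for n x by (rule integrable_bounded(1)[OF G]) (use G_bdd in simp)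
  have gint: "integrable (K x) (g n)" for n x unfolding g_def using Gint by auto
  have gK: "(\<integral>y. g n y \<partial>K x) = (\<integral>y. G n y \<partial>K x) - G n 0" for n x
    unfolding g_def using Gint kernel.prob_space by simp
  have gKV: "\<bar>\<integral>y. g n y \<partial>K x\<bar> \<le> A' * ((l + k) * V x)" for n x
  proof -
    have "\<bar>\<integral>y. g n y \<partial>K x\<bar> \<le> (\<integral>y. \<bar>g n y\<bar> \<partial>K x)" by (rule integral_abs_bound)
    also have "\<dots> \<le> (\<integral>y. A' * V y \<partial>K x)" using gint V_kernel gV by (intro integral_mono) auto
    also have "\<dots> = A' * (\<integral>y. V y \<partial>K x)" by simp
    also have "\<dots> \<le> A' * ((l + k) * V x)"
    proof (rule mult_left_mono[OF _ A'0])
      have "k * 1 \<le> k * V x" using V_ge_1[of x] k by (intro mult_left_mono) auto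
      then show "(\<integral>y. V y \<partial>K x) \<le> (l + k) * V x" using V_kernel_le[of x] by (simp add: distrib_right)
    qed
    finally show ?thesis .
  qed
  define H where "H n = poisson_residual K F (G n)" for n
  have res: "H n x - c n = (F x - F (rep n x)) + ((\<integral>y. g n y \<partial>K x) - (\<integral>y. g n y \<partial>K (rep n x)))" for n x
    using scheme[of n x] by (simp add: H_def poisson_residual_def gK)
  have "(\<lambda>n. asymptotic_variance K \<mu> (H n)) \<longlonglongrightarrow> 0"
  proof (rule asymptotic_variance_tendsto_0[OF chain])
    fix n
    have "H n = (\<lambda>x. F x + kernel_op (G n) x - G n x)"
      by (simp add: fun_eq_iff H_def poisson_residual_def kernel_op_def)
    then show "H n \<in> borel_measurable borel" by simp
    show "0 \<le> 3 * b + 3 * A' * (l + k)" using b A'0 l k by simp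
    fix x
    have "\<bar>\<integral>y. g n y \<partial>K (rep n x)\<bar> \<le> A' * ((l + k) * V (rep n x))" by (rule gKV)
    also have "\<dots> \<le> A' * ((l + k) * (2 * V x))" using r2 l k A'0 by (intro mult_left_mono) auto
    finally have "\<bar>H n x - c n\<bar> \<le> b * V x + 2 * b * V x + A' * ((l + k) * V x) + A' * ((l + k) * (2 * V x))"
      using b(2)[of x] Frep[of n x] gKV[of x n] unfolding res by linarith
    then show "\<bar>H n x - c n\<bar> \<le> (3 * b + 3 * A' * (l + k)) * V x" by (simp add: algebra_simps)
  next
    show "AE x in \<mu>. (\<lambda>n. H n x - c n) \<longlonglongrightarrow> 0"
      using F_cont
    proof eventually_elim
      case (elim x)
      have "(\<lambda>n. F x - F (rep n x)) \<longlonglongrightarrow> F x - F x"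
        by (intro tendsto_diff tendsto_const isCont_tendsto_compose[OF elim rep_lim])
      moreover have "(\<lambda>n. (\<integral>y. g n y \<partial>K x) - (\<integral>y. g n y \<partial>K (rep n x))) \<longlonglongrightarrow> 0"
        by (rule kernel_integral_continuous[OF rep_lim _ A'0 gV _ V_mu]) (auto simp: g_def G_rep)
      ultimately show ?case unfolding res using tendsto_add by fastforce
    qed
  qed
  then show ?thesis by (simp add: H_def)
qed

end

section \<open>Allotments\<close>

text \<open>The representative of the cell that contains \<open>x\<close>, written as a sum so that measurability is immediate.\<close>

definition cell_rep :: "nat \<Rightarrow> (nat \<Rightarrow> 'a::euclidean_space set) \<Rightarrow> (nat \<Rightarrow> 'a) \<Rightarrow> 'a \<Rightarrow> 'a" where
  "cell_rep m J a x = (\<Sum>j\<le>m. indicat_real (J j) x *\<^sub>R a j)"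

lemma sum_cells:
  fixes v :: "nat \<Rightarrow> 'b::real_vector"
  assumes "disjoint_family_on J {..m}" "j \<le> m" "x \<in> J j"
  shows "(\<Sum>i\<le>m. indicat_real (J i) x *\<^sub>R v i) = v j"
proof -
  have "x \<notin> J i" if "i \<le> m" "i \<noteq> j" for i
    using assms that unfolding disjoint_family_on_def by blast
  then have "(\<Sum>i\<le>m. indicat_real (J i) x *\<^sub>R v i) = (\<Sum>i\<le>m. if i = j then v j else 0)"
    using assms(3) by (intro sum.cong refl) (auto simp: indicator_def)
  then show ?thesis using assms(2) by simp
qed

lemma cell_rep_eq:
  assumes "allotment m J a" "j \<le> m" "x \<in> J j"
  shows "cell_rep m J a x = a j"
  unfolding cell_rep_def using assms by (intro sum_cells) (auto simp: allotment_def)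

lemma cell_exists:
  assumes "allotment m J a"
  obtains j where "j \<le> m" "x \<in> J j"
  using assms unfolding allotment_def by blast

lemma cell_rep_measurable:
  assumes "allotment m J a"
  shows "cell_rep m J a \<in> borel_measurable borel"
proof -
  have "J j \<in> sets borel" if "j \<le> m" for j using assms that by (auto simp: allotment_def)
  then show ?thesis unfolding cell_rep_def[abs_def]
    by (intro borel_measurable_sum borel_measurable_scaleR borel_measurable_indicator) auto
qed

text \<open>A supremum bounds its terms only over a set that is bounded above. For the quotients this holds as
  \<open>W \<ge> 1\<close>, for the distances because the cells with positive index are bounded.\<close>

lemma mesh_bounds:
  assumes al: "allotment m J a" and W: "\<And>x. 1 \<le> W x" and j: "j \<le> m" and y: "y \<in> J j"
  shows "W (a j) \<le> (1 + allotment_mesh m J a W) * W y"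
    and "1 \<le> j \<Longrightarrow> norm (y - a j) \<le> allotment_mesh m J a W"
proof -
  have Wpos: "0 < W x" for x using W[of x] by linarith
  let ?S = "(\<lambda>j. SUP y\<in>J j. norm (y - a j)) ` {1..m} \<union> (\<lambda>j. SUP y\<in>J j. W (a j) / W y - 1) ` {0..m}"
  have bdd: "bdd_above ((\<lambda>y. W (a j) / W y - 1) ` J j)"
  proof (rule bdd_aboveI2)
    fix y
    have "W (a j) / W y \<le> W (a j) / 1" using W[of y] Wpos by (intro divide_left_mono) (auto simp: less_imp_le)
    then show "W (a j) / W y - 1 \<le> W (a j)" by simp
  qed
  have "W (a j) / W y - 1 \<le> (SUP y\<in>J j. W (a j) / W y - 1)" by (rule cSUP_upper[OF y bdd])
  also have "\<dots> \<le> allotment_mesh m J a W"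
    unfolding allotment_mesh_def using j by (intro Max_ge) auto
  finally show "W (a j) \<le> (1 + allotment_mesh m J a W) * W y"
    using Wpos[of y] by (simp add: field_simps)
  assume j1: "1 \<le> j"
  have "bounded (J j)"
    using al j j1 unfolding allotment_def by (elim conjE) (erule bounded_subset, auto)
  then obtain r where r: "\<And>y. y \<in> J j \<Longrightarrow> norm y \<le> r" by (auto simp: bounded_iff)
  have bdd: "bdd_above ((\<lambda>y. norm (y - a j)) ` J j)"
  proof (rule bdd_aboveI2)
    fix y assume "y \<in> J j"
    then show "norm (y - a j) \<le> r + norm (a j)" using norm_triangle_ineq4[of y "a j"] r by fastforce
  qed
  have "norm (y - a j) \<le> (SUP y\<in>J j. norm (y - a j))" by (rule cSUP_upper[OF y bdd])
  also have "\<dots> \<le> allotment_mesh m J a W"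
    unfolding allotment_mesh_def using j j1 by (intro Max_ge) auto
  finally show "norm (y - a j) \<le> allotment_mesh m J a W" .
qed

text \<open>Once the radius exceeds \<open>W x\<close>, the point has left the unbounded cell, and the mesh controls its
  distance to the representative.\<close>

lemma cell_rep_tendsto:
  assumes al: "\<And>n. allotment (m n) (J n) (a n)" and W: "\<And>x. 1 \<le> W x" and exh: "exhaustive m J a W"
  shows "(\<lambda>n. cell_rep (m n) (J n) (a n) x) \<longlonglongrightarrow> x"
proof -
  have mesh: "(\<lambda>n. allotment_mesh (m n) (J n) (a n) W) \<longlonglongrightarrow> 0"
    and "filterlim (\<lambda>n. allotment_rad (J n) W) at_top sequentially"
    using exh by (auto simp: exhaustive_def)
  then have "\<forall>\<^sub>F n in sequentially. W x < allotment_rad (J n) W" by (simp add: filterlim_at_top_dense)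
  then have "\<forall>\<^sub>F n in sequentially. norm (cell_rep (m n) (J n) (a n) x - x) \<le> allotment_mesh (m n) (J n) (a n) W"
  proof eventually_elim
    case (elim n)
    obtain j where j: "j \<le> m n" "x \<in> J n j" by (rule cell_exists[OF al])
    have "x \<notin> J n 0"
    proof
      assume "x \<in> J n 0"
      then have "allotment_rad (J n) W \<le> W x"
        unfolding allotment_rad_def using W by (intro cINF_lower bdd_belowI2[where m=1]) auto
      then show False using elim by simp
    qed
    then have "1 \<le> j" using j by (cases j) auto
    then show ?case
      using mesh_bounds(2)[OF al W j] cell_rep_eq[OF al j] by (simp add: norm_minus_commute)
  qed
  then have "(\<lambda>n. cell_rep (m n) (J n) (a n) x - x) \<longlonglongrightarrow> 0"
    by (rule Lim_null_comparison[OF _ mesh])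
  then show ?thesis by (simp add: LIM_zero_iff)
qed

text \<open>The output is constant on cells, so summing against a row of the Scheme's matrix is integrating against the
  kernel at the representative, and the equations for the representatives extend to all points.\<close>

lemma scheme_output_properties:
  assumes al: "allotment m J a" and out: "scheme_output P F m J a Ft"
    and P: "\<And>x. prob_space (P x)" "\<And>x. sets (P x) = sets borel"
  obtains c S where "Ft \<in> borel_measurable borel" "\<And>x. \<bar>Ft x\<bar> \<le> S"
    "\<And>x. Ft (cell_rep m J a x) = Ft x"
    "\<And>x. Ft x - (\<integral>y. Ft y \<partial>P (cell_rep m J a x)) = F (cell_rep m J a x) - c"
proof -
  obtain w fh where eq: "\<And>i. i \<le> m \<Longrightarrow> fh (a i) - (\<Sum>j\<le>m. scheme_matrix P J a i j * fh (a j)) =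
      F (a i) - (\<Sum>j\<le>m. w j * F (a j))" and Ft: "Ft = (\<lambda>x. \<Sum>j\<le>m. fh (a j) * indicator (J j) x)"
    using out unfolding scheme_output_def by blast
  have disj: "disjoint_family_on J {..m}" and Jm: "\<And>j. j \<le> m \<Longrightarrow> J j \<in> sets borel" and aJ: "\<And>j. j \<le> m \<Longrightarrow> a j \<in> J j"
    using al by (auto simp: allotment_def)
  have Ft_cell: "Ft x = fh (a j)" if "j \<le> m" "x \<in> J j" for j x
    using sum_cells[OF disj that, of "\<lambda>i. fh (a i)"] by (simp add: Ft mult.commute)
  have meas: "Ft \<in> borel_measurable borel"
    unfolding Ft using Jm by (intro borel_measurable_sum borel_measurable_times borel_measurable_indicator) auto
  have bdd: "\<bar>Ft x\<bar> \<le> (\<Sum>j\<le>m. \<bar>fh (a j)\<bar>)" for x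
  proof -
    obtain j where j: "j \<le> m" "x \<in> J j" by (rule cell_exists[OF al])
    have "\<bar>fh (a j)\<bar> \<le> (\<Sum>j\<le>m. \<bar>fh (a j)\<bar>)" using j by (intro member_le_sum) auto
    then show ?thesis using Ft_cell[OF j] by simp
  qed
  have int: "(\<integral>y. Ft y \<partial>P z) = (\<Sum>j\<le>m. fh (a j) * measure (P z) (J j))" for z
  proof -
    interpret prob_space "P z" by (rule P)
    have JP: "J j \<in> sets (P z)" if "j \<le> m" for j using Jm[OF that] P(2) by simp
    have "(\<integral>y. Ft y \<partial>P z) = (\<Sum>j\<le>m. \<integral>y. fh (a j) * indicator (J j) y \<partial>P z)"
      unfolding Ft using JP by (intro Bochner_Integration.integral_sum integrable_mult_right integrable_real_indicator)
        (auto simp: less_top[symmetric])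
    also have "\<dots> = (\<Sum>j\<le>m. fh (a j) * measure (P z) (J j))"
      using sets_eq_imp_space_eq[OF P(2)[of z]] by (intro sum.cong refl) simp
    finally show ?thesis .
  qed
  have "Ft (cell_rep m J a x) = Ft x \<and>
    Ft x - (\<integral>y. Ft y \<partial>P (cell_rep m J a x)) = F (cell_rep m J a x) - (\<Sum>j\<le>m. w j * F (a j))" for x
  proof -
    obtain j where j: "j \<le> m" "x \<in> J j" by (rule cell_exists[OF al])
    show ?thesis
      using eq[OF j(1)] Ft_cell[OF j] Ft_cell[OF j(1) aJ[OF j(1)]]
      by (simp add: cell_rep_eq[OF al j] int scheme_matrix_def mult.commute)
  qed
  then show thesis using that meas bdd by blast
qed

lemma L_inf_iff:
  assumes V: "\<And>x. 1 \<le> V x"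
  shows "G \<in> L_inf V \<longleftrightarrow> G \<in> borel_measurable borel \<and> (\<exists>b\<ge>0. \<forall>x. \<bar>G x\<bar> \<le> b * V x)"
proof -
  have Vpos: "0 < V x" for x using V[of x] by linarith
  have "bdd_above (range (\<lambda>x. \<bar>G x\<bar> / V x)) \<longleftrightarrow> (\<exists>b\<ge>0. \<forall>x. \<bar>G x\<bar> \<le> b * V x)"
  proof
    assume "bdd_above (range (\<lambda>x. \<bar>G x\<bar> / V x))"
    then obtain b where b: "\<And>x. \<bar>G x\<bar> / V x \<le> b" by (auto simp: bdd_above_def)
    have "0 \<le> b" using b[of undefined] Vpos[of undefined] by (meson abs_ge_zero divide_nonneg_pos order_trans)
    moreover have "\<bar>G x\<bar> \<le> b * V x" for x using b[of x] Vpos[of x] by (simp add: pos_divide_le_eq)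
    ultimately show "\<exists>b\<ge>0. \<forall>x. \<bar>G x\<bar> \<le> b * V x" by blast
  next
    assume "\<exists>b\<ge>0. \<forall>x. \<bar>G x\<bar> \<le> b * V x"
    then obtain b where "\<And>x. \<bar>G x\<bar> \<le> b * V x" by blast
    then show "bdd_above (range (\<lambda>x. \<bar>G x\<bar> / V x))"
      using Vpos by (intro bdd_aboveI2[where M=b]) (simp add: pos_divide_le_eq)
  qed
  then show ?thesis by (simp add: L_inf_def)
qed

section \<open>Asymptotic solution of the Poisson equation\<close>

theorem theorem2p6:
  fixes \<pi> :: "'a::euclidean_space \<Rightarrow> real"
    and q :: "'a \<Rightarrow> 'a \<Rightarrow> real"
    and V F :: "'a \<Rightarrow> real"
    and M :: "'w measure"
    and \<Phi> :: "nat \<Rightarrow> 'w \<Rightarrow> 'a"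
    and m :: "nat \<Rightarrow> nat"
    and J :: "nat \<Rightarrow> nat \<Rightarrow> 'a set"
    and a :: "nat \<Rightarrow> nat \<Rightarrow> 'a"
    and Ft :: "nat \<Rightarrow> 'a \<Rightarrow> real"
  defines "P \<equiv> mh_kernel \<pi> q"
  assumes target: "prob_density \<pi>"
    and proposal: "\<And>x. prob_density (q x)"
    and A1: "drift_condition P (target_measure \<pi>) V"
    and A2: "continuous_on UNIV \<pi>" "\<And>x. 0 < \<pi> x"
    and A3: "continuous_on UNIV (\<lambda>(x, y). q x y)" "\<And>x y. 0 < q x y" "\<exists>B. \<forall>x y. q x y \<le> B"
    and chain: "markov_chain P M \<Phi>"
    and F: "F \<in> L_inf V" "AE x in target_measure \<pi>. isCont F x"
    and allot: "\<And>n. allotment (m n) (J n) (a n)"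
    and exh: "exhaustive m J a V"
    and scheme: "\<And>n. scheme_output P F (m n) (J n) (a n) (Ft n)"
  shows "asymptotically_solves_poisson P (target_measure \<pi>) V F Ft \<and>
    (\<forall>n. clt_along M \<Phi> (target_measure \<pi>) (poisson_residual P F (Ft n))
       (asymptotic_variance P (target_measure \<pi>) (poisson_residual P F (Ft n))))"
proof -
  obtain B where B: "\<And>x y. q x y \<le> B" using A3(3) by blast
  have V1: "\<And>x. 1 \<le> V x" using A1 by (simp add: drift_condition_def)
  obtain l k C where lk: "0 < l" "l < 1" "0 < k"
    and drift: "\<And>x. (\<integral>\<^sup>+y. ennreal (V y) \<partial>P x) \<le> ennreal (l * V x + k * indicator C x)"
    using A1 unfolding drift_condition_def by blast
  have "(\<integral>\<^sup>+y. ennreal (V y) \<partial>P x) \<le> ennreal (l * V x + k)" for x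
    by (rule order_trans[OF drift]) (use lk in \<open>auto simp: indicator_def intro!: ennreal_leI\<close>)
  then interpret metropolis_hastings_drift \<pi> q B V l k
    using target proposal A1 A2 A3 B lk unfolding P_def drift_condition_def
    by unfold_locales auto
  have chain': "markov_chain K M \<Phi>" using chain by (simp add: P_def)
  obtain b where Fm: "F \<in> borel_measurable borel" and b: "0 \<le> b" "\<And>x. \<bar>F x\<bar> \<le> b * V x"
    using F(1) unfolding L_inf_iff[OF V1] by blast
  let ?rep = "\<lambda>n. cell_rep (m n) (J n) (a n)"
  have "\<exists>c S. Ft n \<in> borel_measurable borel \<and> (\<forall>x. \<bar>Ft n x\<bar> \<le> S) \<and> (\<forall>x. Ft n (?rep n x) = Ft n x) \<and>
      (\<forall>x. Ft n x - (\<integral>y. Ft n y \<partial>K (?rep n x)) = F (?rep n x) - c)" for n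
    by (rule scheme_output_properties[OF allot[of n] scheme[of n, unfolded P_def] K_prob sets_mh_kernel]) blast
  then obtain c S where Ft: "\<And>n. Ft n \<in> borel_measurable borel" "\<And>n x. \<bar>Ft n x\<bar> \<le> S n"
    "\<And>n x. Ft n (?rep n x) = Ft n x"
    "\<And>n x. Ft n x - (\<integral>y. Ft n y \<partial>K (?rep n x)) = F (?rep n x) - c n"
    by metis
  have Ft_L: "Ft n \<in> L_inf V" for n
  proof -
    have S: "0 \<le> S n" using Ft(2)[of n undefined] by linarith
    have "\<bar>Ft n x\<bar> \<le> S n * V x" for x
      using Ft(2)[of n x] mult_left_mono[OF V1[of x] S] by simp
    then show ?thesis unfolding L_inf_iff[OF V1] using Ft(1) S by blast
  qed
  show ?thesis
  proof (rule uniform_contraction)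
    fix \<beta> \<rho> \<delta> :: real
    assume erg: "ergodic_kernel K \<mu> V \<beta> \<rho>" and \<delta>: "0 < \<delta>" "\<delta> \<le> 1"
      and contr: "\<And>rep f A. rep \<in> borel_measurable borel \<Longrightarrow> (\<And>x. V (rep x) \<le> (1 + \<delta>) * V x) \<Longrightarrow>
       f \<in> borel_measurable borel \<Longrightarrow> 0 \<le> A \<Longrightarrow> weighted_osc_le \<beta> V A f \<Longrightarrow>
       weighted_osc_le \<beta> V (\<rho> * A) (\<lambda>x. \<integral>y. f (rep y) \<partial>K (rep x))"
    interpret erg: ergodic_kernel K \<mu> V \<beta> \<rho> by (rule erg)
    have "(\<lambda>n. allotment_mesh (m n) (J n) (a n) V) \<longlonglongrightarrow> 0" using exh by (simp add: exhaustive_def)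
    then have "\<forall>\<^sub>F n in sequentially. allotment_mesh (m n) (J n) (a n) V < \<delta>" using \<delta>(1) by (rule order_tendstoD)
    then obtain n0 where n0: "\<And>n. n0 \<le> n \<Longrightarrow> allotment_mesh (m n) (J n) (a n) V < \<delta>"
      by (auto simp: eventually_sequentially)
    have repV: "V (?rep (n + n0) x) \<le> (1 + \<delta>) * V x" for n x
    proof -
      obtain j where j: "j \<le> m (n + n0)" "x \<in> J (n + n0) j" by (rule cell_exists[OF allot])
      have "V (?rep (n + n0) x) \<le> (1 + allotment_mesh (m (n + n0)) (J (n + n0)) (a (n + n0)) V) * V x"
        unfolding cell_rep_eq[OF allot j] by (rule mesh_bounds(1)[OF allot V1 j])
      also have "\<dots> \<le> (1 + \<delta>) * V x" using n0[of "n + n0"] V_nonneg[of x] by (intro mult_right_mono) auto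
      finally show ?thesis .
    qed
    \<comment> \<open>The uniform estimates hold once the mesh is below \<open>\<delta>\<close>, hence the shift by \<open>n0\<close>.\<close>
    have "(\<lambda>n. asymptotic_variance K \<mu> (poisson_residual K F (Ft (n + n0)))) \<longlonglongrightarrow> 0"
      by (rule residual_variance_tendsto_0[OF chain' erg \<delta> contr cell_rep_measurable[OF allot] repV
            LIMSEQ_ignore_initial_segment[OF cell_rep_tendsto[OF allot V1 exh]] Fm b F(2) Ft(1) Ft(2) Ft(3) Ft(4)])
    then have lim: "(\<lambda>n. asymptotic_variance K \<mu> (poisson_residual K F (Ft n))) \<longlonglongrightarrow> 0"
      by (rule LIMSEQ_offset)
    have clt: "clt_along M \<Phi> \<mu> (poisson_residual K F (Ft n)) (asymptotic_variance K \<mu> (poisson_residual K F (Ft n)))" for n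
    proof -
      have S: "0 \<le> S n" using Ft(2)[of n undefined] by linarith
      have eq: "poisson_residual K F (Ft n) = (\<lambda>x. F x + erg.kernel_op (Ft n) x - Ft n x)"
        by (simp add: fun_eq_iff poisson_residual_def erg.kernel_op_def)
      have KS: "\<bar>erg.kernel_op (Ft n) x\<bar> \<le> S n" for x
        using erg.norm_kernel_op_le[OF Ft(1)[of n], of "S n" x] Ft(2) by simp
      show ?thesis
      proof (rule erg.clt_asymptotic_variance[OF chain'])
        show "poisson_residual K F (Ft n) \<in> borel_measurable borel"
          unfolding eq using Fm Ft(1)[of n] erg.kernel_op_measurable[OF Ft(1)[of n]] by simp
        show "0 \<le> b + 2 * S n" using b S by simp
        fix x
        have "S n * 1 \<le> S n * V x" using V1[of x] S by (rule mult_left_mono)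
        then show "\<bar>poisson_residual K F (Ft n) x\<bar> \<le> (b + 2 * S n) * V x"
          using b(2)[of x] KS[of x] Ft(2)[of n x] unfolding eq by (simp add: distrib_right)
      qed
    qed
    show ?thesis
      unfolding asymptotically_solves_poisson_def P_def using lim Ft_L clt by blast
  qed
qed

end
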